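(* Let $s,t>0$ with $0<s,t<n$ and $u=s+t-n>0$, and let $\mu,\nu\in\mathcal M(\mathbb{R}^n)$ with $I_s(\mu)<\infty$ and $I_t(\nu)<\infty$. Let $\beta>0$ with $u>n-\beta$, and let $\theta$ be a Radon measure on $O(n)$ with $\theta(O(n))\le 1$ such that $\theta(\{g\in O(n):|x-g(z)|<r\})\le (r/|z|)^\beta$ for all $x,z\in\mathbb{R}^n\setminus\{0\}$, $r>0$. Then for $\theta\times\mathcal L^n$ almost all $(g,z)\in O(n)\times\mathbb{R}^n$, as $\varepsilon\to0$ the measures $\nu_{g,g^{-1}(z),\varepsilon}\mu$ converge weakly to a Radon measure $\lambda_{g,z}$, and: (a) $\operatorname{spt}\lambda_{g,z}\subset\operatorname{spt}\mu\cap(g(\operatorname{spt}\nu)+z)$; (b) for $\theta$ almost all $g\in O(n)$, $\int\lambda_{g,z}(\mathbb{R}^n)\,d\mathcal L^n z=\mu(\mathbb{R}^n)\nu(\mathbb{R}^n)$; (c) $\iint I_u(\lambda_{g,z})\,d\mathcal L^n z\,d\theta g\le C\,I_s(\mu)I_t(\nu)$, where $C$ depends only on $n,s,t,\beta$.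
   Context: $O(n)$ is the orthogonal group of $\mathbb{R}^n$; $\mathcal M(\mathbb{R}^n)$ is the set of non-zero compactly supported Radon measures on $\mathbb{R}^n$; $\operatorname{spt}$ denotes support; $I_s(\mu)=\iint|x-y|^{-s}\,d\mu x\,d\mu y$. Fix a non-negative $C^\infty$ function $\psi$ supported in the unit ball with $\int\psi=1$, $\psi_\varepsilon(x)=\varepsilon^{-n}\psi(x/\varepsilon)$, $\nu_\varepsilon=\psi_\varepsilon*\nu$, and for $g\in O(n)$, $w\in\mathbb{R}^n$, $\nu_{g,w,\varepsilon}(x)=\nu_\varepsilon(g^{-1}(x)-w)$; $\nu_{g,w,\varepsilon}\mu$ is the measure with density $\nu_{g,w,\varepsilon}$ with respect to $\mu$. $\mathcal L^n$ is Lebesgue measure. *)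

theory Defs
  imports "HOL-Analysis.Analysis"
begin

fun Ck :: "nat \<Rightarrow> ('a::euclidean_space \<Rightarrow> real) \<Rightarrow> bool" where
  "Ck 0 f = continuous_on UNIV f"
| "Ck (Suc k) f = ((\<forall>x. f differentiable (at x)) \<and>
      (\<forall>i\<in>Basis. Ck k (\<lambda>x. frechet_derivative f (at x) i)))"

definition smooth_fun :: "('a::euclidean_space \<Rightarrow> real) \<Rightarrow> bool" where
  "smooth_fun f \<longleftrightarrow> (\<forall>k. Ck k f)"

definition mollifier :: "(real^'n \<Rightarrow> real) \<Rightarrow> bool" where
  "mollifier \<psi> \<longleftrightarrow> (\<forall>x. \<psi> x \<ge> 0) \<and> smooth_fun \<psi> \<and>
      (\<forall>x. norm x > 1 \<longrightarrow> \<psi> x = 0) \<and> integral\<^sup>L lborel \<psi> = 1"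

definition spt :: "'a::metric_space measure \<Rightarrow> 'a set" where
  "spt M = {x. \<forall>r>0. emeasure M (ball x r) > 0}"

definition radon_measure :: "'a::euclidean_space measure \<Rightarrow> bool" where
  "radon_measure M \<longleftrightarrow> sets M = sets borel \<and> (\<forall>K. compact K \<longrightarrow> emeasure M K < \<infinity>)"

definition cs_radon :: "'a::euclidean_space measure \<Rightarrow> bool" where
  "cs_radon M \<longleftrightarrow> radon_measure M \<and> compact (spt M) \<and> emeasure M UNIV \<noteq> 0"

definition riesz_energy :: "real \<Rightarrow> 'a::euclidean_space measure \<Rightarrow> ennreal" where
  "riesz_energy s M = (\<integral>\<^sup>+x. (\<integral>\<^sup>+y. (if x = y then \<infinity> else ennreal (dist x y powr (-s))) \<partial>M) \<partial>M)"

definition moll_eps :: "(real^'n \<Rightarrow> real) \<Rightarrow> real \<Rightarrow> real^'n \<Rightarrow> real" where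
  "moll_eps \<psi> \<epsilon> x = (1/\<epsilon>) ^ CARD('n) * \<psi> ((1/\<epsilon>) *\<^sub>R x)"

definition smooth_meas :: "(real^'n \<Rightarrow> real) \<Rightarrow> real \<Rightarrow> (real^'n) measure \<Rightarrow> real^'n \<Rightarrow> real" where
  "smooth_meas \<psi> \<epsilon> \<nu> x = (\<integral>y. moll_eps \<psi> \<epsilon> (x - y) \<partial>\<nu>)"

definition smooth_meas_gw :: "(real^'n \<Rightarrow> real) \<Rightarrow> (real^'n) measure \<Rightarrow> real^'n^'n \<Rightarrow> real^'n
     \<Rightarrow> real \<Rightarrow> real^'n \<Rightarrow> real" where
  "smooth_meas_gw \<psi> \<nu> g w \<epsilon> x = smooth_meas \<psi> \<epsilon> \<nu> (matrix_inv g *v x - w)"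

definition weak_conv_at0 :: "(real \<Rightarrow> 'a::euclidean_space measure) \<Rightarrow> 'a measure \<Rightarrow> bool" where
  "weak_conv_at0 M L \<longleftrightarrow> (\<forall>f::'a \<Rightarrow> real. continuous_on UNIV f \<and> compact (closure {x. f x \<noteq> 0})
      \<longrightarrow> ((\<lambda>\<epsilon>. integral\<^sup>L (M \<epsilon>) f) \<longlongrightarrow> integral\<^sup>L L f) (at_right 0))"

end

theory Submission
  imports Defs "HOL-Probability.Probability"
begin

text \<open>
  For fixed \<open>g\<close> the measures \<open>\<lambda>\<^bsub>g,z\<^esub>\<close> are the slices of \<open>\<mu> \<times> \<nu>\<close> along the fibres of
  \<open>(x, y) \<mapsto> x - g y\<close>. On the Fourier side, with \<open>u = s + t - n\<close>, the integral over \<open>z\<close> of the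
  \<open>u\<close>-energies of the mollified slices is at most a constant times
  \<open>\<integral>\<integral> |\<xi> + g \<zeta>|\<^bsup>u-n\<^esup> |\<mu>^(\<xi>)|\<^sup>2 |\<nu>^(\<zeta>)|\<^sup>2 d\<xi> d\<zeta>\<close>, uniformly in \<open>\<epsilon>\<close>. Since \<open>n - u < \<beta>\<close>, integrating over \<open>\<theta>\<close>
  replaces the kernel by a multiple of \<open>max(|\<xi>|, |\<zeta>|)\<^bsup>u-n\<^esup> \<le> |\<xi>|\<^bsup>s-n\<^esup> |\<zeta>|\<^bsup>t-n\<^esup>\<close>, which gives
  \<open>I\<^sub>s(\<mu>) I\<^sub>t(\<nu>)\<close>.

  For almost every \<open>g\<close> this bounds the mollifications of the image of \<open>\<mu> \<times> \<nu>\<close> in \<open>L\<^sup>2\<close>, so the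
  image is absolutely continuous and Lebesgue differentiation yields, for almost every \<open>z\<close>, the
  convergence of \<open>\<integral> f \<nu>\<^bsub>g,z,\<epsilon>\<^esub> d\<mu>\<close> for countably many monomials \<open>f\<close>; the Stone--Weierstrass theorem
  and weak compactness upgrade this to weak convergence.

  No Fourier inversion or Plancherel theorem is used: Riesz kernels are mixtures of Gaussians, and
  for a Gaussian weight every identity is an instance of Fubini's theorem.
\<close>

section \<open>Gaussians and their Fourier transform\<close>

text \<open>The claim is about almost every pair (g, z) and a limit over all real \<epsilon>. Weak
  convergence must therefore be recast as a condition that is measurable in (g, z): convergence of
  the integrals of all coordinate monomials, where by continuity in \<epsilon> > 0 only rational
  scales matter. The null sets of z belonging to single g then combine to a null set of pairs.

  The L2 bound for the masses comes from the energies: the slices live in a ball carrying \<mu>,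
  where the Riesz kernel is bounded below, so the squared mass is at most a constant times the
  energy. Energies pass to the limit by Fatou's lemma, applied first in the frequency and then in z;
  both rest on the bound being uniform in \<epsilon>.

  The exponent n - u equals (n - s) + (n - t), which is why a power of the maximum of the two
  frequencies splits into one factor for \<mu> and one for \<nu>. The assumption u > n - \<beta>
  says that the ratio 2 powr (n - u - \<beta>) of the dyadic series is below 1. All constants are
  fixed before any measure is introduced, so the final one depends on n, s, t, \<beta> only.\<close>

definition gauss :: "real \<Rightarrow> 'a::euclidean_space \<Rightarrow> real" where
  "gauss a \<xi> = (1 / sqrt (2 * pi * a)) ^ DIM('a) * exp (- (norm \<xi>)\<^sup>2 / (2 * a))"

text \<open>\<open>gauss a\<close> is the centred normal density whose covariance is
  \<open>a\<close> times the identity, hence independent coordinates of variance \<open>a\<close>.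
  The product form reduces its Fourier integral to dimension one.\<close>

lemma gauss_prod:
  assumes "a > 0"
  shows "gauss a (\<xi>::'a::euclidean_space) = (\<Prod>b\<in>Basis. normal_density 0 (sqrt a) (\<xi> \<bullet> b))"
proof -
  have n: "(norm \<xi>)\<^sup>2 = (\<Sum>b\<in>Basis. (\<xi> \<bullet> b)\<^sup>2)"
    by (subst norm_eq_sqrt_inner) (simp add: euclidean_inner[of \<xi> \<xi>] power2_eq_square sum_nonneg)
  show ?thesis
    using assms unfolding gauss_def normal_density_def n
    by (simp add: prod_dividef prod.distrib exp_sum[symmetric] sum_negf sum_divide_distrib power_divide)
qed

lemma gauss_nonneg [simp]: "a \<ge> 0 \<Longrightarrow> gauss a \<xi> \<ge> 0"
  by (simp add: gauss_def)

lemma gauss_pos: "a > 0 \<Longrightarrow> gauss a \<xi> > 0"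
  by (simp add: gauss_def)

lemma gauss_measurable [measurable (raw)]:
  assumes "f \<in> borel_measurable M" "g \<in> borel_measurable M"
  shows "(\<lambda>x. gauss (f x) (g x)) \<in> borel_measurable M"
  using assms unfolding gauss_def by measurable

text \<open>A rescaling of the characteristic function of the standard normal distribution.\<close>

lemma normal_fourier:
  assumes "\<sigma> > 0"
  shows "integrable lborel (\<lambda>y. complex_of_real (normal_density 0 \<sigma> y) * cis (t * y))"
    and "(\<integral>y. complex_of_real (normal_density 0 \<sigma> y) * cis (t * y) \<partial>lborel) = complex_of_real (exp (- (\<sigma> * t)\<^sup>2 / 2))"
proof -
  have i: "integrable lborel (normal_density 0 \<sigma>)" using assms by simp
  show "integrable lborel (\<lambda>y. complex_of_real (normal_density 0 \<sigma> y) * cis (t * y))"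
    by (rule Bochner_Integration.integrable_bound[OF i]) (auto simp: norm_mult cis_conv_exp)
  have "complex_of_real (exp (- ((\<sigma> * t)\<^sup>2) / 2)) = char std_normal_distribution (\<sigma> * t)"
    by (simp add: char_std_normal_distribution)
  also have "\<dots> = (\<integral>y. std_normal_density y *\<^sub>R iexp (\<sigma> * t * y) \<partial>lborel)"
    unfolding char_def by (subst integral_density) auto
  also have "\<dots> = (\<integral>y. \<bar>\<sigma>\<bar> *\<^sub>R (complex_of_real (normal_density 0 \<sigma> (0 + \<sigma> * y)) * cis (t * (0 + \<sigma> * y))) \<partial>lborel)"
    using assms
    by (intro Bochner_Integration.integral_cong)
       (auto simp: normal_density_def cis_conv_exp power_mult_distrib scaleR_conv_of_real
          real_sqrt_mult mult_ac)
  also have "\<dots> = (\<integral>y. complex_of_real (normal_density 0 \<sigma> y) * cis (t * y) \<partial>lborel)"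
    using assms by (subst (2) lborel_integral_real_affine[where c=\<sigma> and t=0]) auto
  finally show "(\<integral>y. complex_of_real (normal_density 0 \<sigma> y) * cis (t * y) \<partial>lborel) = complex_of_real (exp (- (\<sigma> * t)\<^sup>2 / 2))"
    by simp
qed

lemma cis_sum: "finite A \<Longrightarrow> cis (\<Sum>b\<in>A. f b) = (\<Prod>b\<in>A. cis (f b))"
  by (induction A rule: finite_induct) (auto simp: cis_mult[symmetric])

text \<open>Both factors of the integrand are products over the coordinates, so Fubini's theorem on
  a product of real lines reduces everything to \<open>normal_fourier\<close> with standard
  deviation \<open>sqrt a\<close>.\<close>

lemma gauss_fourier:
  assumes "a > 0"
  shows "integrable lborel (\<lambda>\<xi>::'a::euclidean_space. complex_of_real (gauss a \<xi>) * cis (\<xi> \<bullet> x))" (is ?A)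
    and "(\<integral>\<xi>. complex_of_real (gauss a \<xi>) * cis (\<xi> \<bullet> x) \<partial>lborel) = complex_of_real (exp (- a * (norm x)\<^sup>2 / 2))" (is ?B)
proof -
  interpret product_sigma_finite "\<lambda>_::'a. lborel :: real measure" ..
  let ?g = "\<lambda>b y. complex_of_real (normal_density 0 (sqrt a) y) * cis ((x \<bullet> b) * y)"
  have e: "complex_of_real (gauss a \<xi>) * cis (\<xi> \<bullet> x) = (\<Prod>b\<in>Basis. ?g b (\<xi> \<bullet> b))" for \<xi> :: 'a
    using assms
    by (simp add: gauss_prod prod.distrib cis_sum[symmetric] euclidean_inner[of \<xi> x] mult.commute)
  have e2: "(\<Prod>b\<in>Basis. ?g b ((\<Sum>b'\<in>Basis. f b' *\<^sub>R b') \<bullet> b)) = (\<Prod>b\<in>Basis. ?g b (f b))" for f :: "'a \<Rightarrow> real"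
    by (intro prod.cong) (auto simp: inner_sum_left inner_Basis if_distrib cong: if_cong)
  have m1[measurable]: "(\<lambda>\<xi>::'a. \<Prod>b\<in>Basis. ?g b (\<xi> \<bullet> b)) \<in> borel_measurable borel"
    by (simp add: cis_conv_exp)
  have m2[measurable]: "(\<lambda>f. \<Sum>b\<in>Basis. f b *\<^sub>R b) \<in> (\<Pi>\<^sub>M b\<in>(Basis::'a set). lborel) \<rightarrow>\<^sub>M borel"
    by simp
  have sa: "sqrt a > 0" using assms by simp
  have "integrable (Pi\<^sub>M (Basis::'a set) (\<lambda>_. lborel)) (\<lambda>f. \<Prod>b\<in>Basis. ?g b (f b))"
    by (intro product_integrable_prod normal_fourier sa) auto
  then show ?A
    unfolding e by (subst lborel_eq) (simp add: integrable_distr_eq e2)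
  have "(\<integral>\<xi>. complex_of_real (gauss a \<xi>) * cis (\<xi> \<bullet> x) \<partial>lborel)
     = (\<integral>f. (\<Prod>b\<in>Basis. ?g b (f b)) \<partial>Pi\<^sub>M (Basis::'a set) (\<lambda>_. lborel))"
    unfolding e by (subst lborel_eq) (simp add: integral_distr e2)
  also have "\<dots> = (\<Prod>b\<in>(Basis::'a set). complex_of_real (exp (- (sqrt a * (x \<bullet> b))\<^sup>2 / 2)))"
    by (subst product_integral_prod) (auto intro!: normal_fourier(1) sa prod.cong simp: normal_fourier(2)[OF sa])
  also have "\<dots> = complex_of_real (exp (- a * (norm x)\<^sup>2 / 2))"
  proof -
    have n: "(norm x)\<^sup>2 = (\<Sum>b\<in>Basis. (x \<bullet> b)\<^sup>2)"
      by (subst norm_eq_sqrt_inner) (simp add: euclidean_inner[of x x] power2_eq_square sum_nonneg)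
    show ?thesis using assms
      by (simp add: n exp_sum[symmetric] power_mult_distrib sum_distrib_left sum_negf sum_divide_distrib
           flip: of_real_prod)
  qed
  finally show ?B .
qed

lemma gauss_integral:
  assumes "a > 0"
  shows "integrable lborel (gauss a :: 'a::euclidean_space \<Rightarrow> real)" "(\<integral>\<xi>. gauss a (\<xi>::'a) \<partial>lborel) = 1"
proof -
  have i: "integrable lborel (\<lambda>\<xi>::'a. complex_of_real (gauss a \<xi>))"
    using gauss_fourier(1)[OF assms, of 0] by simp
  then show "integrable lborel (gauss a :: 'a::euclidean_space \<Rightarrow> real)"
    by (simp only: complex_of_real_integrable_eq)
  show "(\<integral>\<xi>. gauss a (\<xi>::'a) \<partial>lborel) = 1"
    using gauss_fourier(2)[OF assms, of 0] i
    by simp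
qed

lemma measurable_cis [measurable (raw)]:
  "f \<in> borel_measurable M \<Longrightarrow> (\<lambda>x. cis (f x)) \<in> borel_measurable M"
  by (simp add: cis_conv_exp)

lemma measurable_cnj [measurable (raw)]:
  "f \<in> borel_measurable M \<Longrightarrow> (\<lambda>x. cnj (f x)) \<in> borel_measurable M"
  by (rule measurable_compose[where N=borel]) (auto intro!: borel_measurable_continuous_onI continuous_intros)

text \<open>Expanding the square and integrating in \<open>\<xi>\<close> first.\<close>

lemma gauss_quadratic:
  fixes f :: "'p \<Rightarrow> complex" and w :: "'p \<Rightarrow> 'a::euclidean_space"
  assumes sf: "sigma_finite_measure P" and f: "integrable P f" and w[measurable]: "w \<in> P \<rightarrow>\<^sub>M borel" and a: "a > 0"
  defines "h \<equiv> \<lambda>\<xi>. \<integral>p. f p * cis (\<xi> \<bullet> w p) \<partial>P"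
  shows "integrable lborel (\<lambda>\<xi>. gauss a \<xi> * (cmod (h \<xi>))\<^sup>2)" (is ?A)
    and "complex_of_real (\<integral>\<xi>. gauss a \<xi> * (cmod (h \<xi>))\<^sup>2 \<partial>lborel)
      = (\<integral>p. \<integral>q. f p * cnj (f q) * complex_of_real (exp (- a * (norm (w p - w q))\<^sup>2 / 2)) \<partial>P \<partial>P)" (is ?B)
proof -
  interpret sigma_finite_measure P by fact
  interpret PP: pair_sigma_finite P P ..
  interpret PL: pair_sigma_finite P "lborel :: 'a measure" ..
  interpret PPs: sigma_finite_measure "P \<Otimes>\<^sub>M P" ..
  interpret PPL: pair_sigma_finite "P \<Otimes>\<^sub>M P" "lborel :: 'a measure" ..
  have [measurable]: "f \<in> borel_measurable P" using f by auto
  let ?F = "\<lambda>p q (\<xi>::'a). (f p * cis (\<xi> \<bullet> w p)) * cnj (f q * cis (\<xi> \<bullet> w q)) * complex_of_real (gauss a \<xi>)"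
  \<comment> \<open>The two exponentials combine to one that depends on \<open>w p - w q\<close>
    only; its Gaussian integral in the frequency is \<open>gauss_fourier\<close>.\<close>
  have F2: "?F p q \<xi> = f p * cnj (f q) * (complex_of_real (gauss a \<xi>) * cis (\<xi> \<bullet> (w p - w q)))" for p q \<xi>
    by (simp add: cis_cnj inner_diff_right cis_divide[symmetric] divide_inverse cis_inverse)
  have ig: "integrable P (\<lambda>p. f p * cis (\<xi> \<bullet> w p))" for \<xi>
    by (rule Bochner_Integration.integrable_bound[OF f]) (auto simp: norm_mult)
  have int2: "integrable (P \<Otimes>\<^sub>M P) (\<lambda>(p,q). norm (f p) * norm (f q))"
    using f by (intro PP.Fubini_integrable) (auto intro!: integrable_norm)
  \<comment> \<open>The modulus of \<open>?F\<close> equals this product, which justifies the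
    exchange with the frequency integral.\<close>
  have int3: "integrable ((P \<Otimes>\<^sub>M P) \<Otimes>\<^sub>M lborel) (\<lambda>(pq,\<xi>). (norm (f (fst pq)) * norm (f (snd pq))) * gauss a (\<xi>::'a))"
    using gauss_integral[OF a, where 'a='a] int2 a
    by (intro PPL.Fubini_integrable) (auto simp: case_prod_unfold abs_mult intro!: integrable_mult_right)
  have intF: "integrable ((P \<Otimes>\<^sub>M P) \<Otimes>\<^sub>M lborel) (\<lambda>(pq,\<xi>). ?F (fst pq) (snd pq) \<xi>)"
    by (rule Bochner_Integration.integrable_bound[OF int3]) (auto simp: norm_mult case_prod_beta)
  have s1: "(\<integral>pq. ?F (fst pq) (snd pq) \<xi> \<partial>(P \<Otimes>\<^sub>M P)) = complex_of_real (gauss a \<xi> * (cmod (h \<xi>))\<^sup>2)" for \<xi>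
  proof -
    have "integrable (P \<Otimes>\<^sub>M P) (\<lambda>(p,q). (f p * cis (\<xi> \<bullet> w p)) * cnj (f q * cis (\<xi> \<bullet> w q)))"
      by (rule Bochner_Integration.integrable_bound[OF int2]) (auto simp: norm_mult case_prod_beta)
    then have "(\<integral>pq. (f (fst pq) * cis (\<xi> \<bullet> w (fst pq))) * cnj (f (snd pq) * cis (\<xi> \<bullet> w (snd pq))) \<partial>(P \<Otimes>\<^sub>M P))
       = (\<integral>p. \<integral>q. (f p * cis (\<xi> \<bullet> w p)) * cnj (f q * cis (\<xi> \<bullet> w q)) \<partial>P \<partial>P)"
      by (subst PP.integral_fst'[symmetric]) (auto simp: case_prod_unfold)
    also have "\<dots> = h \<xi> * cnj (h \<xi>)"
      using ig by (simp add: h_def flip: Bochner_Integration.integral_cnj)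
    finally show ?thesis
      using complex_norm_square[of "h \<xi>"] by simp
  qed
  have "integrable lborel (\<lambda>\<xi>. \<integral>pq. ?F (fst pq) (snd pq) \<xi> \<partial>(P \<Otimes>\<^sub>M P))"
    using PPL.integrable_snd[of "\<lambda>pq \<xi>. ?F (fst pq) (snd pq) \<xi>"] intF by simp
  then have "integrable lborel (\<lambda>\<xi>. complex_of_real (gauss a \<xi> * (cmod (h \<xi>))\<^sup>2))" unfolding s1 .
  then show ?A by (simp only: complex_of_real_integrable_eq)
  have "complex_of_real (\<integral>\<xi>. gauss a \<xi> * (cmod (h \<xi>))\<^sup>2 \<partial>lborel) = (\<integral>\<xi>. \<integral>pq. ?F (fst pq) (snd pq) \<xi> \<partial>(P \<Otimes>\<^sub>M P) \<partial>lborel)"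
    unfolding s1 by (rule integral_complex_of_real[symmetric])
  also have "\<dots> = (\<integral>pq. \<integral>\<xi>. ?F (fst pq) (snd pq) \<xi> \<partial>lborel \<partial>(P \<Otimes>\<^sub>M P))"
    using intF by (intro PPL.Fubini_integral) auto
  also have "\<dots> = (\<integral>pq. f (fst pq) * cnj (f (snd pq)) * complex_of_real (exp (- a * (norm (w (fst pq) - w (snd pq)))\<^sup>2 / 2)) \<partial>(P \<Otimes>\<^sub>M P))"
    unfolding F2 by (simp add: gauss_fourier[OF a] flip: integral_mult_right_zero)
  also have "\<dots> = (\<integral>p. \<integral>q. f p * cnj (f q) * complex_of_real (exp (- a * (norm (w p - w q))\<^sup>2 / 2)) \<partial>P \<partial>P)"
  proof -
    have "integrable (P \<Otimes>\<^sub>M P) (\<lambda>(p,q). f p * cnj (f q) * complex_of_real (exp (- a * (norm (w p - w q))\<^sup>2 / 2)))"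
      using a by (intro Bochner_Integration.integrable_bound[OF int2])
        (auto simp: norm_mult case_prod_beta intro!: mult_left_le)
    then show ?thesis by (subst PP.integral_fst'[symmetric]) (auto simp: case_prod_unfold)
  qed
  finally show ?B .
qed

section \<open>Riesz kernels as mixtures of Gaussians\<close>

text \<open>The value at the origin matches the diagonal convention of \<open>riesz_energy\<close>,
  under which atoms have infinite energy. The same kernel serves on the Fourier side, with exponent
  n - s.\<close>

definition rk :: "real \<Rightarrow> 'a::euclidean_space \<Rightarrow> ennreal" where
  "rk s x = (if x = 0 then \<infinity> else ennreal (norm x powr (-s)))"

lemma rk_measurable [measurable (raw)]:
  assumes "f \<in> borel_measurable M"
  shows "(\<lambda>x. rk s (f x)) \<in> borel_measurable M"
  using assms unfolding rk_def by measurable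

lemma riesz_energy_rk: "riesz_energy s M = (\<integral>\<^sup>+x. \<integral>\<^sup>+y. rk s (x - y) \<partial>M \<partial>M)"
  unfolding riesz_energy_def rk_def by (intro nn_integral_cong) (simp add: dist_norm)

text \<open>Sign and normalisation are those of a characteristic function, hence the factor
  \<open>(2 * pi) ^ DIM('a)\<close> in \<open>parseval_le\<close>.\<close>

definition four :: "'a::euclidean_space measure \<Rightarrow> 'a \<Rightarrow> complex" where
  "four M \<xi> = (\<integral>x. cis (\<xi> \<bullet> x) \<partial>M)"

lemma gauss_scale:
  assumes "r > 0"
  shows "gauss (r\<^sup>2 * a) (r *\<^sub>R \<xi>) = gauss a (\<xi>::'a::euclidean_space) / r ^ DIM('a)"
  using assms unfolding gauss_def
  by (simp add: real_sqrt_mult power_mult_distrib field_simps)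

text \<open>A radial homogeneous function is determined off the origin by one value. At the origin,
  a finite value would be fixed under multiplication by \<open>2 powr (-p) < 1\<close> and so
  vanish, against \<open>0 < H y\<close> and \<open>H y \<le> H 0\<close>. Both Gaussian mixtures
  are identified in this way, so each has to be controlled at a single point only.\<close>

lemma homogeneous_eq_rk:
  fixes H :: "'a::euclidean_space \<Rightarrow> ennreal"
  assumes hom: "\<And>r x. r > 0 \<Longrightarrow> H (r *\<^sub>R x) = ennreal (r powr (-p)) * H x"
    and rad: "\<And>x y. norm x = norm y \<Longrightarrow> H x = H y"
    and y: "y \<noteq> 0" "0 < H y" "H y < \<infinity>" "H y \<le> H 0" and p: "p > 0"
  obtains c where "c > 0" "\<And>x. H x = ennreal c * rk p x"
proof -
  obtain h where h: "H y = ennreal h" "h > 0"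
    using y by (cases "H y") auto
  define c where "c = h * norm y powr p"
  have H0: "H 0 = \<infinity>"
  proof (rule ccontr)
    assume "H 0 \<noteq> \<infinity>"
    then obtain k where k: "H 0 = ennreal k" "k \<ge> 0"
      by (cases "H 0") auto
    have "H (2 *\<^sub>R 0) = ennreal (2 powr (-p)) * H 0" by (rule hom) simp
    then have "k = 2 powr (-p) * k" using k by (simp flip: ennreal_mult)
    moreover have "k \<ge> h" using y k h by simp
    moreover have "2 powr (-p) < (1::real)" using p by (simp add: powr_less_one)
    ultimately show False using h by simp
  qed
  have "H x = ennreal c * rk p x" for x
  proof (cases "x = 0")
    case True
    have "c > 0" using h y(1) unfolding c_def by simp
    then show ?thesis using True H0 by (simp add: rk_def ennreal_mult_top)
  next
    case False
    let ?r = "norm x / norm y"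
    have "H x = H (?r *\<^sub>R y)" using y by (intro rad) simp
    also have "\<dots> = ennreal (?r powr (-p)) * ennreal h" unfolding h(1)[symmetric] using y False by (intro hom) simp
    also have "\<dots> = ennreal c * rk p x"
      using False y h unfolding c_def rk_def
      by (simp add: powr_divide powr_minus field_simps flip: ennreal_mult)
    finally show ?thesis .
  qed
  moreover have "c > 0" using h y(1) unfolding c_def by simp
  ultimately show thesis using that by blast
qed

text \<open>The mixing density. Its exponent is chosen so that the substitution of
  \<open>r\<^sup>2 * a\<close> for \<open>a\<close> multiplies the measure with this density by
  \<open>r powr u\<close>, see \<open>rk_weight_scale\<close>.\<close>

definition rk_weight :: "real \<Rightarrow> real \<Rightarrow> ennreal" where
  "rk_weight u a = ennreal (a powr (u / 2 - 1)) * indicator {0<..} a"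

lemma rk_weight_measurable [measurable]: "rk_weight u \<in> borel_measurable borel"
  unfolding rk_weight_def by measurable

lemma rk_weight_scale:
  assumes "r > 0" "f \<in> borel_measurable borel"
  shows "(\<integral>\<^sup>+a. rk_weight u a * f a \<partial>lborel) = ennreal (r powr u) * (\<integral>\<^sup>+a. rk_weight u a * f (r\<^sup>2 * a) \<partial>lborel)"
proof -
  have [measurable]: "f \<in> borel_measurable borel" by fact
  have w: "ennreal (r\<^sup>2) * rk_weight u (r\<^sup>2 * a) = ennreal (r powr u) * rk_weight u a" for a
  proof (cases "a > 0")
    case True
    have "r\<^sup>2 * (r\<^sup>2 * a) powr (u / 2 - 1) = r powr u * a powr (u / 2 - 1)"
    proof -
      have "(r\<^sup>2 * a) powr (u / 2 - 1) = (r\<^sup>2) powr (u/2 - 1) * a powr (u/2-1)"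
        using assms True by (simp add: powr_mult)
      also have "(r\<^sup>2) powr (u/2 - 1) = r powr (u - 2)"
      proof -
        have "r\<^sup>2 = r powr 2" using assms by simp
        then have "(r\<^sup>2) powr (u/2 - 1) = r powr (2 * (u/2 - 1))" by (simp only: powr_powr)
        then show ?thesis by (simp add: right_diff_distrib)
      qed
      also have "r powr (u - 2) = r powr u / r\<^sup>2"
        using assms by (simp add: powr_diff)
      finally show ?thesis using assms by simp
    qed
    then show ?thesis using True assms unfolding rk_weight_def by (simp flip: ennreal_mult)
  next
    case False
    then have "\<not> 0 < r\<^sup>2 * a" using assms by (simp add: zero_less_mult_iff)
    then show ?thesis using False by (simp add: rk_weight_def)
  qed
  have "(\<integral>\<^sup>+a. rk_weight u a * f a \<partial>lborel) = ennreal (r\<^sup>2) * (\<integral>\<^sup>+a. rk_weight u (r\<^sup>2 * a) * f (r\<^sup>2 * a) \<partial>lborel)"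
    using assms(1) by (subst nn_integral_real_affine[where c="r\<^sup>2" and t=0]) auto
  also have "\<dots> = (\<integral>\<^sup>+a. (ennreal (r\<^sup>2) * rk_weight u (r\<^sup>2 * a)) * f (r\<^sup>2 * a) \<partial>lborel)"
    by (subst nn_integral_cmult[symmetric]) (auto simp: mult.assoc)
  also have "\<dots> = ennreal (r powr u) * (\<integral>\<^sup>+a. rk_weight u a * f (r\<^sup>2 * a) \<partial>lborel)"
    unfolding w by (subst nn_integral_cmult[symmetric]) (auto simp: mult.assoc)
  finally show ?thesis .
qed

lemma nn_integral_lborel_pos:
  assumes [measurable]: "f \<in> borel_measurable borel" and "\<And>a. a > (0::real) \<Longrightarrow> f a > 0"
  shows "(\<integral>\<^sup>+a. f a \<partial>lborel) > 0"
proof (rule ccontr)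
  assume "\<not> ?thesis"
  then have "AE a in lborel. f a = 0" by (simp add: nn_integral_0_iff_AE)
  then have "AE a in lborel. a \<notin> {0<..<1::real}"
    by eventually_elim (metis assms(2) greaterThanLessThan_iff less_irrefl)
  then have "emeasure lborel {0<..<1::real} = 0"
    by (subst (asm) AE_iff_measurable[of "{0<..<1}"]) auto
  moreover have "emeasure lborel {0<..<1::real} = 1" by (subst emeasure_lborel_Ioo) auto
  ultimately show False by simp
qed

text \<open>By \<open>rk_weight_scale\<close> the mixture is homogeneous of degree -u, and it is
  radial and largest at the origin, so \<open>homogeneous_eq_rk\<close> applies.\<close>

lemma rk_eq_exp:
  assumes u: "u > 0"
  obtains c where "c > 0"
    "\<And>x::'a::euclidean_space. (\<integral>\<^sup>+a. rk_weight u a * ennreal (exp (- a * (norm x)\<^sup>2 / 2)) \<partial>lborel) = ennreal c * rk u x"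
proof -
  define H where "H x = (\<integral>\<^sup>+a. rk_weight u a * ennreal (exp (- a * (norm x)\<^sup>2 / 2)) \<partial>lborel)" for x :: 'a
  \<comment> \<open>With squared norm 2 the exponent becomes -a, and the mixture at \<open>b\<close>
    is the integral defining \<open>Gamma (u/2)\<close>.\<close>
  obtain q :: real where q: "q \<ge> 0" "q\<^sup>2 = 2" using real_sqrt_pow2[of 2] real_sqrt_ge_zero[of 2] by fastforce
  obtain b :: 'a where "norm b = q" using vector_choose_size[OF q(1)] by blast
  then have b: "(norm b)\<^sup>2 = 2" using q by simp
  have "H b = ennreal (Gamma (u/2))"
  proof -
    have "AE a in lborel. rk_weight u a * ennreal (exp (- a * (norm b)\<^sup>2 / 2)) = ennreal (indicator {0..} a * a powr (u/2 - 1) / exp a)"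
      using AE_lborel_singleton[of "0::real"]
    proof eventually_elim
      case (elim a)
      show ?case
      proof (cases "a > 0")
        case True
        have "rk_weight u a * ennreal (exp (- a * (norm b)\<^sup>2 / 2)) = ennreal (a powr (u/2 - 1) * exp (- a))"
          unfolding rk_weight_def b using True by (simp add: ennreal_mult)
        also have "a powr (u/2 - 1) * exp (- a) = indicator {0..} a * a powr (u/2 - 1) / exp a"
          using True by (simp add: exp_minus field_simps)
        finally show ?thesis .
      next
        case False
        then show ?thesis using elim by (simp add: rk_weight_def)
      qed
    qed
    then have "H b = (\<integral>\<^sup>+a. ennreal (indicator {0..} a * a powr (u/2 - 1) / exp a) \<partial>lborel)"
      unfolding H_def by (rule nn_integral_cong_AE)
    also have "\<dots> = Gamma (u/2)" using u by (subst Gamma_conv_nn_integral_real) auto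
    finally show ?thesis by simp
  qed
  moreover have "Gamma (u/2) > 0" using u by (simp add: Gamma_real_pos)
  ultimately have Hb: "0 < H b" "H b < \<infinity>" by auto
  obtain c where "c > 0" "\<And>x. H x = ennreal c * rk u x"
  proof (rule homogeneous_eq_rk[of H u b])
    fix r :: real and x :: 'a assume r: "r > 0"
    have "ennreal (r powr u) * H (r *\<^sub>R x) = H x"
      unfolding H_def using r
      by (subst (2) rk_weight_scale[of r]) (auto simp: power_mult_distrib mult_ac)
    then have "ennreal (r powr (-u)) * H x = (ennreal (r powr (-u)) * ennreal (r powr u)) * H (r *\<^sub>R x)"
      by (metis mult.assoc)
    also have "ennreal (r powr (-u)) * ennreal (r powr u) = 1"
      using r by (simp add: powr_minus flip: ennreal_mult)
    finally show "H (r *\<^sub>R x) = ennreal (r powr (-u)) * H x" by simp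
  next
    show "b \<noteq> 0" using b by auto
    show "H b \<le> H 0" unfolding H_def
    proof (intro nn_integral_mono)
      fix a :: real
      show "rk_weight u a * ennreal (exp (- a * (norm b)\<^sup>2 / 2)) \<le> rk_weight u a * ennreal (exp (- a * (norm (0::'a))\<^sup>2 / 2))"
      proof (cases "a > 0")
        case True
        then have "ennreal (exp (- a * (norm b)\<^sup>2 / 2)) \<le> ennreal (exp (- a * (norm (0::'a))\<^sup>2 / 2))"
          by (intro ennreal_leI) simp
        then show ?thesis by (rule mult_left_mono) simp
      qed (simp add: rk_weight_def)
    qed
  qed (use Hb u in \<open>auto simp: H_def\<close>)
  then show thesis using that unfolding H_def by blast
qed

lemma nn_integral_power_0_1:
  assumes "p > -1"
  shows "(\<integral>\<^sup>+a. ennreal (a powr p) * indicator {0..1} a \<partial>lborel) < \<infinity>"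
proof -
  have "((\<lambda>x. x powr p) has_integral (1 powr (p+1) / (p+1))) {0..1}"
    using assms by (intro has_integral_powr_from_0) auto
  from nn_integral_has_integral_lebesgue[OF _ this]
  show ?thesis by (simp add: nn_integral_set_ennreal mult.commute)
qed

lemma nn_integral_power_1_inf:
  assumes "p < -1"
  shows "(\<integral>\<^sup>+a. ennreal (a powr p) * indicator {1..} a \<partial>lborel) < \<infinity>"
proof -
  have "((\<lambda>x. x powr p) has_integral (-(1 powr (p+1)) / (p+1))) {1..}"
    using assms by (intro has_integral_powr_to_inf) auto
  from nn_integral_has_integral_lebesgue[OF _ this]
  show ?thesis by (simp add: nn_integral_set_ennreal mult.commute)
qed

lemma power_le_exp:
  assumes "x \<ge> (0::real)"
  shows "x ^ m / fact m \<le> exp x"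
proof -
  have "(\<lambda>k. x ^ k / fact k) sums exp x"
    using exp_converges[of x] by (simp add: field_simps)
  then show ?thesis
    using sum_le_suminf[of "\<lambda>k. x ^ k / fact k" "{m}"] assms by (simp add: sums_iff)
qed

text \<open>The normalising factor of \<open>gauss a\<close>, of order \<open>a powr (-n/2)\<close>,
  shifts the degree of homogeneity from -u to u - n. At a unit vector the integrand is harmless near
  a = 0, where the exponential beats the normalisation, and is at most
  \<open>a powr ((u - n)/2 - 1)\<close> for large a, which is integrable because u < n. Together
  with \<open>rk_eq_exp\<close> this encodes that the Fourier transform of a Riesz kernel of
  exponent u is a multiple of the one of exponent n - u.\<close>

lemma rk_eq_gauss:
  fixes u :: real assumes u: "0 < u" "u < DIM('a::euclidean_space)"
  obtains c where "c > 0"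
    "\<And>x::'a. (\<integral>\<^sup>+a. rk_weight u a * ennreal (gauss a x) \<partial>lborel) = ennreal c * rk (DIM('a) - u) x"
proof -
  define n where "n = DIM('a)"
  define H where "H x = (\<integral>\<^sup>+a. rk_weight u a * ennreal (gauss a x) \<partial>lborel)" for x :: 'a
  obtain b :: 'a where b: "norm b = 1" using vector_choose_size[of "1"] by auto
  \<comment> \<open>One term of the exponential series gives
    \<open>exp (- (1 / (2 * a))) \<le> fact n * (2 * a) ^ n\<close>, which absorbs the
    normalisation, at most \<open>(1 / a) ^ n\<close> on this range.\<close>
  have K: "gauss a b \<le> fact n * 2 ^ n" if "0 < a" "a \<le> 1" for a
  proof -
    have "a \<le> sqrt (2 * pi * a)"
    proof -
      have "a * a \<le> 2 * pi * a" using that pi_ge_two by (intro mult_right_mono) auto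
      then show ?thesis using that by (intro real_le_rsqrt) (simp add: power2_eq_square)
    qed
    then have "1 / sqrt (2 * pi * a) \<le> 1 / a"
      using that by (intro divide_left_mono) auto
    then have 1: "(1 / sqrt (2 * pi * a)) ^ n \<le> (1 / a) ^ n"
      using that by (intro power_mono) auto
    have "(1 / (2 * a)) ^ n / fact n \<le> exp (1 / (2 * a))"
      using that by (intro power_le_exp) auto
    then have "exp (- (1 / (2 * a))) \<le> fact n * (2 * a) ^ n"
      using that by (simp add: exp_minus field_simps)
    then have "gauss a b \<le> (1 / a) ^ n * (fact n * (2 * a) ^ n)"
      unfolding gauss_def n_def[symmetric] b using 1 that by (intro mult_mono) auto
    also have "\<dots> = fact n * 2 ^ n" using that by (simp add: power_mult_distrib field_simps)
    finally show ?thesis .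
  qed
  have K2: "gauss a b \<le> a powr (- (real n / 2))" if "1 \<le> a" for a
  proof -
    have "1 * a \<le> 2 * pi * a" using that pi_ge_two by (intro mult_right_mono) auto
    from real_sqrt_le_mono[OF this] have "sqrt a \<le> sqrt (2 * pi * a)" by (simp only: mult_1)
    then have "gauss a b \<le> (1 / sqrt a) ^ n * 1"
      unfolding gauss_def n_def[symmetric] b using that
      by (intro mult_mono power_mono divide_left_mono) auto
    also have "\<dots> = a powr (- (real n / 2))"
    proof -
      have "a powr (- (real n / 2)) = (a powr (- (1/2))) powr real n"
        by (simp add: powr_powr)
      also have "a powr (- (1/2)) = 1 / sqrt a"
        using that by (simp add: powr_minus powr_half_sqrt inverse_eq_divide)
      also have "(1 / sqrt a) powr real n = (1 / sqrt a) ^ n"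
        using that by (intro powr_realpow) simp
      finally show ?thesis by simp
    qed
    finally show ?thesis .
  qed
  have "H b \<le> (\<integral>\<^sup>+a. ennreal (fact n * 2 ^ n) * (ennreal (a powr (u/2-1)) * indicator {0..1} a) + ennreal (a powr ((u - n)/2 - 1)) * indicator {1..} a \<partial>lborel)"
    unfolding H_def
  proof (intro nn_integral_mono)
    fix a :: real
    consider "a \<le> 0" | "0 < a" "a \<le> 1" | "a > 1" by linarith
    then show "rk_weight u a * ennreal (gauss a b) \<le> ennreal (fact n * 2 ^ n) * (ennreal (a powr (u/2-1)) * indicator {0..1} a) + ennreal (a powr ((u - n)/2 - 1)) * indicator {1..} a"
    proof cases
      case 1 then show ?thesis by (simp add: rk_weight_def)
    next
      case 2
      have "rk_weight u a * ennreal (gauss a b) = ennreal (gauss a b) * (ennreal (a powr (u/2-1)) * indicator {0..1} a)"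
        using 2 by (simp add: rk_weight_def mult.commute)
      also have "\<dots> \<le> ennreal (fact n * 2 ^ n) * (ennreal (a powr (u/2-1)) * indicator {0..1} a)"
        using K[OF 2] by (intro mult_right_mono ennreal_leI) auto
      finally show ?thesis by (rule order_trans) simp
    next
      case 3
      have "rk_weight u a * ennreal (gauss a b) \<le> ennreal (a powr (u/2-1)) * ennreal (a powr (- (real n / 2)))"
        unfolding rk_weight_def using 3 K2[of a] by (auto intro!: mult_mono ennreal_leI)
      also have "\<dots> = ennreal (a powr (u/2 - 1 + - (real n / 2)))"
        by (simp only: powr_add ennreal_mult powr_ge_zero)
      also have "u/2 - 1 + - (real n / 2) = (u - n)/2 - 1" by (simp add: field_simps)
      finally show ?thesis using 3 by simp
    qed
  qed
  also have "\<dots> = ennreal (fact n * 2 ^ n) * (\<integral>\<^sup>+a. ennreal (a powr (u/2-1)) * indicator {0..1} a \<partial>lborel) + (\<integral>\<^sup>+a. ennreal (a powr ((u - n)/2 - 1)) * indicator {1..} a \<partial>lborel)"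
    by (subst nn_integral_add) (auto simp: nn_integral_cmult)
  also have "\<dots> < \<infinity>"
    using nn_integral_power_0_1[of "u/2-1"] nn_integral_power_1_inf[of "(u - n)/2 - 1"] u
    by (auto simp: n_def ennreal_mult_less_top)
  finally have fin: "H b < \<infinity>" .
  have pos: "H b > 0" unfolding H_def
    by (intro nn_integral_lborel_pos) (auto simp: rk_weight_def ennreal_zero_less_mult_iff gauss_pos)
  obtain c where "c > 0" "\<And>x. H x = ennreal c * rk (n - u) x"
  proof (rule homogeneous_eq_rk[of H "n - u" b])
    fix r :: real and x :: 'a assume r: "r > 0"
    have "H (r *\<^sub>R x) = ennreal (r powr u) * (\<integral>\<^sup>+a. rk_weight u a * (ennreal (1 / r ^ n) * ennreal (gauss a x)) \<partial>lborel)"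
    proof -
      have "H (r *\<^sub>R x) = ennreal (r powr u) * (\<integral>\<^sup>+a. rk_weight u a * ennreal (gauss (r\<^sup>2 * a) (r *\<^sub>R x)) \<partial>lborel)"
        unfolding H_def using r by (intro rk_weight_scale) auto
      also have "(\<integral>\<^sup>+a. rk_weight u a * ennreal (gauss (r\<^sup>2 * a) (r *\<^sub>R x)) \<partial>lborel) = (\<integral>\<^sup>+a. rk_weight u a * (ennreal (1 / r ^ n) * ennreal (gauss a x)) \<partial>lborel)"
      proof (intro nn_integral_cong)
        fix a :: real
        show "rk_weight u a * ennreal (gauss (r\<^sup>2 * a) (r *\<^sub>R x)) = rk_weight u a * (ennreal (1 / r ^ n) * ennreal (gauss a x))"
          using r by (cases "a > 0") (auto simp: rk_weight_def gauss_scale n_def simp flip: ennreal_mult)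
      qed
      finally show ?thesis .
    qed
    also have "\<dots> = ennreal (r powr u) * (\<integral>\<^sup>+a. ennreal (1 / r ^ n) * (rk_weight u a * ennreal (gauss a x)) \<partial>lborel)"
      by (simp add: mult_ac)
    also have "\<dots> = ennreal (r powr u) * ennreal (1 / r ^ n) * H x"
      unfolding H_def by (subst nn_integral_cmult) (auto simp: mult.assoc)
    also have "ennreal (r powr u) * ennreal (1 / r ^ n) = ennreal (r powr (- (n - u)))"
      using r by (simp add: powr_diff powr_realpow flip: ennreal_mult)
    finally show "H (r *\<^sub>R x) = ennreal (r powr (- (n - u))) * H x" .
  next
    show "b \<noteq> 0" using b by auto
    show "H b \<le> H 0" unfolding H_def
    proof (intro nn_integral_mono)
      fix a :: real
      show "rk_weight u a * ennreal (gauss a b) \<le> rk_weight u a * ennreal (gauss a (0::'a))"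
      proof (cases "a > 0")
        case True
        then have "gauss a b \<le> gauss a (0::'a)" unfolding gauss_def by (intro mult_left_mono) auto
        then show ?thesis by (intro mult_left_mono ennreal_leI) auto
      qed (simp add: rk_weight_def)
    qed
  qed (use pos fin u in \<open>auto simp: H_def n_def gauss_def\<close>)
  then show thesis using that unfolding H_def n_def by blast
qed

section \<open>Energies and mollifications on the Fourier side\<close>

lemma nn_gauss_quadratic:
  assumes fin: "finite_measure (M :: 'a::euclidean_space measure)" and s[measurable_cong]: "sets M = sets borel" and a: "a > 0"
  shows "(\<integral>\<^sup>+\<xi>. ennreal (gauss a \<xi>) * ennreal ((cmod (four M \<xi>))\<^sup>2) \<partial>lborel)
    = (\<integral>\<^sup>+x. \<integral>\<^sup>+y. ennreal (exp (- a * (norm (x - y))\<^sup>2 / 2)) \<partial>M \<partial>M)"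
proof -
  interpret finite_measure M by fact
  let ?e = "\<lambda>x y. exp (- a * (norm (x - y))\<^sup>2 / 2)"
  have e1: "?e x y \<le> 1" for x y :: 'a using a by simp
  have i1: "integrable M (\<lambda>y. ?e x y)" for x
    by (rule integrable_const_bound[where B=1]) (use e1 in auto)
  have i2: "integrable M (\<lambda>x. \<integral>y. ?e x y \<partial>M)"
  proof (rule integrable_const_bound[where B="measure M (space M)"])
    show "AE x in M. norm (\<integral>y. ?e x y \<partial>M) \<le> measure M (space M)"
    proof (rule AE_I2)
      fix x
      have "(\<integral>y. ?e x y \<partial>M) \<le> (\<integral>y. 1 \<partial>M)"
        using i1 e1 by (intro integral_mono) auto
      then show "norm (\<integral>y. ?e x y \<partial>M) \<le> measure M (space M)" by simp
    qed
  qed simp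
  note g = gauss_quadratic[OF sigma_finite_measure_axioms, of "\<lambda>_. 1" "\<lambda>x. x" a]
  have g1: "integrable lborel (\<lambda>\<xi>. gauss a \<xi> * (cmod (four M \<xi>))\<^sup>2)"
    using g(1) a by (simp add: four_def)
  have "complex_of_real (\<integral>\<xi>. gauss a \<xi> * (cmod (four M \<xi>))\<^sup>2 \<partial>lborel) = (\<integral>p. \<integral>q. complex_of_real (?e p q) \<partial>M \<partial>M)"
    using g(2) a by (simp add: four_def)
  also have "\<dots> = complex_of_real (\<integral>p. \<integral>q. ?e p q \<partial>M \<partial>M)"
    by (simp only: integral_complex_of_real)
  finally have eq: "(\<integral>\<xi>. gauss a \<xi> * (cmod (four M \<xi>))\<^sup>2 \<partial>lborel) = (\<integral>p. \<integral>q. ?e p q \<partial>M \<partial>M)"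
    by (simp only: of_real_eq_iff)
  have "(\<integral>\<^sup>+\<xi>. ennreal (gauss a \<xi>) * ennreal ((cmod (four M \<xi>))\<^sup>2) \<partial>lborel) = (\<integral>\<^sup>+\<xi>. ennreal (gauss a \<xi> * (cmod (four M \<xi>))\<^sup>2) \<partial>lborel)"
    using a by (simp add: ennreal_mult)
  also have "\<dots> = ennreal (\<integral>\<xi>. gauss a \<xi> * (cmod (four M \<xi>))\<^sup>2 \<partial>lborel)"
    using g1 a by (intro nn_integral_eq_integral) auto
  also have "\<dots> = (\<integral>\<^sup>+x. ennreal (\<integral>y. ?e x y \<partial>M) \<partial>M)"
    unfolding eq using i2 by (intro nn_integral_eq_integral[symmetric]) (auto intro!: integral_nonneg)
  also have "\<dots> = (\<integral>\<^sup>+x. \<integral>\<^sup>+y. ennreal (?e x y) \<partial>M \<partial>M)"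
    using i1 by (intro nn_integral_cong nn_integral_eq_integral[symmetric]) auto
  finally show ?thesis .
qed

lemma four_measurable [measurable]:
  assumes "finite_measure (M :: 'a::euclidean_space measure)" "sets M = sets borel"
  shows "four M \<in> borel_measurable borel"
proof -
  interpret finite_measure M by fact
  note assms(2)[measurable_cong]
  show ?thesis unfolding four_def by measurable
qed

text \<open>The kernel is expanded by \<open>rk_eq_exp\<close>, each Gaussian is moved to the
  Fourier side by \<open>nn_gauss_quadratic\<close>, and the Gaussian weights are recombined by
  \<open>rk_eq_gauss\<close>. All integrands are nonnegative, so infinite energies are covered, and
  the constant is the same for all measures.\<close>

lemma riesz_energy_four:
  fixes s :: real
  assumes s: "0 < s" "s < DIM('a::euclidean_space)"
  obtains b where "b > 0"
    "\<And>M :: 'a measure. finite_measure M \<Longrightarrow> sets M = sets borel \<Longrightarrow>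
       riesz_energy s M = ennreal b * (\<integral>\<^sup>+\<xi>. rk (DIM('a) - s) \<xi> * ennreal ((cmod (four M \<xi>))\<^sup>2) \<partial>lborel)"
proof -
  obtain c where c: "c > 0" "\<And>x::'a. (\<integral>\<^sup>+a. rk_weight s a * ennreal (exp (- a * (norm x)\<^sup>2 / 2)) \<partial>lborel) = ennreal c * rk s x"
    using rk_eq_exp[OF s(1)] by blast
  obtain d where d: "d > 0" "\<And>x::'a. (\<integral>\<^sup>+a. rk_weight s a * ennreal (gauss a x) \<partial>lborel) = ennreal d * rk (DIM('a) - s) x"
    using rk_eq_gauss[OF s] by blast
  have "riesz_energy s M = ennreal (d / c) * (\<integral>\<^sup>+\<xi>. rk (DIM('a) - s) \<xi> * ennreal ((cmod (four M \<xi>))\<^sup>2) \<partial>lborel)"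
    if fin: "finite_measure M" and se[measurable_cong]: "sets M = sets borel" for M :: "'a measure"
  proof -
    interpret finite_measure M by fact
    interpret MR: pair_sigma_finite M "lborel :: real measure" ..
    note four_measurable[OF that, measurable]
    have "ennreal c * riesz_energy s M = (\<integral>\<^sup>+x. \<integral>\<^sup>+y. \<integral>\<^sup>+a. rk_weight s a * ennreal (exp (- a * (norm (x - y))\<^sup>2 / 2)) \<partial>lborel \<partial>M \<partial>M)"
      unfolding c riesz_energy_rk by (simp add: nn_integral_cmult)
    also have "\<dots> = (\<integral>\<^sup>+x. \<integral>\<^sup>+a. \<integral>\<^sup>+y. rk_weight s a * ennreal (exp (- a * (norm (x - y))\<^sup>2 / 2)) \<partial>M \<partial>lborel \<partial>M)"
      by (intro nn_integral_cong MR.Fubini'[symmetric]) measurable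
    also have "\<dots> = (\<integral>\<^sup>+a. \<integral>\<^sup>+x. \<integral>\<^sup>+y. rk_weight s a * ennreal (exp (- a * (norm (x - y))\<^sup>2 / 2)) \<partial>M \<partial>M \<partial>lborel)"
      by (intro MR.Fubini'[symmetric]) measurable
    also have "\<dots> = (\<integral>\<^sup>+a. rk_weight s a * (\<integral>\<^sup>+\<xi>. ennreal (gauss a \<xi>) * ennreal ((cmod (four M \<xi>))\<^sup>2) \<partial>lborel) \<partial>lborel)"
    proof (intro nn_integral_cong)
      fix a :: real
      show "(\<integral>\<^sup>+x. \<integral>\<^sup>+y. rk_weight s a * ennreal (exp (- a * (norm (x - y))\<^sup>2 / 2)) \<partial>M \<partial>M)
        = rk_weight s a * (\<integral>\<^sup>+\<xi>. ennreal (gauss a \<xi>) * ennreal ((cmod (four M \<xi>))\<^sup>2) \<partial>lborel)"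
      proof (cases "a > 0")
        case True
        show ?thesis
          by (subst nn_gauss_quadratic[OF that True]) (simp add: nn_integral_cmult)
      qed (simp add: rk_weight_def)
    qed
    also have "\<dots> = (\<integral>\<^sup>+a. \<integral>\<^sup>+\<xi>. rk_weight s a * ennreal (gauss a \<xi>) * ennreal ((cmod (four M \<xi>))\<^sup>2) \<partial>lborel \<partial>lborel)"
      by (simp add: nn_integral_cmult mult.assoc)
    also have "\<dots> = (\<integral>\<^sup>+\<xi>. \<integral>\<^sup>+a. rk_weight s a * ennreal (gauss a \<xi>) * ennreal ((cmod (four M \<xi>))\<^sup>2) \<partial>lborel \<partial>lborel)"
      by (intro lborel_pair.Fubini') measurable
    also have "\<dots> = (\<integral>\<^sup>+\<xi>. (\<integral>\<^sup>+a. rk_weight s a * ennreal (gauss a \<xi>) \<partial>lborel) * ennreal ((cmod (four M \<xi>))\<^sup>2) \<partial>lborel)"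
      by (simp add: nn_integral_multc)
    also have "\<dots> = ennreal d * (\<integral>\<^sup>+\<xi>. rk (DIM('a) - s) \<xi> * ennreal ((cmod (four M \<xi>))\<^sup>2) \<partial>lborel)"
      unfolding d by (simp add: nn_integral_cmult mult.assoc)
    finally have "ennreal (1 / c) * (ennreal c * riesz_energy s M) = ennreal (1 / c) * (ennreal d * (\<integral>\<^sup>+\<xi>. rk (DIM('a) - s) \<xi> * ennreal ((cmod (four M \<xi>))\<^sup>2) \<partial>lborel))"
      by simp
    then show ?thesis using c(1) d(1) by (simp flip: mult.assoc ennreal_mult)
  qed
  moreover have "d / c > 0" using c d by simp
  ultimately show thesis using that by blast
qed

section \<open>An inequality of Parseval type for mollified measures\<close>

lemma nn_integral_lborel_affine:
  fixes t :: "'a::euclidean_space"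
  assumes [measurable]: "f \<in> borel_measurable borel" and c: "c \<noteq> 0"
  shows "(\<integral>\<^sup>+x. f x \<partial>lborel) = ennreal (\<bar>c\<bar> ^ DIM('a)) * (\<integral>\<^sup>+x. f (t + c *\<^sub>R x) \<partial>lborel)"
  by (subst lborel_affine[OF c, of t])
     (simp add: nn_integral_density nn_integral_distr nn_integral_cmult)

lemma integral_lborel_affine:
  fixes t :: "'a::euclidean_space" and f :: "'a \<Rightarrow> 'b::{banach, second_countable_topology}"
  assumes [measurable]: "f \<in> borel_measurable borel" and c: "c \<noteq> 0"
  shows "(\<integral>x. f x \<partial>lborel) = (\<bar>c\<bar> ^ DIM('a)) *\<^sub>R (\<integral>x. f (t + c *\<^sub>R x) \<partial>lborel)"
  by (subst lborel_affine[OF c, of t])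
     (simp add: integral_density integral_distr)

text \<open>Damping the right-hand side by a Gaussian factor at most 1 makes
  \<open>gauss_quadratic\<close> applicable, which turns it into the autocorrelation of
  \<open>F\<close> averaged over displacements of size \<open>\<delta>\<close>, namely
  \<open>T \<delta>\<close> up to a constant. As \<open>\<delta>\<close> tends to 0, dominated
  convergence leads to the squared L2 norm; continuity of \<open>F\<close> enters here.\<close>

lemma parseval_le:
  fixes F :: "'a::euclidean_space \<Rightarrow> complex"
  assumes F: "integrable lborel F" and cont: "continuous_on UNIV F" and bd: "\<And>z. cmod (F z) \<le> B"
  shows "ennreal ((2 * pi) ^ DIM('a)) * (\<integral>\<^sup>+z. ennreal ((cmod (F z))\<^sup>2) \<partial>lborel)
    \<le> (\<integral>\<^sup>+\<xi>. ennreal ((cmod (\<integral>z. F z * cis (\<xi> \<bullet> z) \<partial>lborel))\<^sup>2) \<partial>lborel)"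
proof -
  define n where "n = DIM('a)"
  have [measurable]: "F \<in> borel_measurable borel" using F by auto
  have B: "B \<ge> 0" using bd[of 0] norm_ge_zero[of "F 0"] by linarith
  define h where "h \<xi> = (\<integral>z. F z * cis (\<xi> \<bullet> z) \<partial>lborel)" for \<xi>
  have [measurable]: "h \<in> borel_measurable borel" unfolding h_def by measurable
  define T where "T \<delta> = (\<integral>zv. F (fst zv) * cnj (F (fst zv + \<delta> *\<^sub>R snd zv)) * complex_of_real (gauss 1 (snd zv)) \<partial>(lborel \<Otimes>\<^sub>M lborel))" for \<delta> :: real
  have bnd: "integrable (lborel \<Otimes>\<^sub>M lborel) (\<lambda>zv. B * cmod (F (fst zv)) * gauss 1 (snd zv :: 'a))"
    using F gauss_integral[of 1, where 'a='a]
    by (intro lborel_pair.Fubini_integrable) (auto simp: abs_mult intro!: integrable_norm)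
  have bnd2: "cmod (F (fst zv) * cnj (F (fst zv + \<delta> *\<^sub>R snd zv)) * complex_of_real (gauss 1 (snd zv))) \<le> B * cmod (F (fst zv)) * gauss 1 (snd zv)" for zv \<delta>
  proof -
    have "cmod (F (fst zv + \<delta> *\<^sub>R snd zv)) * (cmod (F (fst zv)) * gauss 1 (snd zv)) \<le> B * (cmod (F (fst zv)) * gauss 1 (snd zv))"
      by (intro mult_right_mono bd) auto
    then show ?thesis by (simp add: norm_mult mult_ac)
  qed
  have Tint: "integrable (lborel \<Otimes>\<^sub>M lborel) (\<lambda>zv. F (fst zv) * cnj (F (fst zv + \<delta> *\<^sub>R snd zv)) * complex_of_real (gauss 1 (snd zv)))" for \<delta>
  proof (rule Bochner_Integration.integrable_bound[OF bnd])
    show "AE zv in lborel \<Otimes>\<^sub>M lborel. cmod (F (fst zv) * cnj (F (fst zv + \<delta> *\<^sub>R snd zv)) * complex_of_real (gauss 1 (snd zv))) \<le> norm (B * cmod (F (fst zv)) * gauss 1 (snd zv))"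
      using bnd2 B by (auto simp: abs_mult)
  qed measurable
  have lim: "(\<lambda>m. T (1 / real (Suc m))) \<longlonglongrightarrow> T 0"
    unfolding T_def
  proof (rule integral_dominated_convergence[OF _ _ bnd])
    show "AE zv in lborel \<Otimes>\<^sub>M lborel. (\<lambda>m. F (fst zv) * cnj (F (fst zv + (1 / real (Suc m)) *\<^sub>R snd zv)) * complex_of_real (gauss 1 (snd zv)))
        \<longlonglongrightarrow> F (fst zv) * cnj (F (fst zv + 0 *\<^sub>R snd zv)) * complex_of_real (gauss 1 (snd zv))"
    proof (intro AE_I2 tendsto_intros)
      fix zv :: "'a \<times> 'a"
      have "(\<lambda>m. fst zv + (1 / real (Suc m)) *\<^sub>R snd zv) \<longlonglongrightarrow> fst zv + 0 *\<^sub>R snd zv"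
        using LIMSEQ_inverse_real_of_nat by (intro tendsto_intros) (simp add: inverse_eq_divide)
      then show "(\<lambda>m. F (fst zv + (1 / real (Suc m)) *\<^sub>R snd zv)) \<longlonglongrightarrow> F (fst zv + 0 *\<^sub>R snd zv)"
        by (intro continuous_on_tendsto_compose[OF cont]) auto
    qed
  qed (use bnd2 in \<open>auto intro!: AE_I2\<close>)
  have F2: "integrable lborel (\<lambda>z. (cmod (F z))\<^sup>2)"
  proof (rule Bochner_Integration.integrable_bound[where f="\<lambda>z. B * cmod (F z)"])
    show "AE x in lborel. norm ((cmod (F x))\<^sup>2) \<le> norm (B * cmod (F x))"
      using bd B by (auto simp: power2_eq_square abs_mult intro!: mult_right_mono)
  qed (use F in auto)
  have T0: "T 0 = complex_of_real (\<integral>z. (cmod (F z))\<^sup>2 \<partial>lborel)"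
  proof -
    have "T 0 = (\<integral>z. \<integral>v. F z * cnj (F z) * complex_of_real (gauss 1 (v::'a)) \<partial>lborel \<partial>lborel)"
      unfolding T_def using Tint[of 0] by (subst lborel_pair.integral_fst'[symmetric]) auto
    also have "\<dots> = (\<integral>z. complex_of_real ((cmod (F z))\<^sup>2) \<partial>lborel)"
      by (simp add: gauss_integral complex_norm_square[symmetric] del: of_real_power)
    finally show ?thesis by (simp del: of_real_power)
  qed
  have Teq: "ennreal ((2 * pi) ^ n * Re (T \<delta>)) \<le> (\<integral>\<^sup>+\<xi>. ennreal ((cmod (h \<xi>))\<^sup>2) \<partial>lborel)" if \<delta>: "\<delta> > 0" for \<delta>
  proof -
    \<comment> \<open>The damping factor is \<open>exp (- (norm \<xi>)\<^sup>2 / (2 * a))\<close>, a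
      Gaussian of width \<open>1 / \<delta>\<close>. It equals
      \<open>(q / \<delta> ^ n) * gauss a \<xi>\<close>, while the substitution y = z + \<delta> v
      produces the factor \<open>\<delta> ^ n * q\<close>. The powers of \<open>\<delta>\<close>
      cancel and \<open>q * q = (2 * pi) ^ n\<close> remains.\<close>
    define a where "a = 1 / \<delta>\<^sup>2"
    have a: "a > 0" using \<delta> by (simp add: a_def)
    define q where "q = sqrt (2 * pi) ^ n"
    have "q * q = (sqrt (2 * pi) * sqrt (2 * pi)) ^ n" by (simp only: q_def power_mult_distrib)
    then have q: "q > 0" "q * q = (2 * pi) ^ n" by (simp_all add: q_def)
    note g = gauss_quadratic[OF sigma_finite_lborel F _ a, of "\<lambda>z. z", folded h_def]
    have "complex_of_real (\<integral>\<xi>. gauss a \<xi> * (cmod (h \<xi>))\<^sup>2 \<partial>lborel)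
       = (\<integral>z. \<integral>y. F z * cnj (F y) * complex_of_real (exp (- a * (norm (z - y))\<^sup>2 / 2)) \<partial>lborel \<partial>lborel)"
      using g(2) by simp
    also have "\<dots> = (\<integral>z. (\<delta> ^ n) *\<^sub>R (\<integral>v. F z * cnj (F (z + \<delta> *\<^sub>R v)) * complex_of_real (exp (- a * (norm (z - (z + \<delta> *\<^sub>R v)))\<^sup>2 / 2)) \<partial>lborel) \<partial>lborel)"
    proof (intro Bochner_Integration.integral_cong refl)
      fix z :: 'a
      show "(\<integral>y. F z * cnj (F y) * complex_of_real (exp (- a * (norm (z - y))\<^sup>2 / 2)) \<partial>lborel)
        = (\<delta> ^ n) *\<^sub>R (\<integral>v. F z * cnj (F (z + \<delta> *\<^sub>R v)) * complex_of_real (exp (- a * (norm (z - (z + \<delta> *\<^sub>R v)))\<^sup>2 / 2)) \<partial>lborel)"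
        unfolding n_def using \<delta> by (subst integral_lborel_affine[where c=\<delta> and t=z]) auto
    qed
    also have "\<dots> = (\<integral>z. complex_of_real (\<delta> ^ n * q) * (\<integral>v. F z * cnj (F (z + \<delta> *\<^sub>R v)) * complex_of_real (gauss 1 v) \<partial>lborel) \<partial>lborel)"
    proof -
      have "complex_of_real (exp (- a * (norm (z - (z + \<delta> *\<^sub>R v)))\<^sup>2 / 2)) = complex_of_real q * complex_of_real (gauss 1 v)" for z v :: 'a
      proof -
        have 1: "q * (1 / sqrt (2 * pi * 1)) ^ n = 1"
          unfolding q_def power_mult_distrib[symmetric] by simp
        have 2: "- a * (norm (z - (z + \<delta> *\<^sub>R v)))\<^sup>2 / 2 = - (norm v)\<^sup>2 / (2 * 1)"
          using \<delta> by (simp add: a_def power_mult_distrib)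
        have "q * gauss 1 v = exp (- (norm v)\<^sup>2 / (2 * 1))"
          unfolding gauss_def n_def[symmetric] mult.assoc[symmetric] 1 by simp
        then show ?thesis unfolding 2 by (metis of_real_mult)
      qed
      then show ?thesis
        by (simp add: scaleR_conv_of_real mult_ac flip: integral_mult_right_zero)
    qed
    also have "\<dots> = complex_of_real (\<delta> ^ n * q) * T \<delta>"
      unfolding T_def using Tint[of \<delta>] by (subst lborel_pair.integral_fst'[symmetric]) auto
    finally have C: "complex_of_real (\<integral>\<xi>. gauss a \<xi> * (cmod (h \<xi>))\<^sup>2 \<partial>lborel) = complex_of_real (\<delta> ^ n * q) * T \<delta>" .
    have "(\<integral>\<xi>. gauss a \<xi> * (cmod (h \<xi>))\<^sup>2 \<partial>lborel) = Re (complex_of_real (\<integral>\<xi>. gauss a \<xi> * (cmod (h \<xi>))\<^sup>2 \<partial>lborel))"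
      by (simp only: Re_complex_of_real)
    also have "\<dots> = (\<delta> ^ n * q) * Re (T \<delta>)"
      unfolding C by (simp only: times_complex.sel Re_complex_of_real Im_complex_of_real)
    finally have *: "(\<integral>\<xi>. gauss a \<xi> * (cmod (h \<xi>))\<^sup>2 \<partial>lborel) = \<delta> ^ n * q * Re (T \<delta>)" .
    have "(2 * pi) ^ n * Re (T \<delta>) = (q / \<delta> ^ n) * (\<integral>\<xi>. gauss a \<xi> * (cmod (h \<xi>))\<^sup>2 \<partial>lborel)"
      unfolding * q(2)[symmetric] using \<delta> by simp
    also have "\<dots> = (\<integral>\<xi>. (q / \<delta> ^ n) * gauss a \<xi> * (cmod (h \<xi>))\<^sup>2 \<partial>lborel)"
      by (simp add: mult.assoc flip: integral_mult_right_zero)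
    finally have "ennreal ((2 * pi) ^ n * Re (T \<delta>)) = (\<integral>\<^sup>+\<xi>. ennreal ((q / \<delta> ^ n) * gauss a \<xi> * (cmod (h \<xi>))\<^sup>2) \<partial>lborel)"
      using g(1) a q(1) \<delta> by (subst nn_integral_eq_integral) (auto simp: mult.assoc)
    also have "\<dots> \<le> (\<integral>\<^sup>+\<xi>. ennreal ((cmod (h \<xi>))\<^sup>2) \<partial>lborel)"
    proof (intro nn_integral_mono ennreal_leI)
      fix \<xi> :: 'a
      have "(q / \<delta> ^ n) * gauss a \<xi> = exp (- (norm \<xi>)\<^sup>2 / (2 * a))"
      proof -
        have "sqrt (2 * pi * a) = sqrt (2 * pi) / \<delta>"
          using \<delta> by (simp add: a_def real_sqrt_divide)
        then have 1: "(q / \<delta> ^ n) * (1 / sqrt (2 * pi * a)) ^ n = 1"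
          unfolding q_def power_divide[symmetric] power_mult_distrib[symmetric] using \<delta> by simp
        show ?thesis
          unfolding gauss_def n_def[symmetric] mult.assoc[symmetric] 1 by simp
      qed
      also have "\<dots> \<le> 1" using a by simp
      finally show "(q / \<delta> ^ n) * gauss a \<xi> * (cmod (h \<xi>))\<^sup>2 \<le> (cmod (h \<xi>))\<^sup>2"
        using a q(1) \<delta> by (intro mult_left_le_one_le) auto
    qed
    finally show ?thesis .
  qed
  have "(\<lambda>m. ennreal ((2 * pi) ^ n * Re (T (1 / real (Suc m))))) \<longlonglongrightarrow> ennreal ((2 * pi) ^ n * Re (T 0))"
    by (intro tendsto_intros lim)
  then have "ennreal ((2 * pi) ^ n * Re (T 0)) \<le> (\<integral>\<^sup>+\<xi>. ennreal ((cmod (h \<xi>))\<^sup>2) \<partial>lborel)"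
  proof (rule tendsto_upperbound)
    show "\<forall>\<^sub>F m in sequentially. ennreal ((2 * pi) ^ n * Re (T (1 / real (Suc m)))) \<le> (\<integral>\<^sup>+\<xi>. ennreal ((cmod (h \<xi>))\<^sup>2) \<partial>lborel)"
      by (intro always_eventually allI Teq) simp
  qed simp
  also have "ennreal ((2 * pi) ^ n * Re (T 0)) = ennreal ((2 * pi) ^ n) * (\<integral>\<^sup>+z. ennreal ((cmod (F z))\<^sup>2) \<partial>lborel)"
    unfolding T0 using F2 by (subst nn_integral_eq_integral) (auto simp: ennreal_mult)
  finally show ?thesis unfolding h_def n_def .
qed

text \<open>The function of \<open>z\<close> on the left is the image under \<open>w\<close> of the
  complex measure with density \<open>f\<close>, convolved with the reflection of
  \<open>\<phi>\<close>. Its Fourier integral is that of the image measure times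
  \<open>\<kappa>\<close>, and \<open>cmod (\<kappa> \<eta>) \<le> 1\<close> because
  \<open>\<phi>\<close> is a probability density. The bounds on \<open>f\<close> and
  \<open>\<phi>\<close> supply the hypotheses of \<open>parseval_le\<close>.\<close>

lemma mollified_l2_le:
  fixes w :: "'p \<Rightarrow> 'a::euclidean_space" and \<phi> :: "'a \<Rightarrow> real"
  assumes fin: "finite_measure P" and f[measurable]: "f \<in> borel_measurable P" "\<And>p. cmod (f p) \<le> 1"
    and w[measurable]: "w \<in> P \<rightarrow>\<^sub>M borel"
    and \<phi>: "\<And>x. \<phi> x \<ge> 0" "continuous_on UNIV \<phi>" "\<And>x. \<phi> x \<le> B" "integrable lborel \<phi>" "(\<integral>x. \<phi> x \<partial>lborel) = 1"
  shows "ennreal ((2 * pi) ^ DIM('a)) * (\<integral>\<^sup>+z. ennreal ((cmod (\<integral>p. f p * complex_of_real (\<phi> (w p - z)) \<partial>P))\<^sup>2) \<partial>lborel)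
    \<le> (\<integral>\<^sup>+\<eta>. ennreal ((cmod (\<integral>p. f p * cis (\<eta> \<bullet> w p) \<partial>P))\<^sup>2) \<partial>lborel)"
proof -
  interpret finite_measure P by fact
  interpret PL: pair_sigma_finite P "lborel :: 'a measure" ..
  have [measurable]: "\<phi> \<in> borel_measurable borel" using \<phi>(4) by auto
  have B: "B \<ge> 0" using \<phi>(1,3)[of 0] by linarith
  define F where "F z = (\<integral>p. f p * complex_of_real (\<phi> (w p - z)) \<partial>P)" for z
  have shift: "integrable lborel (\<lambda>z. \<phi> (v - z))" "(\<integral>z. \<phi> (v - z) \<partial>lborel) = 1" for v
  proof -
    have *: "(\<integral>\<^sup>+z. ennreal (\<phi> z) \<partial>lborel) = (\<integral>\<^sup>+z. ennreal (\<phi> (v - z)) \<partial>lborel)"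
      by (subst nn_integral_lborel_affine[where c="-1" and t=v]) auto
    have "(\<integral>\<^sup>+z. ennreal (\<phi> z) \<partial>lborel) = 1"
      using \<phi> by (subst nn_integral_eq_integral) auto
    then have "(\<integral>\<^sup>+z. ennreal (\<phi> (v - z)) \<partial>lborel) = ennreal 1" using * by simp
    then have "has_bochner_integral lborel (\<lambda>z. \<phi> (v - z)) 1"
      using \<phi> by (intro has_bochner_integral_nn_integral) auto
    then show "integrable lborel (\<lambda>z. \<phi> (v - z))" "(\<integral>z. \<phi> (v - z) \<partial>lborel) = 1"
      by (auto simp: has_bochner_integral_iff)
  qed
  have i1: "integrable (P \<Otimes>\<^sub>M lborel) (\<lambda>pz. \<phi> (w (fst pz) - snd pz))"
    using shift \<phi> by (intro PL.Fubini_integrable) auto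
  have i2: "integrable (P \<Otimes>\<^sub>M lborel) (\<lambda>pz. f (fst pz) * complex_of_real (\<phi> (w (fst pz) - snd pz)) * cis (\<eta> \<bullet> snd pz))" for \<eta>
    by (rule Bochner_Integration.integrable_bound[OF i1])
       (use \<phi>(1) f in \<open>auto simp: norm_mult mult_left_le_one_le intro!: AE_I2\<close>)
  have iF: "integrable lborel F"
    using PL.integrable_snd[of "\<lambda>p z. f p * complex_of_real (\<phi> (w p - z))"] i2[of 0] unfolding F_def by (simp add: case_prod_unfold)
  have bf: "norm (f p * complex_of_real (\<phi> (w p - z))) \<le> B" for p z
    using \<phi>(1)[of "w p - z"] \<phi>(3)[of "w p - z"] f(2)[of p] mult_mono[of "cmod (f p)" 1 "\<phi> (w p - z)" B] by (simp add: norm_mult)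
  have cF: "continuous_on UNIV F"
  proof (subst continuous_on_sequentially, intro allI impI ballI)
    fix X :: "nat \<Rightarrow> 'a" and z assume X: "(\<forall>m. X m \<in> UNIV) \<and> X \<longlonglongrightarrow> z"
    have "(\<lambda>m. F (X m)) \<longlonglongrightarrow> F z"
      unfolding F_def
    proof (rule integral_dominated_convergence[where w="\<lambda>_. B"])
      show "AE p in P. (\<lambda>m. f p * complex_of_real (\<phi> (w p - X m))) \<longlonglongrightarrow> f p * complex_of_real (\<phi> (w p - z))"
      proof (intro AE_I2 tendsto_intros)
        fix p
        have "(\<lambda>m. w p - X m) \<longlonglongrightarrow> w p - z" using X by (intro tendsto_intros) auto
        then show "(\<lambda>m. \<phi> (w p - X m)) \<longlonglongrightarrow> \<phi> (w p - z)"
          by (intro continuous_on_tendsto_compose[OF \<phi>(2)]) auto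
      qed
    qed (use bf in auto)
    then show "(F \<circ> X) \<longlonglongrightarrow> F z" by (simp add: o_def)
  qed
  have bF: "cmod (F z) \<le> measure P (space P) * B" for z
  proof -
    have "cmod (F z) \<le> (\<integral>p. norm (f p * complex_of_real (\<phi> (w p - z))) \<partial>P)"
      unfolding F_def by (rule integral_norm_bound)
    also have "\<dots> \<le> (\<integral>p. B \<partial>P)"
      using bf by (intro integral_mono integrable_norm integrable_const_bound[where B=B]) (auto simp: norm_mult B)
    finally have "cmod (F z) \<le> (\<integral>p. B \<partial>P)" .
    then show ?thesis by simp
  qed
  define \<kappa> where "\<kappa> \<eta> = (\<integral>v. complex_of_real (\<phi> v) * cis (- (\<eta> \<bullet> v)) \<partial>lborel)" for \<eta>
  have \<kappa>: "cmod (\<kappa> \<eta>) \<le> 1" for \<eta>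
  proof -
    have "cmod (\<kappa> \<eta>) \<le> (\<integral>v. \<phi> v \<partial>lborel)"
      unfolding \<kappa>_def
    proof (rule Bochner_Integration.integral_norm_bound_integral)
      show "integrable lborel (\<lambda>v. complex_of_real (\<phi> v) * cis (- (\<eta> \<bullet> v)))"
        by (rule Bochner_Integration.integrable_bound[OF \<phi>(4)]) (auto simp: norm_mult)
    qed (use \<phi> in \<open>auto simp: norm_mult\<close>)
    then show ?thesis using \<phi> by simp
  qed
  have hF: "(\<integral>z. F z * cis (\<eta> \<bullet> z) \<partial>lborel) = (\<integral>p. f p * cis (\<eta> \<bullet> w p) \<partial>P) * \<kappa> \<eta>" for \<eta>
  proof -
    have "(\<integral>z. F z * cis (\<eta> \<bullet> z) \<partial>lborel) = (\<integral>z. \<integral>p. f p * complex_of_real (\<phi> (w p - z)) * cis (\<eta> \<bullet> z) \<partial>P \<partial>lborel)"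
      unfolding F_def by (simp flip: integral_mult_left_zero)
    also have "\<dots> = (\<integral>p. \<integral>z. f p * complex_of_real (\<phi> (w p - z)) * cis (\<eta> \<bullet> z) \<partial>lborel \<partial>P)"
      using i2[of \<eta>] by (intro PL.Fubini_integral) (simp add: case_prod_unfold)
    also have "\<dots> = (\<integral>p. f p * (\<integral>z. complex_of_real (\<phi> (w p - z)) * cis (\<eta> \<bullet> z) \<partial>lborel) \<partial>P)"
      by (simp add: mult.assoc)
    also have "\<dots> = (\<integral>p. f p * (cis (\<eta> \<bullet> w p) * \<kappa> \<eta>) \<partial>P)"
    proof -
      have "(\<integral>z. complex_of_real (\<phi> (v - z)) * cis (\<eta> \<bullet> z) \<partial>lborel) = cis (\<eta> \<bullet> v) * \<kappa> \<eta>" for v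
      proof -
        have "(\<integral>z. complex_of_real (\<phi> (v - z)) * cis (\<eta> \<bullet> z) \<partial>lborel) = (\<integral>x. complex_of_real (\<phi> x) * cis (\<eta> \<bullet> (v - x)) \<partial>lborel)"
          by (subst integral_lborel_affine[where c="-1" and t=v]) auto
        also have "\<dots> = (\<integral>x. cis (\<eta> \<bullet> v) * (complex_of_real (\<phi> x) * cis (- (\<eta> \<bullet> x))) \<partial>lborel)"
          by (intro Bochner_Integration.integral_cong) (auto simp: inner_diff_right cis_mult)
        finally show ?thesis by (simp add: \<kappa>_def)
      qed
      then show ?thesis by simp
    qed
    also have "\<dots> = (\<integral>p. f p * cis (\<eta> \<bullet> w p) \<partial>P) * \<kappa> \<eta>"
      by (simp flip: mult.assoc)
    finally show ?thesis .
  qed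
  have "ennreal ((2 * pi) ^ DIM('a)) * (\<integral>\<^sup>+z. ennreal ((cmod (F z))\<^sup>2) \<partial>lborel)
    \<le> (\<integral>\<^sup>+\<eta>. ennreal ((cmod (\<integral>z. F z * cis (\<eta> \<bullet> z) \<partial>lborel))\<^sup>2) \<partial>lborel)"
    by (rule parseval_le[OF iF cF bF])
  also have "\<dots> \<le> (\<integral>\<^sup>+\<eta>. ennreal ((cmod (\<integral>p. f p * cis (\<eta> \<bullet> w p) \<partial>P))\<^sup>2) \<partial>lborel)"
    unfolding hF norm_mult using \<kappa>
    by (intro nn_integral_mono ennreal_leI power_mono mult_right_le_one_le) auto
  finally show ?thesis unfolding F_def .
qed

section \<open>Weak compactness\<close>

text \<open>Schoenberg's space-filling curve, together with a Borel right inverse: it transports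
  Helly's selection theorem from the line to Euclidean space.\<close>

definition sch :: "real \<Rightarrow> real" where
  "sch t = max 0 (min 1 (1 / 2 - cos (pi * t)))"

lemma sch_bounds: "0 \<le> sch t" "sch t \<le> 1"
  by (auto simp: sch_def)

lemma continuous_on_sch [continuous_intros]:
  fixes f :: "real \<Rightarrow> real"
  shows "continuous_on S f \<Longrightarrow> continuous_on S (\<lambda>t. sch (f t))"
  unfolding sch_def by (intro continuous_intros)

lemma sch_add_even: "sch (t + 2 * of_int k) = sch t"
proof -
  have "cos (pi * (t + 2 * of_int k)) = cos (pi * t + of_int k * (2 * pi))" by (simp add: algebra_simps)
  also have "\<dots> = cos (pi * t)" by (metis cos_int_2pin mult.commute cos_add sin_int_2pin mult.right_neutral mult_zero_right diff_zero)
  finally show ?thesis by (simp add: sch_def)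
qed

lemma sch_low: "0 \<le> t \<Longrightarrow> t \<le> 1 / 3 \<Longrightarrow> sch t = 0"
proof -
  assume t: "0 \<le> t" "t \<le> 1 / 3"
  then have "pi * t \<le> pi / 3" by (simp add: field_simps)
  then have "cos (pi / 3) \<le> cos (pi * t)" using t by (intro cos_monotone_0_pi_le) auto
  then show ?thesis by (simp add: sch_def cos_60)
qed

lemma sch_high: "2 / 3 \<le> t \<Longrightarrow> t \<le> 1 \<Longrightarrow> sch t = 1"
proof -
  assume t: "2 / 3 \<le> t" "t \<le> 1"
  then have "pi - pi / 3 \<le> pi * t" by (simp add: field_simps)
  then have "cos (pi * t) \<le> cos (pi - pi / 3)" using t by (intro cos_monotone_0_pi_le) auto
  also have "\<dots> = - (1 / 2)" by (subst cos_pi_minus) (simp add: cos_60)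
  finally show ?thesis by (simp add: sch_def)
qed

lemma sums_2_over_3: "(\<lambda>k. 2 / 3 ^ (k + 1)) sums (1::real)"
  using sums_mult[OF geometric_sums[of "1/3::real"], of "2/3"] by (simp add: power_divide)

text \<open>Multiplication by \<open>3 ^ k\<close> shifts a ternary expansion with digits 0 and 2.
  Its integer part \<open>2 * A\<close> is even and disappears by periodicity; the remainder
  \<open>r\<close> lies in [0, 1/3] or [2/3, 1] according to the digit \<open>c k\<close>, and on
  these intervals \<open>sch\<close> is constantly 0 or 1.\<close>

lemma sch_ternary:
  fixes c :: "nat \<Rightarrow> int"
  assumes c: "\<And>k. c k \<in> {0, 1}"
  shows "sch (3 ^ k * (\<Sum>i. 2 * real_of_int (c i) / 3 ^ (i + 1))) = real_of_int (c k)"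
proof -
  let ?d = "\<lambda>i. 2 * real_of_int (c i) / 3 ^ (i + 1)"
  have le: "2 * real_of_int (d i) / 3 ^ (i + 1) \<le> 2 / 3 ^ (i + 1)" "0 \<le> 2 * real_of_int (d i) / 3 ^ (i + 1)"
    "norm (2 * real_of_int (d i) / 3 ^ (i + 1)) \<le> 2 / 3 ^ (i + 1)"
    if "\<And>k. d k \<in> {0, 1}" for d :: "nat \<Rightarrow> int" and i
    using that[of i] by auto
  have sm: "summable (\<lambda>i. 2 * real_of_int (d i) / 3 ^ (i + 1))" if "\<And>k. d k \<in> {0, 1}" for d :: "nat \<Rightarrow> int"
    by (rule summable_comparison_test'[OF sums_summable[OF sums_2_over_3], where N=0]) (rule le(3)[OF that])
  have bd: "0 \<le> (\<Sum>i. 2 * real_of_int (d i) / 3 ^ (i + 1))" "(\<Sum>i. 2 * real_of_int (d i) / 3 ^ (i + 1)) \<le> 1"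
    if "\<And>k. d k \<in> {0, 1}" for d :: "nat \<Rightarrow> int"
  proof -
    show "0 \<le> (\<Sum>i. 2 * real_of_int (d i) / 3 ^ (i + 1))"
      by (rule suminf_nonneg[OF sm]) (use le[of d] that in auto)
    have "(\<Sum>i. 2 * real_of_int (d i) / 3 ^ (i + 1)) \<le> (\<Sum>i. 2 / 3 ^ (i + 1))"
      by (rule suminf_le[OF _ sm sums_summable[OF sums_2_over_3]]) (use le[of d] that in auto)
    then show "(\<Sum>i. 2 * real_of_int (d i) / 3 ^ (i + 1)) \<le> 1"
      using sums_unique[OF sums_2_over_3] by simp
  qed
  define A where "A = (\<Sum>i<k. c i * 3 ^ (k - Suc i))"
  define r where "r = (\<Sum>i. 2 * real_of_int (c (i + k)) / 3 ^ (i + 1))"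
  define r' where "r' = (\<Sum>i. 2 * real_of_int (c (i + Suc k)) / 3 ^ (i + 1))"
  have "(\<Sum>i. ?d i) = (\<Sum>i. ?d (i + k)) + (\<Sum>i<k. ?d i)"
    by (rule suminf_split_initial_segment) (use sm[of c] c in auto)
  moreover have "(\<Sum>i. ?d (i + k)) = r / 3 ^ k"
  proof -
    have "r / 3 ^ k = (\<Sum>i. 2 * real_of_int (c (i + k)) / 3 ^ (i + 1) / 3 ^ k)"
      unfolding r_def by (rule suminf_divide[symmetric]) (use sm[of "\<lambda>i. c (i + k)"] c in auto)
    then show ?thesis by (simp add: power_add field_simps)
  qed
  moreover have "3 ^ k * (\<Sum>i<k. ?d i) = 2 * of_int A"
  proof -
    have "3 ^ k * ?d i = 2 * of_int (c i * 3 ^ (k - Suc i))" if "i < k" for i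
    proof -
      have "(3::real) ^ k = 3 ^ (k - Suc i) * 3 ^ (i + 1)" using that unfolding power_add[symmetric] by simp
      then show ?thesis by simp
    qed
    then show ?thesis by (simp add: A_def sum_distrib_left)
  qed
  ultimately have e: "3 ^ k * (\<Sum>i. ?d i) = r + 2 * of_int A"
    by (simp add: distrib_left)
  have r': "0 \<le> r'" "r' \<le> 1" using bd[of "\<lambda>i. c (i + Suc k)"] c by (auto simp: r'_def)
  have "r = 2 * of_int (c k) / 3 + r' / 3"
  proof -
    have s: "summable (\<lambda>i. 2 * real_of_int (c (i + k)) / 3 ^ (i + 1))"
      using sm[of "\<lambda>i. c (i + k)"] c by auto
    have "r' / 3 = (\<Sum>i. 2 * real_of_int (c (i + Suc k)) / 3 ^ (i + 1) / 3)"
      unfolding r'_def by (rule suminf_divide[symmetric]) (use sm[of "\<lambda>i. c (i + Suc k)"] c in auto)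
    moreover have "r = (\<Sum>i. 2 * real_of_int (c (Suc i + k)) / 3 ^ (Suc i + 1)) + 2 * of_int (c k) / 3"
      unfolding r_def using suminf_split_head[OF s] by simp
    ultimately show ?thesis by (simp add: field_simps)
  qed
  then have "sch r = real_of_int (c k)"
    using c[of k] r' sch_low[of r] sch_high[of r] by auto
  then show ?thesis unfolding e sch_add_even .
qed

text \<open>The digit in place \<open>j + 1\<close> after the binary point.\<close>

definition digit :: "real \<Rightarrow> nat \<Rightarrow> int" where
  "digit x j = \<lfloor>2 ^ (j + 1) * x\<rfloor> - 2 * \<lfloor>2 ^ j * x\<rfloor>"

lemma digit_01: "digit x j \<in> {0, 1}"
proof -
  have "digit x j = 0 \<or> digit x j = 1"
    unfolding digit_def by (simp add: mult.assoc) linarith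
  then show ?thesis by simp
qed

text \<open>The partial sums telescope to the dyadic truncations of \<open>x\<close>; the integer
  part, where the telescoping starts, is 0.\<close>

lemma digit_sums:
  assumes "0 \<le> x" "x < 1"
  shows "(\<lambda>j. real_of_int (digit x j) / 2 ^ (j + 1)) sums x"
proof -
  have p: "(\<Sum>j<m. real_of_int (digit x j) / 2 ^ (j + 1)) = of_int \<lfloor>2 ^ m * x\<rfloor> / 2 ^ m" for m
  proof (induction m)
    case 0
    have "\<lfloor>x\<rfloor> = 0" using assms by linarith
    then show ?case by simp
  next
    case (Suc m)
    then show ?case by (simp add: digit_def field_simps)
  qed
  have "(\<lambda>m. of_int \<lfloor>2 ^ m * x\<rfloor> / 2 ^ m) \<longlonglongrightarrow> x"
  proof (rule tendsto_sandwich)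
    show "\<forall>\<^sub>F m in sequentially. x - (1/2) ^ m \<le> of_int \<lfloor>2 ^ m * x\<rfloor> / 2 ^ m"
    proof (intro always_eventually allI)
      fix m
      have "2 ^ m * x - 1 \<le> of_int \<lfloor>2 ^ m * x\<rfloor>" by linarith
      then have "(2 ^ m * x - 1) / 2 ^ m \<le> of_int \<lfloor>2 ^ m * x\<rfloor> / 2 ^ m" by (intro divide_right_mono) auto
      then show "x - (1/2) ^ m \<le> of_int \<lfloor>2 ^ m * x\<rfloor> / 2 ^ m" by (simp add: diff_divide_distrib power_one_over)
    qed
    show "\<forall>\<^sub>F m in sequentially. of_int \<lfloor>2 ^ m * x\<rfloor> / 2 ^ m \<le> x"
    proof (intro always_eventually allI)
      fix m
      have "of_int \<lfloor>2 ^ m * x\<rfloor> \<le> 2 ^ m * x" by linarith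
      then have "of_int \<lfloor>2 ^ m * x\<rfloor> / 2 ^ m \<le> (2 ^ m * x) / 2 ^ m" by (intro divide_right_mono) auto
      then show "of_int \<lfloor>2 ^ m * x\<rfloor> / 2 ^ m \<le> x" by simp
    qed
    have "(\<lambda>m. x - (1/2) ^ m) \<longlonglongrightarrow> x - 0"
      by (intro tendsto_intros LIMSEQ_power_zero) auto
    then show "(\<lambda>m. x - (1/2) ^ m) \<longlonglongrightarrow> x" by simp
  qed simp
  then show ?thesis unfolding sums_def p .
qed

text \<open>The right inverse \<open>\<kappa>\<close> interleaves the binary digits of all
  coordinates into one ternary expansion with digits 0 and 2, and Schoenberg's curve reads them
  back. Continuity of \<open>\<phi>\<close> lets test functions be pulled back to the line, whereas
  measures can be pushed forward by a map that is merely Borel, such as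
  \<open>\<kappa>\<close>.\<close>

lemma unit_cube_curve:
  obtains \<phi> :: "real \<Rightarrow> 'a::euclidean_space" and \<kappa> :: "'a \<Rightarrow> real"
  where "continuous_on UNIV \<phi>" "\<kappa> \<in> borel_measurable borel" "\<And>x. 0 \<le> \<kappa> x \<and> \<kappa> x \<le> 1"
    "\<And>x. (\<And>b. b \<in> Basis \<Longrightarrow> 0 \<le> x \<bullet> b \<and> x \<bullet> b < 1) \<Longrightarrow> \<phi> (\<kappa> x) = x"
proof -
  define N where "N = DIM('a)"
  have N: "N > 0" by (simp add: N_def)
  obtain h where h: "bij_betw h (Basis :: 'a set) {0..<N}"
    using ex_bij_betw_finite_nat[of "Basis :: 'a set"] by (auto simp: N_def)
  define g where "g = inv_into Basis h"
  have gh: "g (h b) = b" if "b \<in> Basis" for b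
    using that h unfolding g_def by (auto simp: bij_betw_def)
  have hN: "h b < N" if "b \<in> Basis" for b using that h by (auto simp: bij_betw_def)
  define \<phi>c where "\<phi>c b t = (\<Sum>j. sch (3 ^ (N * j + h b) * t) / 2 ^ (j + 1))" for b :: 'a and t
  define \<phi> where "\<phi> t = (\<Sum>b\<in>Basis. \<phi>c b t *\<^sub>R b)" for t
  \<comment> \<open>Digit \<open>j\<close> of the coordinate \<open>b\<close> is stored at position
    \<open>N * j + h b\<close>, the exponent used in \<open>\<phi>c\<close>.\<close>
  define c where "c x k = digit (x \<bullet> g (k mod N)) (k div N)" for x k
  define \<kappa> where "\<kappa> x = (\<Sum>i. 2 * real_of_int (c x i) / 3 ^ (i + 1))" for x
  have c01: "c x k \<in> {0, 1}" for x k using digit_01 by (simp add: c_def)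
  have sum2: "summable (\<lambda>j. 1 / 2 ^ (j + 1) :: real)"
    using summable_mult[OF summable_geometric[of "1/2::real"], of "1/2"] by (simp add: power_divide)
  have "continuous_on UNIV (\<phi>c b)" for b
  proof -
    have "uniform_limit UNIV (\<lambda>n t. \<Sum>j<n. sch (3 ^ (N * j + h b) * t) / 2 ^ (j + 1)) (\<lambda>t. \<Sum>j. sch (3 ^ (N * j + h b) * t) / 2 ^ (j + 1)) sequentially"
      by (rule Weierstrass_m_test[OF _ sum2]) (use sch_bounds in \<open>auto intro!: divide_right_mono\<close>)
    then show ?thesis unfolding \<phi>c_def
      by (rule uniform_limit_theorem[rotated]) (auto intro!: always_eventually continuous_intros)
  qed
  then have 1: "continuous_on UNIV \<phi>" unfolding \<phi>_def by (intro continuous_intros)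
  have 2: "\<kappa> \<in> borel_measurable borel" unfolding \<kappa>_def c_def digit_def by measurable
  have 3: "0 \<le> \<kappa> x \<and> \<kappa> x \<le> 1" for x
  proof -
    have le: "2 * real_of_int (c x i) / 3 ^ (i + 1) \<le> 2 / 3 ^ (i + 1)" "0 \<le> 2 * real_of_int (c x i) / 3 ^ (i + 1)"
      "norm (2 * real_of_int (c x i) / 3 ^ (i + 1)) \<le> 2 / 3 ^ (i + 1)" for i
      using c01[of x i] by auto
    have sm: "summable (\<lambda>i. 2 * real_of_int (c x i) / 3 ^ (i + 1))"
      by (rule summable_comparison_test'[OF sums_summable[OF sums_2_over_3], where N=0]) (rule le(3))
    have "\<kappa> x \<le> (\<Sum>i. 2 / 3 ^ (i + 1))" unfolding \<kappa>_def
      by (rule suminf_le[OF _ sm sums_summable[OF sums_2_over_3]]) (use le in auto)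
    moreover have "0 \<le> \<kappa> x" unfolding \<kappa>_def by (rule suminf_nonneg[OF sm]) (use le in auto)
    ultimately show ?thesis using sums_unique[OF sums_2_over_3] by simp
  qed
  have 4: "\<phi> (\<kappa> x) = x" if x: "\<And>b. b \<in> Basis \<Longrightarrow> 0 \<le> x \<bullet> b \<and> x \<bullet> b < 1" for x
  proof -
    have "\<phi>c b (\<kappa> x) = x \<bullet> b" if b: "b \<in> Basis" for b
    proof -
      have "sch (3 ^ (N * j + h b) * \<kappa> x) = real_of_int (digit (x \<bullet> b) j)" for j
        unfolding \<kappa>_def using sch_ternary[of "c x", OF c01] hN[OF b] gh[OF b] by (simp add: c_def)
      then show ?thesis unfolding \<phi>c_def using digit_sums[of "x \<bullet> b"] x[OF b] by (simp add: sums_iff)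
    qed
    then show ?thesis unfolding \<phi>_def by (simp add: euclidean_representation)
  qed
  show thesis by (rule that[OF 1 2 3 4])
qed

lemma cball_curve:
  obtains \<phi> :: "real \<Rightarrow> 'a::euclidean_space" and \<kappa> :: "'a \<Rightarrow> real"
  where "continuous_on UNIV \<phi>" "\<kappa> \<in> borel_measurable borel" "\<And>x. 0 \<le> \<kappa> x \<and> \<kappa> x \<le> 1"
    "\<And>x. norm x \<le> R \<Longrightarrow> \<phi> (\<kappa> x) = x"
proof -
  obtain \<phi> :: "real \<Rightarrow> 'a" and \<kappa> where pk: "continuous_on UNIV \<phi>" "\<kappa> \<in> borel_measurable borel" "\<And>x. 0 \<le> \<kappa> x \<and> \<kappa> x \<le> 1"
    "\<And>x. (\<And>b. b \<in> Basis \<Longrightarrow> 0 \<le> x \<bullet> b \<and> x \<bullet> b < 1) \<Longrightarrow> \<phi> (\<kappa> x) = x"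
    using unit_cube_curve by metis
  note [measurable] = pk(2)
  \<comment> \<open>The side exceeds \<open>2 * \<bar>R\<bar>\<close> so that the rescaled
    coordinates stay strictly below 1, as the half-open cube requires.\<close>
  define L where "L = 2 * \<bar>R\<bar> + 1"
  define s :: 'a where "s = (\<Sum>b\<in>Basis. \<bar>R\<bar> *\<^sub>R b)"
  have sb: "s \<bullet> b = \<bar>R\<bar>" if "b \<in> Basis" for b
    using that by (simp add: s_def inner_sum_left inner_Basis if_distrib cong: if_cong)
  have L: "L > 0" by (simp add: L_def)
  show thesis
  proof (rule that[of "\<lambda>t. L *\<^sub>R \<phi> t - s" "\<lambda>x. \<kappa> ((1 / L) *\<^sub>R (x + s))"])
    show "continuous_on UNIV (\<lambda>t. L *\<^sub>R \<phi> t - s)" by (intro continuous_intros pk)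
    fix x :: 'a assume x: "norm x \<le> R"
    have "\<phi> (\<kappa> ((1 / L) *\<^sub>R (x + s))) = (1 / L) *\<^sub>R (x + s)"
    proof (rule pk(4))
      fix b :: 'a assume b: "b \<in> Basis"
      have "\<bar>x \<bullet> b\<bar> \<le> R" using Basis_le_norm[OF b, of x] x by simp
      then have "0 \<le> (x \<bullet> b + \<bar>R\<bar>) / L \<and> (x \<bullet> b + \<bar>R\<bar>) / L < 1"
        using L by (simp add: pos_divide_less_eq) (auto simp: L_def)
      then show "0 \<le> (1 / L) *\<^sub>R (x + s) \<bullet> b \<and> (1 / L) *\<^sub>R (x + s) \<bullet> b < 1"
        by (simp add: inner_add_left sb[OF b])
    qed
    then show "L *\<^sub>R \<phi> (\<kappa> ((1 / L) *\<^sub>R (x + s))) - s = x" using L by simp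
  qed (use pk in auto)
qed

text \<open>The measures are pushed to the unit interval by \<open>\<kappa>\<close>, normalised, and
  Helly's theorem gives a limit law there, which \<open>\<phi>\<close> carries back. Since
  \<open>\<phi>\<close> undoes \<open>\<kappa>\<close> on the ball of radius \<open>R\<close>,
  integrals of \<open>f\<close> become integrals of the bounded continuous function \<open>f\<close>
  composed with \<open>\<phi>\<close>. Convergence of the masses allows the normalisation to be
  reverted.\<close>

lemma weak_compactness:
  fixes M :: "nat \<Rightarrow> 'a::euclidean_space measure"
  assumes fin: "\<And>j. finite_measure (M j)" and s: "\<And>j. sets (M j) = sets borel"
    and R: "\<And>j. AE x in M j. norm x \<le> R" and m: "(\<lambda>j. measure (M j) UNIV) \<longlonglongrightarrow> m"
  obtains r \<Lambda> where "strict_mono (r :: nat \<Rightarrow> nat)" "finite_measure \<Lambda>" "sets \<Lambda> = sets borel"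
    "\<And>f :: 'a \<Rightarrow> real. continuous_on UNIV f \<Longrightarrow> bounded (range f) \<Longrightarrow> (\<lambda>j. \<integral>x. f x \<partial>M (r j)) \<longlonglongrightarrow> (\<integral>x. f x \<partial>\<Lambda>)"
proof -
  interpret M: finite_measure "M j" for j by fact
  note s[measurable_cong]
  have sp[simp]: "space (M j) = UNIV" for j using sets_eq_imp_space_eq[OF s[of j]] by simp
  obtain \<phi> :: "real \<Rightarrow> 'a" and \<kappa> where pk: "continuous_on UNIV \<phi>" "\<kappa> \<in> borel_measurable borel" "\<And>x. 0 \<le> \<kappa> x \<and> \<kappa> x \<le> 1"
    "\<And>x. norm x \<le> R \<Longrightarrow> \<phi> (\<kappa> x) = x"
    using cball_curve[of R] by metis
  note [measurable] = pk(2)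
  have [measurable]: "\<phi> \<in> borel_measurable borel" using pk(1) by (rule borel_measurable_continuous_onI)
  \<comment> \<open>A measure of mass zero cannot be normalised; the Dirac measure is a placeholder
    that is later multiplied by that mass.\<close>
  define D where "D j = (if measure (M j) UNIV = 0 then return borel 0
      else density (distr (M j) borel \<kappa>) (\<lambda>_. ennreal (1 / measure (M j) UNIV)))" for j
  have sD: "sets (D j) = sets borel" for j by (simp add: D_def)
  have pD: "prob_space (D j)" for j
  proof (cases "measure (M j) UNIV = 0")
    case True
    then show ?thesis by (simp add: D_def prob_space_return)
  next
    case False
    then have pos: "measure (M j) UNIV > 0" using measure_nonneg[of "M j" UNIV] by linarith
    have "emeasure (D j) (space (D j)) = ennreal (1 / measure (M j) UNIV) * ennreal (measure (M j) UNIV)"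
      using False by (simp add: D_def emeasure_density nn_integral_distr emeasure_distr M.emeasure_eq_measure mult.commute)
    also have "\<dots> = 1" using pos by (simp flip: ennreal_mult)
    finally show ?thesis by (rule prob_spaceI)
  qed
  have rD: "real_distribution (D j)" for j
    using pD[of j] sD[of j] by (simp add: real_distribution_def real_distribution_axioms_def)
  \<comment> \<open>\<open>tight\<close> is phrased with intervals open on the left, so the left end
    has to lie below the value 0 that \<open>\<kappa>\<close> may take.\<close>
  have D01: "measure (D j) {-1<..1} = 1" for j
  proof -
    interpret prob_space "D j" by fact
    have "AE x in D j. x \<in> {-1<..1}"
    proof (cases "measure (M j) UNIV = 0")
      case True
      then have D: "D j = return borel 0" by (simp add: D_def)
      show ?thesis unfolding D using AE_return[of 0 borel "\<lambda>x. x \<in> {-1<..1::real}"] by (simp del: AE_conj_iff)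
    next
      case False
      have "-1 < \<kappa> x \<and> \<kappa> x \<le> 1" for x using pk(3)[of x] by linarith
      then have "AE x in M j. \<kappa> x \<in> {-1<..1}" by auto
      then have *: "AE x in distr (M j) borel \<kappa>. x \<in> {-1<..1}" by (subst AE_distr_iff) auto
      have D: "D j = density (distr (M j) borel \<kappa>) (\<lambda>_. ennreal (1 / measure (M j) UNIV))"
        using False by (simp add: D_def)
      show ?thesis unfolding D using * by (subst AE_density) (auto elim: eventually_mono)
    qed
    then show ?thesis using sD by (subst prob_eq_1) auto
  qed
  have tight: "tight D"
    unfolding tight_def
  proof (intro conjI allI impI rD)
    fix e :: real assume "e > 0"
    then show "\<exists>a b. a < b \<and> (\<forall>n. 1 - e < measure (D n) {a<..b})"
      by (intro exI[of _ "-1"] exI[of _ 1]) (simp add: D01)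
  qed
  obtain r M' where r: "strict_mono (r :: nat \<Rightarrow> nat)" "real_distribution M'" "weak_conv_m (D \<circ> id \<circ> r) M'"
    using tight_imp_convergent_subsubsequence[OF tight strict_mono_id] by blast
  interpret M': real_distribution M' by fact
  define \<Lambda> where "\<Lambda> = density (distr M' borel \<phi>) (\<lambda>_. ennreal m)"
  have m0: "m \<ge> 0" by (rule tendsto_lowerbound[OF m]) auto
  have "emeasure \<Lambda> (space \<Lambda>) = ennreal m"
    by (simp add: \<Lambda>_def emeasure_density nn_integral_distr emeasure_distr M'.emeasure_space_1[simplified])
  then have fL: "finite_measure \<Lambda>" by (intro finite_measureI) simp
  have conv: "(\<lambda>j. \<integral>x. f x \<partial>M (r j)) \<longlonglongrightarrow> (\<integral>x. f x \<partial>\<Lambda>)" if f: "continuous_on UNIV f" "bounded (range f)" for f :: "'a \<Rightarrow> real"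
  proof -
    obtain B where B: "\<And>x. norm (f x) \<le> B" using f(2) by (auto simp: bounded_iff)
    have [measurable]: "f \<in> borel_measurable borel" using f(1) by (rule borel_measurable_continuous_onI)
    have cf: "continuous_on UNIV (\<lambda>t. f (\<phi> t))" using f(1) pk(1) by (rule continuous_on_compose2) auto
    have "(\<lambda>j. \<integral>t. f (\<phi> t) \<partial>((D \<circ> id \<circ> r) j)) \<longlonglongrightarrow> (\<integral>t. f (\<phi> t) \<partial>M')"
      by (rule weak_conv_imp_integral_bdd_continuous_conv[OF _ r(2) r(3), where B=B])
         (use rD cf B in \<open>auto simp: continuous_on_eq_continuous_within\<close>)
    moreover have "(\<lambda>j. measure (M (r j)) UNIV) \<longlonglongrightarrow> m"
      using LIMSEQ_subseq_LIMSEQ[OF m r(1)] by (simp add: o_def)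
    ultimately have "(\<lambda>j. measure (M (r j)) UNIV * (\<integral>t. f (\<phi> t) \<partial>D (r j))) \<longlonglongrightarrow> m * (\<integral>t. f (\<phi> t) \<partial>M')"
      by (intro tendsto_mult) (auto simp: o_def)
    moreover have "measure (M j) UNIV * (\<integral>t. f (\<phi> t) \<partial>D j) = (\<integral>x. f x \<partial>M j)" for j
    proof (cases "measure (M j) UNIV = 0")
      case True
      have "AE x in M j. False" using True M.emeasure_eq_measure[of j UNIV] by (intro AE_I[where N=UNIV]) auto
      then have "(\<integral>x. f x \<partial>M j) = (\<integral>x. 0 \<partial>M j)" by (intro integral_cong_AE) auto
      then show ?thesis using True by simp
    next
      case False
      then have pos: "measure (M j) UNIV > 0" using measure_nonneg[of "M j" UNIV] by linarith
      have "(\<integral>t. f (\<phi> t) \<partial>D j) = (\<integral>x. (1 / measure (M j) UNIV) *\<^sub>R f (\<phi> (\<kappa> x)) \<partial>M j)"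
        using False by (simp add: D_def integral_density integral_distr)
      also have "\<dots> = (\<integral>x. (1 / measure (M j) UNIV) *\<^sub>R f x \<partial>M j)"
      proof (intro integral_cong_AE)
        show "AE x in M j. (1 / measure (M j) UNIV) *\<^sub>R f (\<phi> (\<kappa> x)) = (1 / measure (M j) UNIV) *\<^sub>R f x"
          using R[of j] by eventually_elim (simp add: pk(4))
      qed auto
      finally show ?thesis using pos by simp
    qed
    moreover have "m * (\<integral>t. f (\<phi> t) \<partial>M') = (\<integral>x. f x \<partial>\<Lambda>)"
      unfolding \<Lambda>_def using m0 by (simp add: integral_density integral_distr)
    ultimately show ?thesis by simp
  qed
  show thesis
    by (rule that[OF r(1) fL _ conv]) (auto simp: \<Lambda>_def)
qed

section \<open>Mollifications converge almost everywhere to the density\<close>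

lemma ball_measurable [measurable]: "ball c r \<in> sets borel" "cball c r \<in> sets borel"
  by auto

lemma emeasure_UN_countable_le:
  assumes [measurable]: "\<And>i. i \<in> I \<Longrightarrow> X i \<in> sets M" and I: "countable I"
  shows "emeasure M (\<Union>i\<in>I. X i) \<le> (\<integral>\<^sup>+i. emeasure M (X i) \<partial>count_space I)"
proof -
  have "emeasure M (\<Union>i\<in>I. X i) = (\<integral>\<^sup>+x. indicator (\<Union>i\<in>I. X i) x \<partial>M)"
    using assms by (intro nn_integral_indicator[symmetric] sets.countable_UN') auto
  also have "\<dots> \<le> (\<integral>\<^sup>+x. \<integral>\<^sup>+i. indicator (X i) x \<partial>count_space I \<partial>M)"
  proof (intro nn_integral_mono)
    fix x
    show "indicator (\<Union>i\<in>I. X i) x \<le> (\<integral>\<^sup>+i. indicator (X i) x \<partial>count_space I :: ennreal)"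
    proof (cases "x \<in> (\<Union>i\<in>I. X i)")
      case True
      then obtain j where j: "j \<in> I" "x \<in> X j" by blast
      have "(\<integral>\<^sup>+i. indicator {j} i \<partial>count_space I) \<le> (\<integral>\<^sup>+i. indicator (X i) x \<partial>count_space I :: ennreal)"
        using j by (intro nn_integral_mono) (auto simp: indicator_def)
      then show ?thesis using j True by (simp add: nn_integral_indicator)
    qed simp
  qed
  also have "\<dots> = (\<integral>\<^sup>+i. emeasure M (X i) \<partial>count_space I)"
    using I by (subst nn_integral_count_space_nn_integral) (auto intro!: nn_integral_cong)
  finally show ?thesis .
qed

text \<open>A covering argument. By outer regularity \<open>A\<close> lies in an open set
  \<open>U\<close> of small \<open>\<tau>\<close>-measure. Each bad point is the centre of small
  balls inside \<open>U\<close> whose volume is at most a constant times their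
  \<open>\<tau>\<close>-measure; Vitali's lemma selects disjoint ones whose fivefold enlargements
  cover the bad points, with total volume controlled by \<open>emeasure \<tau> U\<close>. The bad
  set is only enclosed in null sets, never shown to be measurable.\<close>

lemma zero_density_AE:
  fixes \<tau> :: "'a::euclidean_space measure"
  assumes fin: "finite_measure \<tau>" and s: "sets \<tau> = sets borel"
    and A: "A \<in> sets borel" "emeasure \<tau> A = 0"
  shows "AE z in lborel. z \<in> A \<longrightarrow> (\<forall>e>0. \<exists>d>0. \<forall>r. 0 < r \<longrightarrow> r < d \<longrightarrow> emeasure \<tau> (cball z r) \<le> ennreal (e * r ^ DIM('a)))"
proof -
  interpret finite_measure \<tau> by fact
  define n where "n = DIM('a)"
  define Bad where "Bad e = {z\<in>A. \<forall>d>0. \<exists>r. 0 < r \<and> r < d \<and> emeasure \<tau> (cball z r) > ennreal (e * r ^ n)}" for e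
  define V where "V = unit_ball_vol (real n)"
  have V: "V \<ge> 0" by (simp add: V_def)
  have cover: "\<exists>W\<in>sets borel. Bad e \<subseteq> W \<and> emeasure lborel W \<le> ennreal (V * 5 ^ n / e * \<eta>)" if e: "e > 0" and \<eta>: "\<eta> > 0" for e \<eta> :: real
  proof -
    have "(INF U\<in>{U. A \<subseteq> U \<and> open U}. emeasure \<tau> U) = 0"
      using outer_regular[of \<tau> A] s A by simp
    then have "(INF U\<in>{U. A \<subseteq> U \<and> open U}. emeasure \<tau> U) < ennreal \<eta>" using \<eta> by simp
    then obtain U where U: "A \<subseteq> U" "open U" "emeasure \<tau> U < ennreal \<eta>"
      unfolding INF_less_iff by blast
    define K where "K = {(z, r). z \<in> Bad e \<and> 0 < r \<and> r \<le> 1 \<and> cball z r \<subseteq> U \<and> emeasure \<tau> (cball z r) > ennreal (e * r ^ n)}"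
    have BK: "Bad e \<subseteq> (\<Union>i\<in>K. cball (fst i) (snd i))"
    proof
      fix z assume z: "z \<in> Bad e"
      then have "z \<in> U" using U by (auto simp: Bad_def)
      then obtain d where d: "d > 0" "cball z d \<subseteq> U" using U(2) open_contains_cball by blast
      obtain r where r: "0 < r" "r < min d 1" "emeasure \<tau> (cball z r) > ennreal (e * r ^ n)"
        using z d(1) unfolding Bad_def by (auto dest: spec[of _ "min d 1"])
      then have "cball z r \<subseteq> U" using d(2) by (meson less_imp_le min_less_iff_conj order_trans subset_cball)
      then have "(z, r) \<in> K" using z r by (auto simp: K_def)
      moreover have "z \<in> cball z r" using r by simp
      ultimately show "z \<in> (\<Union>i\<in>K. cball (fst i) (snd i))" by force
    qed
    have Kr: "\<And>i. i \<in> K \<Longrightarrow> 0 < snd i \<and> snd i \<le> 1" by (auto simp: K_def)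
    obtain C where C: "countable C" "C \<subseteq> K"
      "pairwise (\<lambda>i j. disjnt (cball (fst i) (snd i)) (cball (fst j) (snd j))) C"
      "Bad e \<subseteq> (\<Union>i\<in>C. cball (fst i) (5 * snd i))"
      by (rule Vitali_covering_lemma_cballs[OF BK Kr])
    define W where "W = (\<Union>i\<in>C. cball (fst i) (5 * snd i))"
    have dj: "disjoint_family_on (\<lambda>i. cball (fst i) (snd i)) C"
      using C(3) unfolding disjoint_family_on_def pairwise_def disjnt_def by blast
    have "emeasure lborel W \<le> (\<integral>\<^sup>+i. emeasure lborel (cball (fst i) (5 * snd i)) \<partial>count_space C)"
      unfolding W_def using C(1) by (intro emeasure_UN_countable_le) auto
    also have "\<dots> \<le> (\<integral>\<^sup>+i. ennreal (V * 5 ^ n / e) * emeasure \<tau> (cball (fst i) (snd i)) \<partial>count_space C)"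
    proof (intro nn_integral_mono)
      fix i assume "i \<in> space (count_space C)"
      then have i: "0 < snd i" "ennreal (e * snd i ^ n) \<le> emeasure \<tau> (cball (fst i) (snd i))"
        using C(2) by (auto simp: K_def)
      have "emeasure lborel (cball (fst i) (5 * snd i)) = ennreal (V * 5 ^ n / e) * ennreal (e * snd i ^ n)"
        using i e V by (simp add: emeasure_cball V_def n_def power_mult_distrib flip: ennreal_mult)
      also have "\<dots> \<le> ennreal (V * 5 ^ n / e) * emeasure \<tau> (cball (fst i) (snd i))"
        by (intro mult_left_mono i) auto
      finally show "emeasure lborel (cball (fst i) (5 * snd i)) \<le> ennreal (V * 5 ^ n / e) * emeasure \<tau> (cball (fst i) (snd i))" .
    qed
    also have "\<dots> = ennreal (V * 5 ^ n / e) * emeasure \<tau> (\<Union>i\<in>C. cball (fst i) (snd i))"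
      using C(1) dj s by (subst emeasure_UN_countable) (auto simp: nn_integral_cmult)
    also have "\<dots> \<le> ennreal (V * 5 ^ n / e) * ennreal \<eta>"
    proof -
      have "emeasure \<tau> (\<Union>i\<in>C. cball (fst i) (snd i)) \<le> emeasure \<tau> U"
      proof (intro emeasure_mono UN_least)
        fix i assume "i \<in> C"
        then show "cball (fst i) (snd i) \<subseteq> U" using C(2) unfolding K_def by fastforce
      qed (use U(2) s in auto)
      then show ?thesis using U(3) by (intro mult_left_mono) auto
    qed
    also have "\<dots> = ennreal (V * 5 ^ n / e * \<eta>)" using V e \<eta> by (subst ennreal_mult) auto
    finally have "emeasure lborel W \<le> ennreal (V * 5 ^ n / e * \<eta>)" .
    moreover have "W \<in> sets borel" unfolding W_def using C(1) by (intro sets.countable_UN') auto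
    ultimately show ?thesis using C(4) unfolding W_def by blast
  qed
  have null: "\<exists>N\<in>null_sets lborel. Bad e \<subseteq> N" if e: "e > 0" for e
  proof -
    have "\<forall>j. \<exists>W\<in>sets borel. Bad e \<subseteq> W \<and> emeasure lborel W \<le> ennreal (V * 5 ^ n / e * (1 / real (Suc j)))"
      by (intro allI cover[OF e]) simp
    then obtain W where W: "\<And>j. W j \<in> sets borel" "\<And>j. Bad e \<subseteq> W j" "\<And>j. emeasure lborel (W j) \<le> ennreal (V * 5 ^ n / e * (1 / real (Suc j)))"
      by metis
    define N where "N = (\<Inter>j. W j)"
    have "emeasure lborel N \<le> ennreal (V * 5 ^ n / e * (1 / real (Suc j)))" for j
      using W(3)[of j] emeasure_mono[of N "W j" lborel] W(1)[of j] by (auto simp: N_def intro: order_trans)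
    moreover have "(\<lambda>j. ennreal (V * 5 ^ n / e * (1 / real (Suc j)))) \<longlonglongrightarrow> ennreal (V * 5 ^ n / e * 0)"
      using LIMSEQ_inverse_real_of_nat by (intro tendsto_intros) (simp add: inverse_eq_divide)
    ultimately have "emeasure lborel N \<le> ennreal (V * 5 ^ n / e * 0)"
      by (intro tendsto_lowerbound[of _ _ sequentially] always_eventually) auto
    then have "emeasure lborel N = 0" by simp
    moreover have "N \<in> sets borel" unfolding N_def using W(1) by auto
    ultimately show ?thesis using W(2) by (intro bexI[of _ N]) (auto simp: N_def null_sets_def)
  qed
  have "AE z in lborel. \<forall>k. z \<notin> Bad (1 / real (Suc k))"
  proof (subst AE_all_countable, intro allI)
    fix k
    obtain N where "N \<in> null_sets lborel" "Bad (1 / real (Suc k)) \<subseteq> N" using null[of "1 / real (Suc k)"] by auto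
    then show "AE z in lborel. z \<notin> Bad (1 / real (Suc k))" by (intro AE_I'[of N]) auto
  qed
  then show ?thesis
  proof eventually_elim
    case (elim z)
    show ?case
    proof (intro impI allI)
      fix e :: real assume z: "z \<in> A" and e: "e > 0"
      obtain k where k: "1 / real (Suc k) < e" using e nat_approx_posE by blast
      have "z \<notin> Bad (1 / real (Suc k))" using elim by blast
      then obtain d where "d > 0" "\<not> (\<exists>r. 0 < r \<and> r < d \<and> emeasure \<tau> (cball z r) > ennreal (1 / real (Suc k) * r ^ n))"
        using z unfolding Bad_def by blast
      then have d: "d > 0" "\<And>r. 0 < r \<Longrightarrow> r < d \<Longrightarrow> emeasure \<tau> (cball z r) \<le> ennreal (1 / real (Suc k) * r ^ n)"
        by (meson not_less)+
      have "emeasure \<tau> (cball z r) \<le> ennreal (e * r ^ n)" if "0 < r" "r < d" for r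
        using d(2)[OF that] k that by (elim order_trans) (intro ennreal_leI mult_right_mono, auto)
      then show "\<exists>d>0. \<forall>r. 0 < r \<longrightarrow> r < d \<longrightarrow> emeasure \<tau> (cball z r) \<le> ennreal (e * r ^ DIM('a))"
        using d(1) unfolding n_def by blast
    qed
  qed
qed

text \<open>For rational \<open>q\<close> near \<open>h z\<close>, the oscillation of
  \<open>h\<close> around \<open>h z\<close> is at most the excess of
  \<open>\<bar>h w - q\<bar>\<close> over \<open>1 / Suc j\<close> plus a small constant. The
  measure with that excess as density vanishes on \<open>A q j\<close>, so
  \<open>zero_density_AE\<close> applies, and there are countably many choices of \<open>q\<close>,
  \<open>j\<close> and \<open>N\<close>.\<close>

lemma Lebesgue_points_AE:
  fixes h :: "'a::euclidean_space \<Rightarrow> real"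
  assumes h: "integrable lborel h"
  shows "AE z in lborel. \<forall>e>0. \<exists>d>0. \<forall>r. 0 < r \<longrightarrow> r < d \<longrightarrow>
    (\<integral>\<^sup>+w. ennreal \<bar>h w - h z\<bar> * indicator (cball z r) w \<partial>lborel) \<le> ennreal (e * r ^ DIM('a))"
proof -
  define n where "n = DIM('a)"
  define V where "V = unit_ball_vol (real n)"
  have V: "V \<ge> 0" by (simp add: V_def)
  have [measurable]: "h \<in> borel_measurable borel" using h by auto
  \<comment> \<open>The cut-off to a ball makes the measure with this density finite.\<close>
  define g where "g q j N w = max (\<bar>h w - q\<bar> - 1 / real (Suc j)) 0 * indicator (ball 0 (real N)) w" for q j N and w :: 'a
  have [measurable]: "g q j N \<in> borel_measurable borel" for q j N unfolding g_def by measurable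
  define \<tau> where "\<tau> q j N = density lborel (\<lambda>w. ennreal (g q j N w))" for q j N
  have fin: "finite_measure (\<tau> q j N)" for q j N
  proof (intro finite_measureI)
    have "emeasure (\<tau> q j N) (space (\<tau> q j N)) = (\<integral>\<^sup>+w. ennreal (g q j N w) \<partial>lborel)"
      by (simp add: \<tau>_def emeasure_density)
    also have "\<dots> \<le> (\<integral>\<^sup>+w. ennreal \<bar>h w\<bar> + ennreal \<bar>q\<bar> * indicator (ball 0 (real N)) w \<partial>lborel)"
    proof (intro nn_integral_mono)
      fix w :: 'a
      have "0 \<le> 1 / real (Suc j)" by simp
      then have "\<bar>h w - q\<bar> - 1 / real (Suc j) \<le> \<bar>h w\<bar> + \<bar>q\<bar>" by linarith
      then show "ennreal (g q j N w) \<le> ennreal \<bar>h w\<bar> + ennreal \<bar>q\<bar> * indicator (ball 0 (real N)) w"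
        by (auto simp: g_def indicator_def simp flip: ennreal_plus intro!: ennreal_leI)
    qed
    also have "\<dots> = (\<integral>\<^sup>+w. ennreal \<bar>h w\<bar> \<partial>lborel) + ennreal \<bar>q\<bar> * emeasure lborel (ball (0::'a) (real N))"
      by (subst nn_integral_add) (auto simp: nn_integral_cmult)
    also have "\<dots> < \<infinity>"
      using h emeasure_lborel_ball_finite[of "0::'a" "real N"] by (auto simp: integrable_iff_bounded ennreal_mult_less_top)
    finally show "emeasure (\<tau> q j N) (space (\<tau> q j N)) \<noteq> \<infinity>" by simp
  qed
  define A where "A q j = {w. \<bar>h w - q\<bar> \<le> 1 / real (Suc j)}" for q j
  have [measurable]: "A q j \<in> sets borel" for q j unfolding A_def by measurable
  have A0: "emeasure (\<tau> q j N) (A q j) = 0" for q j N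
  proof -
    have "emeasure (\<tau> q j N) (A q j) = (\<integral>\<^sup>+w. ennreal (g q j N w) * indicator (A q j) w \<partial>lborel)"
      by (simp add: \<tau>_def emeasure_density)
    also have "\<dots> = (\<integral>\<^sup>+w. 0 \<partial>(lborel :: 'a measure))"
      by (intro nn_integral_cong) (auto simp: g_def A_def indicator_def)
    finally show ?thesis by simp
  qed
  have "AE z in lborel. \<forall>q\<in>\<rat>. \<forall>j N. z \<in> A q j \<longrightarrow> (\<forall>e>0. \<exists>d>0. \<forall>r. 0 < r \<longrightarrow> r < d \<longrightarrow> emeasure (\<tau> q j N) (cball z r) \<le> ennreal (e * r ^ n))"
    unfolding n_def
    by (intro AE_ball_countable[THEN iffD2] countable_rat ballI AE_all_countable[THEN iffD2] allI zero_density_AE fin A0)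
       (auto simp: \<tau>_def)
  then show ?thesis
  proof eventually_elim
    case (elim z)
    show ?case
    proof (intro allI impI)
      fix e :: real assume e: "e > 0"
      \<comment> \<open>The excess contributes \<open>e' * r ^ n\<close> and the constant
        \<open>2 * c\<close> at most \<open>2 * e' * V * r ^ n\<close>, together
        \<open>e * r ^ n\<close>.\<close>
      define e' where "e' = e / (2 * V + 1)"
      have e': "e' > 0" using e V by (simp add: e'_def)
      obtain j where j: "1 / real (Suc j) < e'" using e' nat_approx_posE by blast
      define c where "c = 1 / real (Suc j)"
      have c: "c > 0" by (simp add: c_def)
      obtain q where q: "q \<in> \<rat>" "h z - c < q" "q < h z + c"
        using Rats_dense_in_real[of "h z - c" "h z + c"] c by auto
      then have zA: "z \<in> A q j" by (auto simp: A_def c_def)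
      obtain N where N: "norm z + 1 < real N" using reals_Archimedean2 by blast
      obtain d where d: "d > 0" "\<And>r. 0 < r \<Longrightarrow> r < d \<Longrightarrow> emeasure (\<tau> q j N) (cball z r) \<le> ennreal (e' * r ^ n)"
        using elim q(1) zA e' by meson
      have "(\<integral>\<^sup>+w. ennreal \<bar>h w - h z\<bar> * indicator (cball z r) w \<partial>lborel) \<le> ennreal (e * r ^ n)" if r: "0 < r" "r < min d 1" for r
      proof -
        have "(\<integral>\<^sup>+w. ennreal \<bar>h w - h z\<bar> * indicator (cball z r) w \<partial>lborel)
          \<le> (\<integral>\<^sup>+w. ennreal (g q j N w) * indicator (cball z r) w + ennreal (2 * c) * indicator (cball z r) w \<partial>lborel)"
        proof (intro nn_integral_mono)
          fix w :: 'a
          show "ennreal \<bar>h w - h z\<bar> * indicator (cball z r) w \<le> ennreal (g q j N w) * indicator (cball z r) w + ennreal (2 * c) * indicator (cball z r) w"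
          proof (cases "w \<in> cball z r")
            case True
            have "norm w \<le> norm z + norm (w - z)" using norm_triangle_sub[of w z] by simp
            then have "w \<in> ball 0 (real N)" using True r N by (simp add: dist_norm norm_minus_commute)
            then have "\<bar>h w - h z\<bar> \<le> g q j N w + 2 * c"
              using q unfolding g_def c_def[symmetric] by (auto simp: max_def)
            moreover have "g q j N w \<ge> 0" by (auto simp: g_def)
            ultimately show ?thesis using True c by (auto simp flip: ennreal_plus intro!: ennreal_leI)
          qed auto
        qed
        also have "\<dots> = emeasure (\<tau> q j N) (cball z r) + ennreal (2 * c) * emeasure lborel (cball z r)"
          by (subst nn_integral_add) (auto simp: \<tau>_def emeasure_density nn_integral_cmult)
        also have "\<dots> \<le> ennreal (e' * r ^ n) + ennreal (2 * e') * ennreal (V * r ^ n)"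
          using d(2)[of r] r j by (intro add_mono mult_mono ennreal_leI) (auto simp: emeasure_cball V_def n_def c_def)
        also have "\<dots> = ennreal (e' * (2 * V + 1) * r ^ n)"
          using e' V r by (subst ennreal_mult[symmetric]) (auto simp: algebra_simps simp flip: ennreal_plus)
        also have "e' * (2 * V + 1) = e" using V by (simp add: e'_def)
        finally show ?thesis .
      qed
      then show "\<exists>d>0. \<forall>r. 0 < r \<longrightarrow> r < d \<longrightarrow> (\<integral>\<^sup>+w. ennreal \<bar>h w - h z\<bar> * indicator (cball z r) w \<partial>lborel) \<le> ennreal (e * r ^ DIM('a))"
        using d(1) unfolding n_def by (intro exI[of _ "min d 1"]) auto
    qed
  qed
qed

text \<open>At a Lebesgue point \<open>z\<close> of the density \<open>h\<close>, a rescaled profile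
  has integral 1, is supported in the ball of radius \<open>\<epsilon>\<close> and is at most
  \<open>B / \<epsilon> ^ n\<close>, so the error is at most \<open>B / \<epsilon> ^ n\<close> times
  the integral of the oscillation over that ball. The exceptional null set is thus common to all
  profiles.\<close>

lemma mollification_tendsto_density:
  fixes \<tau> :: "'a::euclidean_space measure"
  assumes fin: "finite_measure \<tau>" and s: "sets \<tau> = sets borel" and ac: "absolutely_continuous lborel \<tau>"
  obtains h :: "'a \<Rightarrow> real" where "h \<in> borel_measurable borel" "\<And>z. h z \<ge> 0" "(\<integral>\<^sup>+z. ennreal (h z) \<partial>lborel) = emeasure \<tau> UNIV"
    "AE z in lborel. \<forall>\<phi> B. \<phi> \<in> borel_measurable borel \<longrightarrow> (\<forall>x. \<bar>\<phi> x\<bar> \<le> B) \<longrightarrow> (\<forall>x. norm x > 1 \<longrightarrow> \<phi> x = 0) \<longrightarrow>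
       integral\<^sup>L lborel \<phi> = 1 \<longrightarrow> ((\<lambda>\<epsilon>. \<integral>w. (1 / \<epsilon>) ^ DIM('a) * \<phi> ((1 / \<epsilon>) *\<^sub>R (w - z)) \<partial>\<tau>) \<longlongrightarrow> h z) (at_right 0)"
proof -
  interpret finite_measure \<tau> by fact
  define n where "n = DIM('a)"
  have sp: "space \<tau> = UNIV" using sets_eq_imp_space_eq[OF s] by simp
  obtain h0 where h0[measurable]: "h0 \<in> borel_measurable borel" and d0: "density lborel h0 = \<tau>"
    using sigma_finite_measure.Radon_Nikodym[OF sigma_finite_lborel ac] s by auto
  have i0: "(\<integral>\<^sup>+x. h0 x \<partial>lborel) = emeasure \<tau> UNIV"
    by (simp add: d0[symmetric] emeasure_density)
  have "AE x in lborel. h0 x \<noteq> \<infinity>"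
    by (rule nn_integral_PInf_AE) (use i0 emeasure_finite[of UNIV] in auto)
  then have h0h: "AE x in lborel. h0 x = ennreal (enn2real (h0 x))"
    by eventually_elim (simp add: less_top)
  define h where "h x = enn2real (h0 x)" for x
  have [measurable]: "h \<in> borel_measurable borel" unfolding h_def by measurable
  have hpos: "h x \<ge> 0" for x by (simp add: h_def)
  have d: "\<tau> = density lborel (\<lambda>x. ennreal (h x))"
    unfolding d0[symmetric] using h0h by (intro density_cong) (auto simp: h_def)
  have ih: "(\<integral>\<^sup>+z. ennreal (h z) \<partial>lborel) = emeasure \<tau> UNIV"
    using i0 nn_integral_cong_AE[OF h0h] by (simp add: h_def)
  have hi: "integrable lborel h"
    using ih emeasure_finite[of UNIV] hpos by (intro integrableI_nonneg) (auto simp: less_top[symmetric])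
  have "AE z in lborel. \<forall>\<phi> B. \<phi> \<in> borel_measurable borel \<longrightarrow> (\<forall>x. \<bar>\<phi> x\<bar> \<le> B) \<longrightarrow> (\<forall>x. norm x > 1 \<longrightarrow> \<phi> x = 0) \<longrightarrow>
       integral\<^sup>L lborel \<phi> = 1 \<longrightarrow> ((\<lambda>\<epsilon>. \<integral>w. (1 / \<epsilon>) ^ n * \<phi> ((1 / \<epsilon>) *\<^sub>R (w - z)) \<partial>\<tau>) \<longlongrightarrow> h z) (at_right 0)"
    using Lebesgue_points_AE[OF hi]
  proof eventually_elim
    case (elim z)
    show ?case
    proof (intro allI impI)
      fix \<phi> :: "'a \<Rightarrow> real" and B
      assume \<phi>m[measurable]: "\<phi> \<in> borel_measurable borel" and \<phi>B: "\<forall>x. \<bar>\<phi> x\<bar> \<le> B"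
        and \<phi>0: "\<forall>x. norm x > 1 \<longrightarrow> \<phi> x = 0" and \<phi>1: "integral\<^sup>L lborel \<phi> = 1"
      have B: "B \<ge> 0" using \<phi>B[rule_format, of 0] by linarith
      have \<phi>i: "integrable lborel \<phi>" using \<phi>1 not_integrable_integral_eq by fastforce
      have key: "\<bar>(\<integral>w. (1 / \<epsilon>) ^ n * \<phi> ((1 / \<epsilon>) *\<^sub>R (w - z)) \<partial>\<tau>) - h z\<bar> \<le> B * e"
        if \<epsilon>: "\<epsilon> > 0" and le: "(\<integral>\<^sup>+w. ennreal \<bar>h w - h z\<bar> * indicator (cball z \<epsilon>) w \<partial>lborel) \<le> ennreal (e * \<epsilon> ^ n)" and e: "e > 0" for \<epsilon> e
      proof -
        define p where "p w = (1 / \<epsilon>) ^ n * \<phi> ((1 / \<epsilon>) *\<^sub>R (w - z))" for w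
        have [measurable]: "p \<in> borel_measurable borel" unfolding p_def by measurable
        have pB: "\<bar>p w\<bar> \<le> (1 / \<epsilon>) ^ n * B" for w
          unfolding p_def abs_mult using \<phi>B \<epsilon> by (intro mult_mono) auto
        have p0: "p w = 0" if "w \<notin> cball z \<epsilon>" for w
        proof -
          have "norm (w - z) > \<epsilon>" using that by (simp add: dist_norm norm_minus_commute)
          then have "norm ((1 / \<epsilon>) *\<^sub>R (w - z)) > 1" using \<epsilon> unfolding norm_scaleR by simp
          then show ?thesis using \<phi>0 by (simp add: p_def)
        qed
        have eqp: "p (z + \<epsilon> *\<^sub>R v) = (1 / \<epsilon>) ^ n * \<phi> v" for v using \<epsilon> by (simp add: p_def)
        have p1: "(\<integral>w. p w \<partial>lborel) = 1"
        proof -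
          have "(\<integral>w. p w \<partial>lborel) = (\<bar>\<epsilon>\<bar> ^ n) *\<^sub>R (\<integral>v. p (z + \<epsilon> *\<^sub>R v) \<partial>lborel)"
            unfolding n_def using \<epsilon> by (intro integral_lborel_affine) auto
          also have "\<dots> = 1" unfolding eqp using \<epsilon> \<phi>1 by (simp add: power_one_over)
          finally show ?thesis .
        qed
        then have pi: "integrable lborel p" using not_integrable_integral_eq by fastforce
        have ph: "integrable lborel (\<lambda>w. p w * h w)"
        proof (rule Bochner_Integration.integrable_bound[where f="\<lambda>w. (1 / \<epsilon>) ^ n * B * h w"])
          show "AE w in lborel. norm (p w * h w) \<le> norm ((1 / \<epsilon>) ^ n * B * h w)"
            using pB hpos B \<epsilon> by (auto simp: abs_mult intro!: mult_right_mono)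
        qed (use hi in auto)
        have i: "integrable lborel (\<lambda>w. p w * (h w - h z))"
          using ph pi by (simp add: right_diff_distrib)
        have "(\<integral>w. p w \<partial>\<tau>) - h z = (\<integral>w. p w * h w \<partial>lborel) - (\<integral>w. p w \<partial>lborel) * h z"
          unfolding d p1 using hpos by (subst integral_density) (auto simp: mult.commute)
        also have "\<dots> = (\<integral>w. p w * (h w - h z) \<partial>lborel)"
          using ph pi by (simp add: right_diff_distrib)
        finally have eq: "(\<integral>w. p w \<partial>\<tau>) - h z = (\<integral>w. p w * (h w - h z) \<partial>lborel)" .
        have "ennreal \<bar>(\<integral>w. p w \<partial>\<tau>) - h z\<bar> \<le> (\<integral>\<^sup>+w. ennreal \<bar>p w * (h w - h z)\<bar> \<partial>lborel)"
          unfolding eq using integral_norm_bound_ennreal[OF i] by simp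
        also have "\<dots> \<le> (\<integral>\<^sup>+w. ennreal ((1 / \<epsilon>) ^ n * B) * (ennreal \<bar>h w - h z\<bar> * indicator (cball z \<epsilon>) w) \<partial>lborel)"
        proof (intro nn_integral_mono)
          fix w
          show "ennreal \<bar>p w * (h w - h z)\<bar> \<le> ennreal ((1 / \<epsilon>) ^ n * B) * (ennreal \<bar>h w - h z\<bar> * indicator (cball z \<epsilon>) w)"
          proof (cases "w \<in> cball z \<epsilon>")
            case True
            have "\<bar>p w * (h w - h z)\<bar> \<le> ((1 / \<epsilon>) ^ n * B) * \<bar>h w - h z\<bar>"
              unfolding abs_mult by (intro mult_right_mono pB) auto
            then show ?thesis using True B \<epsilon> by (simp add: ennreal_leI flip: ennreal_mult)
          qed (simp add: p0)
        qed
        also have "\<dots> = ennreal ((1 / \<epsilon>) ^ n * B) * (\<integral>\<^sup>+w. ennreal \<bar>h w - h z\<bar> * indicator (cball z \<epsilon>) w \<partial>lborel)"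
          by (subst nn_integral_cmult) auto
        also have "\<dots> \<le> ennreal ((1 / \<epsilon>) ^ n * B) * ennreal (e * \<epsilon> ^ n)"
          by (intro mult_left_mono le) auto
        also have "\<dots> = ennreal (B * e)"
          using B e \<epsilon> by (simp add: power_one_over flip: ennreal_mult)
        finally show ?thesis using B e unfolding p_def by (subst (asm) ennreal_le_iff) auto
      qed
      show "((\<lambda>\<epsilon>. \<integral>w. (1 / \<epsilon>) ^ n * \<phi> ((1 / \<epsilon>) *\<^sub>R (w - z)) \<partial>\<tau>) \<longlongrightarrow> h z) (at_right 0)"
      proof (rule tendstoI)
        fix e :: real assume e: "e > 0"
        \<comment> \<open>The summand 1 keeps the denominator positive, and
          \<open>B * e' < e\<close> holds, also if \<open>B = 0\<close>.\<close>
        define e' where "e' = e / (2 * (B + 1))"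
        have e': "e' > 0" using e B by (simp add: e'_def)
        have "e = e' * (2 * (B + 1))" using B by (simp add: e'_def)
        then have "e - B * e' = e' * (B + 2)" by (simp add: algebra_simps)
        moreover have "e' * (B + 2) > 0" using e' B by (intro mult_pos_pos) auto
        ultimately have Be: "B * e' < e" by linarith
        obtain d where d: "d > 0" "\<And>r. 0 < r \<Longrightarrow> r < d \<Longrightarrow>
            (\<integral>\<^sup>+w. ennreal \<bar>h w - h z\<bar> * indicator (cball z r) w \<partial>lborel) \<le> ennreal (e' * r ^ n)"
          using elim e' unfolding n_def by blast
        have "\<forall>\<^sub>F \<epsilon> in at_right (0::real). 0 < \<epsilon> \<and> \<epsilon> < d"
          using d(1) eventually_at_right_real[of 0 d] by (auto elim: eventually_mono)
        then show "\<forall>\<^sub>F \<epsilon> in at_right 0. dist (\<integral>w. (1 / \<epsilon>) ^ n * \<phi> ((1 / \<epsilon>) *\<^sub>R (w - z)) \<partial>\<tau>) (h z) < e"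
        proof eventually_elim
          case (elim \<epsilon>)
          then show ?case using key[OF _ d(2) e', of \<epsilon>] Be by (simp add: dist_real_def)
        qed
      qed
    qed
  qed
  then show thesis using that[of h] hpos ih unfolding n_def by auto
qed

section \<open>Orthogonal matrices\<close>

text \<open>As a simp rule it would rewrite \<open>transpose g *v x\<close> to
  \<open>x v* g\<close>, a form to which the rules below do not apply.\<close>

declare transpose_matrix_vector [simp del]

lemma continuous_on_matrix_vector_mult [continuous_intros]:
  fixes f :: "'a::topological_space \<Rightarrow> real^'n^'m" and h :: "'a \<Rightarrow> real^'n"
  assumes "continuous_on S f" "continuous_on S h"
  shows "continuous_on S (\<lambda>x. f x *v h x)"
  unfolding matrix_vector_mult_def using assms by (intro continuous_intros)

lemma continuous_on_transpose [continuous_intros]: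
  fixes f :: "'a::topological_space \<Rightarrow> real^'n^'m"
  assumes "continuous_on S f"
  shows "continuous_on S (\<lambda>x. transpose (f x))"
  unfolding transpose_def using assms by (intro continuous_intros)

lemma measurable_matrix_vector_mult [measurable (raw)]:
  fixes f :: "'a \<Rightarrow> real^'n^'m" and h :: "'a \<Rightarrow> real^'n"
  assumes "f \<in> borel_measurable M" "h \<in> borel_measurable M"
  shows "(\<lambda>x. f x *v h x) \<in> borel_measurable M"
  by (rule borel_measurable_continuous_Pair[OF assms]) (intro continuous_intros)

lemma measurable_transpose [measurable (raw)]:
  fixes f :: "'a \<Rightarrow> real^'n^'m"
  assumes "f \<in> borel_measurable M"
  shows "(\<lambda>x. transpose (f x)) \<in> borel_measurable M"
  by (rule measurable_compose[OF assms]) (intro borel_measurable_continuous_onI continuous_intros)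

text \<open>Testing on the standard basis expresses orthogonality through \<open>*v\<close> and
  \<open>transpose\<close> alone, whose measurability has just been shown.\<close>

lemma orthogonal_matrix_iff_mult_vec:
  fixes g :: "real^'n^'n"
  shows "orthogonal_matrix g \<longleftrightarrow> (\<forall>i. transpose g *v (g *v axis i 1) = axis i 1)"
proof -
  have "orthogonal_matrix g \<longleftrightarrow> transpose g ** g = mat 1" by (rule orthogonal_matrix)
  also have "\<dots> \<longleftrightarrow> (\<forall>i. (transpose g ** g) *v axis i 1 = mat 1 *v axis i 1)"
    by (metis (no_types, lifting) matrix_vector_mult_basis column_def vec_eq_iff vec_lambda_beta)
  finally show ?thesis by (simp add: matrix_vector_mul_assoc)
qed

lemma orthogonal_matrices_measurable [measurable]:
  "Measurable.pred borel (orthogonal_matrix :: real^'n^'n \<Rightarrow> bool)"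
  unfolding orthogonal_matrix_iff_mult_vec[abs_def] by measurable

lemma orthogonal_matrices_borel [measurable]: "{g :: real^'n^'n. orthogonal_matrix g} \<in> sets borel"
  by measurable

lemma orthogonal_matrix_mult_vec:
  fixes g :: "real^'n^'n"
  assumes "orthogonal_matrix g"
  shows "transpose g *v (g *v x) = x" "g *v (transpose g *v x) = x" "norm (g *v x) = norm x" "norm (transpose g *v x) = norm x"
    "matrix_inv g = transpose g"
proof -
  have 1: "transpose g ** g = mat 1" "g ** transpose g = mat 1" using assms by (auto simp: orthogonal_matrix_def)
  show "transpose g *v (g *v x) = x" "g *v (transpose g *v x) = x"
    using 1 by (simp_all add: matrix_vector_mul_assoc)
  show "norm (g *v x) = norm x" "norm (transpose g *v x) = norm x"
    using assms by (simp_all add: orthogonal_transformation_norm orthogonal_transformation_matrix orthogonal_matrix_transpose)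
  have "matrix_inv g ** g = mat 1" "g ** matrix_inv g = mat 1"
    unfolding matrix_inv_def using 1 someI[of "\<lambda>A'. g ** A' = mat 1 \<and> A' ** g = mat 1" "transpose g"] by auto
  then have "matrix_inv g = matrix_inv g ** (g ** transpose g)" using 1 by simp
  also have "\<dots> = transpose g"
    using \<open>matrix_inv g ** g = mat 1\<close> by (simp add: matrix_mul_assoc)
  finally show "matrix_inv g = transpose g" .
qed

lemma inner_matrix_vec_transpose:
  fixes g :: "real^'n^'m"
  shows "x \<bullet> (g *v y) = (transpose g *v x) \<bullet> y"
  by (metis dot_lmul_matrix transpose_matrix_vector)

text \<open>Up to a null set an open set is a disjoint union of closed balls (Vitali), and orthogonal
  maps preserve balls.\<close>

lemma emeasure_lborel_le_orthogonal_vimage: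
  fixes g :: "real^'n^'n"
  assumes g: "orthogonal_matrix g" and U: "open U"
  shows "emeasure lborel U \<le> emeasure lborel ((\<lambda>x. g *v x) -` U)"
proof -
  define K where "K = {(a, r). 0 < r \<and> cball a r \<subseteq> U}"
  have g_meas: "(\<lambda>x. g *v x) \<in> borel \<rightarrow>\<^sub>M borel" by measurable
  have vU: "(\<lambda>x. g *v x) -` U \<in> sets borel"
    using measurable_sets[OF g_meas, of U] U by simp
  have pos: "\<And>i. i \<in> K \<Longrightarrow> 0 < snd i" by (auto simp: K_def)
  have fine: "\<exists>i. i \<in> K \<and> x \<in> cball (fst i) (snd i) \<and> snd i < d" if x: "x \<in> U" and d: "0 < d" for x d
  proof -
    obtain e where e: "e > 0" "cball x e \<subseteq> U" using U x open_contains_cball by blast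
    have "cball x (min e (d / 2)) \<subseteq> U" using e(2) subset_cball[of "min e (d/2)" e x] by auto
    then have "(x, min e (d / 2)) \<in> K" using e d by (simp add: K_def)
    then show ?thesis using e d by (intro exI[of _ "(x, min e (d / 2))"]) auto
  qed
  obtain C where C: "countable C" "C \<subseteq> K"
     "pairwise (\<lambda>i j. disjnt (cball (fst i) (snd i)) (cball (fst j) (snd j))) C"
     "negligible (U - (\<Union>i\<in>C. cball (fst i) (snd i)))"
    by (rule Vitali_covering_theorem_cballs[OF pos fine])
  define W where "W = (\<Union>i\<in>C. cball (fst i) (snd i))"
  have Wb: "W \<in> sets borel" unfolding W_def using C(1) by (intro sets.countable_UN') auto
  have WU: "W \<subseteq> U"
  proof -
    have "cball (fst i) (snd i) \<subseteq> U" if "i \<in> C" for i using C(2) that unfolding K_def by fastforce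
    then show ?thesis unfolding W_def by blast
  qed
  have Ub: "U \<in> sets borel" using U by simp
  have "U - W \<in> null_sets lebesgue" using C(4) unfolding W_def negligible_iff_null_sets .
  then have "emeasure lborel (U - W) = 0" using Ub Wb by (auto simp: null_sets_def)
  then have "emeasure lborel U = emeasure lborel W"
    using emeasure_Un_null_set[of W lborel "U - W"] Ub Wb WU by (auto simp: null_sets_def Un_absorb1)
  also have "\<dots> = (\<integral>\<^sup>+i. emeasure lborel (cball (fst i) (snd i)) \<partial>count_space C)"
    unfolding W_def using C(1,3)
    by (intro emeasure_UN_countable) (auto simp: disjoint_family_on_def pairwise_def disjnt_def)
  also have "\<dots> = (\<integral>\<^sup>+i. emeasure lborel ((\<lambda>x. g *v x) -` cball (fst i) (snd i)) \<partial>count_space C)"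
  proof (intro nn_integral_cong)
    fix i assume "i \<in> space (count_space C)"
    then have "i \<in> K" using C(2) by auto
    then have r: "snd i > 0" by (rule pos)
    have "(\<lambda>x. g *v x) -` cball a r = cball (transpose g *v a) r" for a r
    proof (intro set_eqI)
      fix x
      have "norm (a - g *v x) = norm (transpose g *v (a - g *v x))"
        by (simp add: orthogonal_matrix_mult_vec[OF g])
      also have "\<dots> = norm (transpose g *v a - x)"
        by (simp add: matrix_vector_mult_diff_distrib orthogonal_matrix_mult_vec[OF g])
      finally show "x \<in> (\<lambda>x. g *v x) -` cball a r \<longleftrightarrow> x \<in> cball (transpose g *v a) r"
        by (simp add: dist_norm)
    qed
    then show "emeasure lborel (cball (fst i) (snd i)) = emeasure lborel ((\<lambda>x. g *v x) -` cball (fst i) (snd i))"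
      using r by (simp add: emeasure_cball)
  qed
  also have "\<dots> = emeasure lborel (\<Union>i\<in>C. (\<lambda>x. g *v x) -` cball (fst i) (snd i))"
  proof (intro emeasure_UN_countable[symmetric])
    show "(\<lambda>x. g *v x) -` cball (fst i) (snd i) \<in> sets lborel" for i
      using measurable_sets[OF g_meas, of "cball (fst i) (snd i)"] by simp
    show "disjoint_family_on (\<lambda>i. (\<lambda>x. g *v x) -` cball (fst i) (snd i)) C"
      using C(3) unfolding disjoint_family_on_def pairwise_def disjnt_def by blast
  qed (use C in auto)
  also have "\<dots> \<le> emeasure lborel ((\<lambda>x. g *v x) -` U)"
    using WU vU unfolding W_def by (intro emeasure_mono) auto
  finally show ?thesis .
qed

text \<open>The inequality for \<open>g\<close> and the one for its transpose combine to equality on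
  boxes, and the values on boxes determine Lebesgue measure.\<close>

lemma distr_lborel_orthogonal:
  fixes g :: "real^'n^'n"
  assumes g: "orthogonal_matrix g"
  shows "distr lborel borel (\<lambda>x. g *v x) = lborel"
proof (rule lborel_eqI[symmetric])
  fix l u :: "real^'n" assume le: "\<And>b. b \<in> Basis \<Longrightarrow> l \<bullet> b \<le> u \<bullet> b"
  let ?V = "(\<lambda>x. g *v x) -` box l u"
  have gt: "orthogonal_matrix (transpose g)" using g by (simp add: orthogonal_matrix_transpose)
  have "continuous_on UNIV (\<lambda>x. g *v x)" by (intro continuous_intros)
  then have oV: "open ?V" by (rule open_vimage[OF open_box])
  have "emeasure lborel ?V \<le> emeasure lborel ((\<lambda>x. transpose g *v x) -` ?V)"
    by (rule emeasure_lborel_le_orthogonal_vimage[OF gt oV])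
  also have "(\<lambda>x. transpose g *v x) -` ?V = box l u"
    by (auto simp: orthogonal_matrix_mult_vec[OF g])
  finally have "emeasure lborel ?V = emeasure lborel (box l u)"
    using emeasure_lborel_le_orthogonal_vimage[OF g open_box] by (intro antisym)
  moreover have "emeasure (distr lborel borel (\<lambda>x. g *v x)) (box l u) = emeasure lborel ?V"
    by (subst emeasure_distr) auto
  ultimately show "emeasure (distr lborel borel (\<lambda>x. g *v x)) (box l u) = (\<Prod>b\<in>Basis. (u - l) \<bullet> b)"
    using le by simp
qed simp

lemma nn_integral_lborel_orthogonal:
  fixes g :: "real^'n^'n"
  assumes g: "orthogonal_matrix g" and [measurable]: "f \<in> borel_measurable borel"
  shows "(\<integral>\<^sup>+x. f (g *v x) \<partial>lborel) = (\<integral>\<^sup>+x. f x \<partial>lborel)"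
  by (subst (2) distr_lborel_orthogonal[OF g, symmetric]) (simp add: nn_integral_distr)

section \<open>Averages of Riesz kernels over the orthogonal group\<close>

lemma suminf_ennreal_const_le_top:
  fixes f :: "nat \<Rightarrow> ennreal"
  assumes "c > 0" "\<And>k. f k \<ge> ennreal c"
  shows "(\<Sum>k. f k) = \<infinity>"
proof (rule ccontr)
  assume "(\<Sum>k. f k) \<noteq> \<infinity>"
  then obtain T where T: "(\<Sum>k. f k) = ennreal T" "T \<ge> 0" by (cases "\<Sum>k. f k") auto
  obtain m :: nat where m: "T < real m * c" using reals_Archimedean3[OF assms(1)] by blast
  have "ennreal (real m * c) = (\<Sum>k<m. ennreal c)"
    using assms(1) by (simp add: ennreal_mult ennreal_of_nat_eq_real_of_nat)
  also have "\<dots> \<le> (\<Sum>k<m. f k)" by (intro sum_mono assms)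
  also have "\<dots> \<le> (\<Sum>k. f k)" by (intro sum_le_suminf) auto
  finally show False using T m by (simp add: ennreal_le_iff)
qed

text \<open>Outside the ball of radius \<open>\<rho>\<close> the first summand dominates. Inside it
  a nonzero \<open>v\<close> lies in some shell between \<open>\<rho> / 2 ^ Suc k\<close> and
  \<open>\<rho> / 2 ^ k\<close>, where the term of index \<open>k\<close> suffices. At the origin
  every term is at least \<open>\<rho> powr (-\<gamma>)\<close>, so the series diverges as it
  must.\<close>

lemma rk_le_dyadic:
  assumes "\<rho> > 0" "\<gamma> > 0"
  shows "rk \<gamma> v \<le> ennreal (\<rho> powr (-\<gamma>)) + (\<Sum>k. ennreal ((\<rho> / 2 ^ Suc k) powr (-\<gamma>)) * indicator {v. norm v < \<rho> / 2 ^ k} v)"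
proof (cases "v = 0")
  case True
  have "(\<Sum>k. ennreal ((\<rho> / 2 ^ Suc k) powr (-\<gamma>)) * indicator {v. norm v < \<rho> / 2 ^ k} v) = \<infinity>"
  proof (rule suminf_ennreal_const_le_top[of "\<rho> powr (-\<gamma>)"])
    fix k
    have "(1::real) \<le> 2 ^ Suc k" by (rule one_le_power) simp
    then have "\<rho> powr (-\<gamma>) \<le> (\<rho> / 2 ^ Suc k) powr (-\<gamma>)"
      using assms by (intro powr_mono2') (auto simp: divide_le_eq mult_le_cancel_left1)
    then show "ennreal (\<rho> powr (-\<gamma>)) \<le> ennreal ((\<rho> / 2 ^ Suc k) powr (-\<gamma>)) * indicator {v. norm v < \<rho> / 2 ^ k} v"
      using True assms by (simp add: ennreal_leI)
  qed (use assms in simp)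
  then show ?thesis by simp
next
  case False
  show ?thesis
  proof (cases "norm v \<ge> \<rho>")
    case True
    then have "rk \<gamma> v \<le> ennreal (\<rho> powr (-\<gamma>))"
      using assms False by (auto simp: rk_def intro!: ennreal_leI powr_mono2')
    then show ?thesis by (rule order_trans) simp
  next
    case small: False
    have "\<exists>k. \<rho> / 2 ^ Suc k \<le> norm v"
    proof -
      obtain m where "\<rho> / norm v < 2 ^ m" using real_arch_pow[of 2 "\<rho> / norm v"] by auto
      also have "(2::real) ^ m \<le> 2 ^ Suc m" by simp
      finally show ?thesis using False by (intro exI[of _ m]) (simp add: field_simps)
    qed
    define k where "k = (LEAST k. \<rho> / 2 ^ Suc k \<le> norm v)"
    have k1: "\<rho> / 2 ^ Suc k \<le> norm v" unfolding k_def using \<open>\<exists>k. _\<close> by (rule LeastI_ex)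
    have k2: "norm v < \<rho> / 2 ^ k"
    proof (cases k)
      case 0 then show ?thesis using small by simp
    next
      case (Suc j)
      then have "\<not> \<rho> / 2 ^ Suc j \<le> norm v" unfolding k_def using not_less_Least by (metis lessI)
      then show ?thesis using Suc by simp
    qed
    let ?f = "\<lambda>k. ennreal ((\<rho> / 2 ^ Suc k) powr (-\<gamma>)) * indicator {v. norm v < \<rho> / 2 ^ k} v"
    have "rk \<gamma> v \<le> ?f k"
      using k1 k2 assms False by (auto simp: rk_def intro!: ennreal_leI powr_mono2')
    also have "?f k \<le> (\<Sum>k. ?f k)"
    proof -
      have "F k \<le> (\<Sum>k. F k)" for F :: "nat \<Rightarrow> ennreal" using sum_le_suminf[of F "{k}"] by auto
      then show ?thesis .
    qed
    finally show ?thesis by (rule order_trans) simp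
  qed
qed

text \<open>Integrating the dyadic decomposition against \<open>\<theta>\<close> costs a geometric series, which converges
  since \<open>\<gamma> < \<beta>\<close>. The bound is symmetric in \<open>\<xi>\<close> and \<open>\<zeta>\<close> because \<open>\<xi> + g \<zeta>\<close> is comparable to \<open>\<xi>\<close> when \<open>\<xi>\<close> dominates.\<close>

lemma average_rk:
  fixes \<theta> :: "(real^'n^'n) measure" and p q \<beta> :: real
  assumes pq: "p > 0" "q > 0" "p + q < \<beta>"
  obtains C where "C > 0"
    "\<And>(\<theta> :: (real^'n^'n) measure) \<xi> \<zeta>. sets \<theta> = sets borel \<Longrightarrow> emeasure \<theta> (- {g. orthogonal_matrix g}) = 0 \<Longrightarrow>
      emeasure \<theta> {g. orthogonal_matrix g} \<le> 1 \<Longrightarrow>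
      (\<And>x z r. x \<noteq> 0 \<Longrightarrow> z \<noteq> 0 \<Longrightarrow> r > 0 \<Longrightarrow>
        emeasure \<theta> {g. orthogonal_matrix g \<and> norm (x - g *v z) < r} \<le> ennreal ((r / norm z) powr \<beta>)) \<Longrightarrow>
      (\<integral>\<^sup>+g. rk (p + q) (\<xi> + g *v \<zeta>) \<partial>\<theta>) \<le> ennreal C * (rk p \<xi> * rk q \<zeta>)"
proof -
  define \<gamma> where "\<gamma> = p + q"
  have \<gamma>: "\<gamma> > 0" "\<gamma> < \<beta>" using pq by (auto simp: \<gamma>_def)
  \<comment> \<open>The ratio of the dyadic series: at scale \<open>2 ^ k\<close> the kernel grows
    like \<open>2 powr (k * \<gamma>)\<close>, while the \<theta>-measure of the matrices involved
    is at most \<open>2 powr (- k * \<beta>)\<close>.\<close>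
  define a where "a = 2 powr (\<gamma> - \<beta>)"
  have a: "0 < a" "a < 1" using \<gamma> by (auto simp: a_def powr_less_one)
  \<comment> \<open>The 1 accounts for the part away from the singularity;
    \<open>2 powr \<gamma>\<close> arises because the kernel is estimated at the inner radius of a
    shell and the measure at the outer one. The further \<open>2 powr \<gamma>\<close> in
    \<open>C\<close> pays for comparing \<open>m\<close> with \<open>m / 2\<close> or
    \<open>\<rho>\<close>.\<close>
  define C0 where "C0 = 1 + 2 powr \<gamma> / (1 - a)"
  have C0: "C0 \<ge> 1" using a by (simp add: C0_def)
  define C where "C = 2 powr \<gamma> * C0"
  have C: "C > 0" using C0 by (simp add: C_def)
  have "(\<integral>\<^sup>+g. rk (p + q) (\<xi> + g *v \<zeta>) \<partial>\<theta>) \<le> ennreal C * (rk p \<xi> * rk q \<zeta>)"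
    if s[measurable_cong]: "sets \<theta> = sets borel" and O0: "emeasure \<theta> (- {g. orthogonal_matrix g}) = 0"
      and O1: "emeasure \<theta> {g. orthogonal_matrix g} \<le> 1"
      and hyp: "\<And>x z r. x \<noteq> 0 \<Longrightarrow> z \<noteq> 0 \<Longrightarrow> r > 0 \<Longrightarrow>
        emeasure \<theta> {g. orthogonal_matrix g \<and> norm (x - g *v z) < r} \<le> ennreal ((r / norm z) powr \<beta>)"
    for \<theta> :: "(real^'n^'n) measure" and \<xi> \<zeta>
  proof (cases "\<xi> = 0 \<or> \<zeta> = 0")
    case True
    have "rk p \<xi> * rk q \<zeta> = \<infinity>"
      using True by (auto simp: rk_def ennreal_mult_top ennreal_top_mult)
    then show ?thesis using C by (simp add: ennreal_mult_top)
  next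
    case False
    then have nz: "\<xi> \<noteq> 0" "\<zeta> \<noteq> 0" by auto
    have sp: "space \<theta> = UNIV" using sets_eq_imp_space_eq[OF s] by simp
    have AEO: "AE g in \<theta>. orthogonal_matrix g"
      using O0 s by (intro AE_I[where N="- {g. orthogonal_matrix g}"]) auto
    have tot: "emeasure \<theta> UNIV \<le> 1"
    proof -
      have "emeasure \<theta> UNIV = emeasure \<theta> {g. orthogonal_matrix g}"
        using AEO s by (intro emeasure_eq_AE) auto
      then show ?thesis using O1 by simp
    qed
    define m where "m = max (norm \<xi>) (norm \<zeta>)"
    have m: "m > 0" "norm \<xi> \<le> m" "norm \<zeta> \<le> m" using nz by (auto simp: m_def less_max_iff_disj)
    have main: "(\<integral>\<^sup>+g. rk \<gamma> (\<xi> + g *v \<zeta>) \<partial>\<theta>) \<le> ennreal (C * m powr (-\<gamma>))"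
    proof (cases "norm \<xi> \<ge> 2 * norm \<zeta>")
      \<comment> \<open>Here \<open>norm (\<xi> + g *v \<zeta>) \<ge> m / 2\<close> for every
        orthogonal \<open>g\<close>, so the kernel is bounded before averaging.\<close>
      case True
      then have "norm \<zeta> \<le> norm \<xi>" using norm_ge_zero[of \<zeta>] by linarith
      then have mx: "m = norm \<xi>" by (simp add: m_def)
      have "(\<integral>\<^sup>+g. rk \<gamma> (\<xi> + g *v \<zeta>) \<partial>\<theta>) \<le> (\<integral>\<^sup>+g. ennreal ((m / 2) powr (-\<gamma>)) \<partial>\<theta>)"
      proof (rule nn_integral_mono_AE)
        show "AE g in \<theta>. rk \<gamma> (\<xi> + g *v \<zeta>) \<le> ennreal ((m / 2) powr (-\<gamma>))"
          using AEO
        proof eventually_elim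
          case (elim g)
          have "m / 2 \<le> norm (\<xi> + g *v \<zeta>)"
            using norm_diff_ineq[of \<xi> "g *v \<zeta>"] orthogonal_matrix_mult_vec(3)[OF elim, of \<zeta>] True mx by simp
          then show ?case using m \<gamma> by (auto simp: rk_def intro!: ennreal_leI powr_mono2')
        qed
      qed
      also have "\<dots> \<le> ennreal ((m / 2) powr (-\<gamma>)) * 1"
        using tot sp by (simp add: mult_left_le)
      also have "(m / 2) powr (-\<gamma>) = 2 powr \<gamma> * m powr (-\<gamma>)"
        using m by (simp add: powr_divide powr_minus field_simps)
      also have "ennreal (2 powr \<gamma> * m powr (-\<gamma>)) * 1 \<le> ennreal (C * m powr (-\<gamma>))"
      proof -
        have "1 * (2 powr \<gamma> * m powr (-\<gamma>)) \<le> C0 * (2 powr \<gamma> * m powr (-\<gamma>))"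
          by (intro mult_right_mono C0) simp
        then show ?thesis by (simp add: C_def mult_ac ennreal_leI)
      qed
      finally show ?thesis .
    next
      case False
      \<comment> \<open>The hypothesis on \<theta> is relative to the norm of the rotated vector, so
        radii \<open>\<rho> / 2 ^ k\<close> give the bound \<open>(1 / 2 ^ k) powr \<beta>\<close>.
        It is applied to \<open>-\<zeta>\<close>, since it concerns differences.\<close>
      define \<rho> where "\<rho> = norm \<zeta>"
      have \<rho>: "\<rho> > 0" "m \<le> 2 * \<rho>" using nz False by (auto simp: \<rho>_def m_def)
      let ?S = "\<lambda>k. {g. orthogonal_matrix g \<and> norm (\<xi> - g *v (-\<zeta>)) < \<rho> / 2 ^ k}"
      have Sm[measurable]: "?S k \<in> sets borel" for k by measurable
      have "(\<integral>\<^sup>+g. rk \<gamma> (\<xi> + g *v \<zeta>) \<partial>\<theta>) \<le>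
        (\<integral>\<^sup>+g. ennreal (\<rho> powr (-\<gamma>)) + (\<Sum>k. ennreal ((\<rho> / 2 ^ Suc k) powr (-\<gamma>)) * indicator (?S k) g) \<partial>\<theta>)"
      proof (rule nn_integral_mono_AE)
        show "AE g in \<theta>. rk \<gamma> (\<xi> + g *v \<zeta>) \<le> ennreal (\<rho> powr (-\<gamma>)) + (\<Sum>k. ennreal ((\<rho> / 2 ^ Suc k) powr (-\<gamma>)) * indicator (?S k) g)"
          using AEO
        proof eventually_elim
          case (elim g)
          have n: "\<xi> - g *v (-\<zeta>) = \<xi> + g *v \<zeta>" for g :: "real^'n^'n"
            by (simp add: matrix_vector_mult_def vec_eq_iff sum_negf)
          have "indicator (?S k) g = (indicator {v. norm v < \<rho> / 2 ^ k} (\<xi> + g *v \<zeta>) :: ennreal)" for k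
            unfolding n using elim by (simp add: indicator_def)
          then show ?case using rk_le_dyadic[OF \<rho>(1) \<gamma>(1), of "\<xi> + g *v \<zeta>"] by simp
        qed
      qed
      also have "\<dots> = ennreal (\<rho> powr (-\<gamma>)) * emeasure \<theta> UNIV + (\<Sum>k. ennreal ((\<rho> / 2 ^ Suc k) powr (-\<gamma>)) * emeasure \<theta> (?S k))"
        using sp s by (subst nn_integral_add) (auto simp: nn_integral_suminf nn_integral_cmult)
      also have "\<dots> \<le> ennreal (\<rho> powr (-\<gamma>)) * 1 + (\<Sum>k. ennreal (\<rho> powr (-\<gamma>) * 2 powr \<gamma> * a ^ k))"
      proof (intro add_mono mult_left_mono tot suminf_le summableI)
        fix k
        have "emeasure \<theta> (?S k) \<le> ennreal ((\<rho> / 2 ^ k / norm (-\<zeta>)) powr \<beta>)"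
          using nz \<rho> by (intro hyp) auto
        then have "ennreal ((\<rho> / 2 ^ Suc k) powr (-\<gamma>)) * emeasure \<theta> (?S k) \<le> ennreal ((\<rho> / 2 ^ Suc k) powr (-\<gamma>)) * ennreal ((1 / 2 ^ k) powr \<beta>)"
          using \<rho> nz by (intro mult_left_mono) (auto simp: \<rho>_def)
        also have "\<dots> = ennreal (\<rho> powr (-\<gamma>) * 2 powr \<gamma> * a ^ k)"
        proof -
          have 1: "(\<rho> / 2 ^ Suc k) powr (-\<gamma>) = \<rho> powr (-\<gamma>) * (2 powr real (Suc k)) powr \<gamma>"
          proof -
            have p: "2 powr real (Suc k) = (2::real) ^ Suc k" by (rule powr_realpow) simp
            show ?thesis unfolding p
              using \<rho> by (subst powr_divide) (auto simp: powr_minus divide_simps simp del: power_Suc)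
          qed
          have 2: "(1 / 2 ^ k) powr \<beta> = (2 powr real k) powr (-\<beta>)"
            by (simp add: powr_divide powr_minus divide_simps powr_realpow)
          have "(2 powr real (Suc k)) powr \<gamma> * (2 powr real k) powr (-\<beta>) = 2 powr \<gamma> * a ^ k"
            unfolding a_def by (simp add: powr_powr powr_add[symmetric] powr_power algebra_simps)
          then have "(\<rho> / 2 ^ Suc k) powr (-\<gamma>) * (1 / 2 ^ k) powr \<beta> = \<rho> powr (-\<gamma>) * 2 powr \<gamma> * a ^ k"
            unfolding 1 2 by (simp only: mult.assoc)
          then show ?thesis by (simp flip: ennreal_mult)
        qed
        finally show "ennreal ((\<rho> / 2 ^ Suc k) powr (-\<gamma>)) * emeasure \<theta> (?S k) \<le> ennreal (\<rho> powr (-\<gamma>) * 2 powr \<gamma> * a ^ k)" .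
      qed auto
      also have "\<dots> = ennreal (\<rho> powr (-\<gamma>) * C0)"
      proof -
        have "(\<lambda>k. \<rho> powr (-\<gamma>) * 2 powr \<gamma> * a ^ k) sums (\<rho> powr (-\<gamma>) * 2 powr \<gamma> * (1 / (1 - a)))"
          using a by (intro sums_mult geometric_sums) auto
        then have "(\<Sum>k. ennreal (\<rho> powr (-\<gamma>) * 2 powr \<gamma> * a ^ k)) = ennreal (\<rho> powr (-\<gamma>) * 2 powr \<gamma> * (1 / (1 - a)))"
          using a by (intro suminf_ennreal_eq) auto
        then show ?thesis using a by (simp add: C0_def distrib_left flip: ennreal_plus)
      qed
      also have "\<dots> \<le> ennreal (C * m powr (-\<gamma>))"
      proof (intro ennreal_leI)
        have "(2 * \<rho>) powr (-\<gamma>) \<le> m powr (-\<gamma>)" using m \<rho> \<gamma> by (intro powr_mono2') auto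
        then have "\<rho> powr (-\<gamma>) \<le> 2 powr \<gamma> * m powr (-\<gamma>)"
          using \<rho> by (simp add: powr_mult powr_minus field_simps)
        then have "\<rho> powr (-\<gamma>) * C0 \<le> (2 powr \<gamma> * m powr (-\<gamma>)) * C0"
          using C0 by (intro mult_right_mono) auto
        then show "\<rho> powr (-\<gamma>) * C0 \<le> C * m powr (-\<gamma>)" by (simp add: C_def mult_ac)
      qed
      finally show ?thesis .
    qed
    \<comment> \<open>Here the two frequencies decouple: the maximum \<open>m\<close> dominates both
      norms and the exponents are negative.\<close>
    have "m powr (-\<gamma>) = m powr (-p) * m powr (-q)"
      by (simp add: \<gamma>_def flip: powr_add)
    also have "\<dots> \<le> norm \<xi> powr (-p) * norm \<zeta> powr (-q)"
      using m nz pq by (intro mult_mono powr_mono2') auto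
    finally have "C * m powr (-\<gamma>) \<le> C * (norm \<xi> powr (-p) * norm \<zeta> powr (-q))"
      using C by (intro mult_left_mono) auto
    then have "ennreal (C * m powr (-\<gamma>)) \<le> ennreal C * (rk p \<xi> * rk q \<zeta>)"
      using C nz by (simp add: rk_def ennreal_leI flip: ennreal_mult)
    with main show ?thesis unfolding \<gamma>_def[symmetric] by (rule order_trans)
  qed
  then show thesis using that C by blast
qed

section \<open>Mollified slices and their energy\<close>

lemma integral_lborel_orthogonal:
  fixes g :: "real^'n^'n" and f :: "real^'n \<Rightarrow> 'b::{banach, second_countable_topology}"
  assumes g: "orthogonal_matrix g" and [measurable]: "f \<in> borel_measurable borel"
  shows "(\<integral>x. f (g *v x) \<partial>lborel) = (\<integral>x. f x \<partial>lborel)"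
  by (subst (2) distr_lborel_orthogonal[OF g, symmetric]) (simp add: integral_distr)

text \<open>Compactness of the support of \<open>\<mu>\<close> is kept as an almost everywhere bound
  by \<open>R\<close>, a form that passes directly to measures with a density with respect to
  \<open>\<mu>\<close>.\<close>

locale moll_pair = mu: finite_measure \<mu> + nu: finite_measure \<nu>
  for \<mu> \<nu> :: "(real^'n) measure" +
  fixes \<psi> :: "real^'n \<Rightarrow> real" and R B :: real
  assumes sets_mu[measurable_cong]: "sets \<mu> = sets borel" and sets_nu[measurable_cong]: "sets \<nu> = sets borel"
    and R0: "R \<ge> 0" and R: "AE x in \<mu>. norm x \<le> R"
    and \<psi>_cont: "continuous_on UNIV \<psi>" and \<psi>_nonneg: "\<And>x. \<psi> x \<ge> 0" and \<psi>_le: "\<And>x. \<psi> x \<le> B"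
    and \<psi>_supp: "\<And>x. norm x > 1 \<Longrightarrow> \<psi> x = 0" and \<psi>_int: "integral\<^sup>L lborel \<psi> = 1"
begin

lemma space_mu [simp]: "space \<mu> = UNIV" using sets_eq_imp_space_eq[OF sets_mu] by simp
lemma space_nu [simp]: "space \<nu> = UNIV" using sets_eq_imp_space_eq[OF sets_nu] by simp

lemma \<psi>_measurable [measurable]: "\<psi> \<in> borel_measurable borel"
  using \<psi>_cont by (rule borel_measurable_continuous_onI)

lemma B0: "B \<ge> 0" using \<psi>_nonneg[of 0] \<psi>_le[of 0] by linarith

lemma moll_measurable [measurable (raw)]:
  assumes "e \<in> borel_measurable M" "f \<in> borel_measurable M"
  shows "(\<lambda>x. moll_eps \<psi> (e x) (f x)) \<in> borel_measurable M"
  using assms unfolding moll_eps_def by measurable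

lemma moll_bounds:
  assumes "\<epsilon> > 0"
  shows "0 \<le> moll_eps \<psi> \<epsilon> v" "moll_eps \<psi> \<epsilon> v \<le> (1 / \<epsilon>) ^ CARD('n) * B"
  using assms \<psi>_nonneg \<psi>_le unfolding moll_eps_def by (auto intro!: mult_left_mono)

text \<open>The density of the mollified slice, with the transpose in place of the inverse. The two
  agree on orthogonal matrices, but this expression is visibly measurable in all arguments, for
  arbitrary matrices.\<close>

definition kern :: "real^'n^'n \<Rightarrow> real^'n \<Rightarrow> real \<Rightarrow> real^'n \<Rightarrow> real" where
  "kern g z \<epsilon> x = (\<integral>y. moll_eps \<psi> \<epsilon> (transpose g *v (x - z) - y) \<partial>\<nu>)"

definition slice :: "real^'n^'n \<Rightarrow> real^'n \<Rightarrow> real \<Rightarrow> (real^'n) measure" where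
  "slice g z \<epsilon> = density \<mu> (\<lambda>x. ennreal (kern g z \<epsilon> x))"

definition Phi :: "real^'n^'n \<Rightarrow> real \<Rightarrow> real^'n \<Rightarrow> real" where
  "Phi g \<epsilon> v = moll_eps \<psi> \<epsilon> (transpose g *v v)"

lemma Phi_measurable [measurable (raw)]:
  assumes "g \<in> borel_measurable M" "e \<in> borel_measurable M" "f \<in> borel_measurable M"
  shows "(\<lambda>x. Phi (g x) (e x) (f x)) \<in> borel_measurable M"
  using assms unfolding Phi_def by measurable

lemma kern_measurable [measurable (raw)]:
  assumes [measurable]: "g \<in> borel_measurable M" "z \<in> borel_measurable M" "e \<in> borel_measurable M" "f \<in> borel_measurable M"
  shows "(\<lambda>x. kern (g x) (z x) (e x) (f x)) \<in> borel_measurable M"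
  unfolding kern_def by measurable

lemma kern_integrable:
  assumes "\<epsilon> > 0"
  shows "integrable \<nu> (\<lambda>y. moll_eps \<psi> \<epsilon> (v - y))"
  using moll_bounds[OF assms] by (intro nu.integrable_const_bound[where B="(1 / \<epsilon>) ^ CARD('n) * B"]) auto

lemma kern_bounds:
  assumes "\<epsilon> > 0"
  shows "0 \<le> kern g z \<epsilon> x" "kern g z \<epsilon> x \<le> (1 / \<epsilon>) ^ CARD('n) * B * measure \<nu> UNIV"
proof -
  show "0 \<le> kern g z \<epsilon> x"
    unfolding kern_def using moll_bounds[OF assms] by (intro Bochner_Integration.integral_nonneg) auto
  have "kern g z \<epsilon> x \<le> (\<integral>y. (1 / \<epsilon>) ^ CARD('n) * B \<partial>\<nu>)"
    unfolding kern_def using moll_bounds[OF assms] kern_integrable[OF assms] by (intro integral_mono) auto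
  then show "kern g z \<epsilon> x \<le> (1 / \<epsilon>) ^ CARD('n) * B * measure \<nu> UNIV" by (simp add: mult_ac)
qed

lemma sets_slice [simp, measurable_cong]: "sets (slice g z \<epsilon>) = sets borel"
  by (simp add: slice_def sets_mu)

lemma space_slice [simp]: "space (slice g z \<epsilon>) = UNIV"
  by (simp add: slice_def)

lemma finite_slice:
  assumes "\<epsilon> > 0"
  shows "finite_measure (slice g z \<epsilon>)"
proof (rule finite_measureI)
  have "emeasure (slice g z \<epsilon>) (space (slice g z \<epsilon>)) = (\<integral>\<^sup>+x. ennreal (kern g z \<epsilon> x) \<partial>\<mu>)"
    by (simp add: slice_def emeasure_density)
  also have "\<dots> \<le> (\<integral>\<^sup>+x. ennreal ((1 / \<epsilon>) ^ CARD('n) * B * measure \<nu> UNIV) \<partial>\<mu>)"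
    using kern_bounds[OF assms] by (intro nn_integral_mono ennreal_leI) auto
  also have "\<dots> < \<infinity>" by (simp add: mu.emeasure_eq_measure ennreal_mult_less_top)
  finally show "emeasure (slice g z \<epsilon>) (space (slice g z \<epsilon>)) \<noteq> \<infinity>" by simp
qed

lemma integral_slice:
  fixes f :: "real^'n \<Rightarrow> 'b::{banach, second_countable_topology}"
  assumes "\<epsilon> > 0" "f \<in> borel_measurable borel"
  shows "(\<integral>x. f x \<partial>slice g z \<epsilon>) = (\<integral>x. kern g z \<epsilon> x *\<^sub>R f x \<partial>\<mu>)"
  unfolding slice_def using assms kern_bounds[OF assms(1)] by (intro integral_density) auto

lemma AE_slice:
  assumes "AE x in \<mu>. P x"
  shows "AE x in slice g z \<epsilon>. P x"
  unfolding slice_def using assms by (subst AE_density) (auto elim: eventually_mono)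

text \<open>This rewrites the mollification of \<open>\<nu>\<close> as a mollification, evaluated at
  \<open>z\<close>, of the image of the product measure under the map taking (x, y) to x - g y. The
  profile becomes the rotated one, \<open>Phi g \<epsilon>\<close>.\<close>

lemma kern_Phi:
  assumes "orthogonal_matrix g"
  shows "moll_eps \<psi> \<epsilon> (transpose g *v (x - z) - y) = Phi g \<epsilon> ((x - g *v y) - z)"
proof -
  have "transpose g *v ((x - g *v y) - z) = transpose g *v (x - z) - transpose g *v (g *v y)"
    by (simp add: matrix_vector_mult_diff_distrib)
  then show ?thesis by (simp add: Phi_def orthogonal_matrix_mult_vec[OF assms])
qed

lemma Phi_props:
  assumes g: "orthogonal_matrix g" and e: "\<epsilon> > 0"
  shows "0 \<le> Phi g \<epsilon> v" "continuous_on UNIV (Phi g \<epsilon>)" "Phi g \<epsilon> v \<le> (1 / \<epsilon>) ^ CARD('n) * B"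
    "integrable lborel (Phi g \<epsilon>)" "(\<integral>v. Phi g \<epsilon> v \<partial>lborel) = 1" "norm v > \<epsilon> \<Longrightarrow> Phi g \<epsilon> v = 0"
proof -
  show "0 \<le> Phi g \<epsilon> v" "Phi g \<epsilon> v \<le> (1 / \<epsilon>) ^ CARD('n) * B"
    using moll_bounds[OF e] by (auto simp: Phi_def)
  show "continuous_on UNIV (Phi g \<epsilon>)"
    unfolding Phi_def[abs_def] moll_eps_def
    by (intro continuous_intros continuous_on_compose2[OF \<psi>_cont]) auto
  have gt: "orthogonal_matrix (transpose g)" using g by (simp add: orthogonal_matrix_transpose)
  have "(\<integral>v. Phi g \<epsilon> v \<partial>lborel) = (\<integral>v. moll_eps \<psi> \<epsilon> v \<partial>lborel)"
    unfolding Phi_def by (rule integral_lborel_orthogonal[OF gt]) measurable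
  also have "\<dots> = (\<bar>\<epsilon>\<bar> ^ DIM(real^'n)) *\<^sub>R (\<integral>v. moll_eps \<psi> \<epsilon> (0 + \<epsilon> *\<^sub>R v) \<partial>lborel)"
    using e by (intro integral_lborel_affine) auto
  also have "\<dots> = 1" using e \<psi>_int by (simp add: moll_eps_def power_one_over)
  finally show 1: "(\<integral>v. Phi g \<epsilon> v \<partial>lborel) = 1" .
  show "integrable lborel (Phi g \<epsilon>)" using 1 not_integrable_integral_eq by fastforce
  show "Phi g \<epsilon> v = 0" if "norm v > \<epsilon>"
    unfolding Phi_def moll_eps_def
    using that e \<psi>_supp[of "(1 / \<epsilon>) *\<^sub>R (transpose g *v v)"] by (simp add: orthogonal_matrix_mult_vec[OF g])
qed

sublocale munu: pair_sigma_finite \<mu> \<nu> ..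

sublocale munu: finite_measure "\<mu> \<Otimes>\<^sub>M \<nu>"
  by (rule finite_measure_pair_measure) unfold_locales

text \<open>With the frequency fixed and \<open>z\<close> variable, the right-hand side is the
  mollified weighted image measure treated in \<open>mollified_l2_le\<close>, with a weight of
  modulus 1.\<close>

lemma four_slice:
  assumes g: "orthogonal_matrix g" and e: "\<epsilon> > 0"
  shows "four (slice g z \<epsilon>) \<xi> = (\<integral>p. cis (\<xi> \<bullet> fst p) * complex_of_real (Phi g \<epsilon> ((fst p - g *v snd p) - z)) \<partial>(\<mu> \<Otimes>\<^sub>M \<nu>))"
proof -
  have "four (slice g z \<epsilon>) \<xi> = (\<integral>x. kern g z \<epsilon> x *\<^sub>R cis (\<xi> \<bullet> x) \<partial>\<mu>)"
    unfolding four_def using e by (intro integral_slice) auto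
  also have "\<dots> = (\<integral>x. \<integral>y. cis (\<xi> \<bullet> x) * complex_of_real (Phi g \<epsilon> ((x - g *v y) - z)) \<partial>\<nu> \<partial>\<mu>)"
    unfolding kern_def kern_Phi[OF g] by (simp add: scaleR_conv_of_real mult.commute)
  also have "\<dots> = (\<integral>p. cis (\<xi> \<bullet> fst p) * complex_of_real (Phi g \<epsilon> ((fst p - g *v snd p) - z)) \<partial>(\<mu> \<Otimes>\<^sub>M \<nu>))"
  proof (subst munu.integral_fst'[symmetric])
    show "integrable (\<mu> \<Otimes>\<^sub>M \<nu>) (\<lambda>p. cis (\<xi> \<bullet> fst p) * complex_of_real (Phi g \<epsilon> ((fst p - g *v snd p) - z)))"
      using Phi_props(1,3)[OF g e] by (intro munu.integrable_const_bound[where B="(1 / \<epsilon>) ^ CARD('n) * B"]) (auto simp: norm_mult)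
  qed simp
  finally show ?thesis .
qed

lemma four_pair:
  "(\<integral>p. cis (\<xi> \<bullet> fst p) * cis (\<zeta> \<bullet> snd p) \<partial>(\<mu> \<Otimes>\<^sub>M \<nu>)) = four \<mu> \<xi> * four \<nu> \<zeta>"
proof (subst munu.integral_fst'[symmetric])
  show "integrable (\<mu> \<Otimes>\<^sub>M \<nu>) (\<lambda>p. cis (\<xi> \<bullet> fst p) * cis (\<zeta> \<bullet> snd p))"
    by (intro munu.integrable_const_bound[where B=1]) (auto simp: norm_mult)
qed (simp add: four_def)

lemma four_measurable_mu [measurable]: "four \<mu> \<in> borel_measurable borel"
  using four_measurable[OF mu.finite_measure_axioms sets_mu] .

lemma four_measurable_nu [measurable]: "four \<nu> \<in> borel_measurable borel"
  using four_measurable[OF nu.finite_measure_axioms sets_nu] .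

text \<open>Up to a constant, the bound for the \<open>z\<close>-integral of the energies of the
  slices at \<open>g\<close>. It does not involve \<open>\<epsilon>\<close>, and \<open>g\<close>
  occurs in the kernel only, so that averaging over \<theta> acts on \<open>rk\<close>
  alone.\<close>

definition Aint :: "real \<Rightarrow> real^'n^'n \<Rightarrow> ennreal" where
  "Aint p g = (\<integral>\<^sup>+\<zeta>. \<integral>\<^sup>+\<xi>. rk p (\<xi> + g *v \<zeta>) * (ennreal ((cmod (four \<mu> \<xi>))\<^sup>2) * ennreal ((cmod (four \<nu> \<zeta>))\<^sup>2)) \<partial>lborel \<partial>lborel)"

text \<open>\<open>mollified_l2_le\<close> leads to the Fourier transform of the weighted image at a
  new frequency \<open>\<eta>\<close>, which factors into the transforms of \<open>\<mu>\<close> at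
  \<open>\<xi> + \<eta>\<close> and of \<open>\<nu>\<close> at
  \<open>- (transpose g *v \<eta>)\<close>. Orthogonal invariance of Lebesgue measure and a
  reflection then bring in \<open>\<zeta>\<close>.\<close>

lemma four_slice_l2:
  assumes g: "orthogonal_matrix g" and e: "\<epsilon> > 0"
  shows "ennreal ((2 * pi) ^ CARD('n)) * (\<integral>\<^sup>+z. ennreal ((cmod (four (slice g z \<epsilon>) \<xi>))\<^sup>2) \<partial>lborel)
    \<le> (\<integral>\<^sup>+\<zeta>. ennreal ((cmod (four \<mu> (\<xi> - g *v \<zeta>)))\<^sup>2) * ennreal ((cmod (four \<nu> \<zeta>))\<^sup>2) \<partial>lborel)"
proof -
  have neg: "g *v (- \<zeta>) = - (g *v \<zeta>)" for \<zeta>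
    by (simp add: matrix_vector_mult_def vec_eq_iff sum_negf)
  have "ennreal ((2 * pi) ^ DIM(real^'n)) * (\<integral>\<^sup>+z. ennreal ((cmod (four (slice g z \<epsilon>) \<xi>))\<^sup>2) \<partial>lborel)
    \<le> (\<integral>\<^sup>+\<eta>. ennreal ((cmod (\<integral>p. cis (\<xi> \<bullet> fst p) * cis (\<eta> \<bullet> (fst p - g *v snd p)) \<partial>(\<mu> \<Otimes>\<^sub>M \<nu>)))\<^sup>2) \<partial>lborel)"
    unfolding four_slice[OF assms]
    by (rule mollified_l2_le[OF munu.finite_measure_axioms]) (use Phi_props[OF assms] in auto)
  also have "\<dots> = (\<integral>\<^sup>+\<eta>. ennreal ((cmod (four \<mu> (\<xi> + \<eta>)))\<^sup>2) * ennreal ((cmod (four \<nu> (- (transpose g *v \<eta>))))\<^sup>2) \<partial>lborel)"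
  proof (intro nn_integral_cong)
    fix \<eta> :: "real^'n"
    have "cis (\<xi> \<bullet> x) * cis (\<eta> \<bullet> (x - g *v y)) = cis ((\<xi> + \<eta>) \<bullet> x) * cis ((- (transpose g *v \<eta>)) \<bullet> y)" for x y
      by (simp add: cis_mult inner_diff_right inner_add_left inner_matrix_vec_transpose add_diff_eq)
    then show "ennreal ((cmod (\<integral>p. cis (\<xi> \<bullet> fst p) * cis (\<eta> \<bullet> (fst p - g *v snd p)) \<partial>(\<mu> \<Otimes>\<^sub>M \<nu>)))\<^sup>2)
      = ennreal ((cmod (four \<mu> (\<xi> + \<eta>)))\<^sup>2) * ennreal ((cmod (four \<nu> (- (transpose g *v \<eta>))))\<^sup>2)"
      by (simp add: four_pair norm_mult power_mult_distrib ennreal_mult del: inner_minus_left)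
  qed
  also have "\<dots> = (\<integral>\<^sup>+\<zeta>. ennreal ((cmod (four \<mu> (\<xi> + g *v \<zeta>)))\<^sup>2) * ennreal ((cmod (four \<nu> (- (transpose g *v (g *v \<zeta>)))))\<^sup>2) \<partial>lborel)"
    by (rule nn_integral_lborel_orthogonal[OF g, symmetric]) measurable
  also have "\<dots> = (\<integral>\<^sup>+\<zeta>. ennreal ((cmod (four \<mu> (\<xi> + g *v \<zeta>)))\<^sup>2) * ennreal ((cmod (four \<nu> (- \<zeta>)))\<^sup>2) \<partial>lborel)"
    by (simp add: orthogonal_matrix_mult_vec[OF g])
  also have "\<dots> = (\<integral>\<^sup>+\<zeta>. ennreal ((cmod (four \<mu> (\<xi> - g *v \<zeta>)))\<^sup>2) * ennreal ((cmod (four \<nu> \<zeta>))\<^sup>2) \<partial>lborel)"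
    by (subst nn_integral_lborel_affine[where c="-1" and t=0]) (auto simp: neg)
  finally show ?thesis by simp
qed

text \<open>On the Fourier side the \<open>z\<close>-integral can be carried out first, for each
  frequency by \<open>four_slice_l2\<close>; translating \<open>\<xi>\<close> by
  \<open>g *v \<zeta>\<close> moves the dependence on \<open>g\<close> into the kernel.\<close>

lemma energy_slice_le:
  assumes g: "orthogonal_matrix g" and e: "\<epsilon> > 0" and b: "b > 0"
    and en: "\<And>M :: (real^'n) measure. finite_measure M \<Longrightarrow> sets M = sets borel \<Longrightarrow>
       riesz_energy u M = ennreal b * (\<integral>\<^sup>+\<xi>. rk p \<xi> * ennreal ((cmod (four M \<xi>))\<^sup>2) \<partial>lborel)"
  shows "(\<integral>\<^sup>+z. riesz_energy u (slice g z \<epsilon>) \<partial>lborel) \<le> ennreal (b / (2 * pi) ^ CARD('n)) * Aint p g"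
proof -
  have [measurable]: "(\<lambda>(z, \<xi>). four (slice g z \<epsilon>) \<xi>) \<in> borel_measurable (lborel \<Otimes>\<^sub>M lborel)"
    unfolding four_slice[OF g e] by measurable
  have c: "ennreal b = ennreal (b / (2 * pi) ^ CARD('n)) * ennreal ((2 * pi) ^ CARD('n))"
    using b by (simp flip: ennreal_mult)
  have "(\<integral>\<^sup>+z. riesz_energy u (slice g z \<epsilon>) \<partial>lborel)
    = (\<integral>\<^sup>+z. ennreal b * (\<integral>\<^sup>+\<xi>. rk p \<xi> * ennreal ((cmod (four (slice g z \<epsilon>) \<xi>))\<^sup>2) \<partial>lborel) \<partial>lborel)"
    by (intro nn_integral_cong en finite_slice e sets_slice)
  also have "\<dots> = ennreal b * (\<integral>\<^sup>+z. \<integral>\<^sup>+\<xi>. rk p \<xi> * ennreal ((cmod (four (slice g z \<epsilon>) \<xi>))\<^sup>2) \<partial>lborel \<partial>lborel)"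
    by (rule nn_integral_cmult) measurable
  also have "(\<integral>\<^sup>+z. \<integral>\<^sup>+\<xi>. rk p \<xi> * ennreal ((cmod (four (slice g z \<epsilon>) \<xi>))\<^sup>2) \<partial>lborel \<partial>lborel)
    = (\<integral>\<^sup>+\<xi>. \<integral>\<^sup>+z. rk p \<xi> * ennreal ((cmod (four (slice g z \<epsilon>) \<xi>))\<^sup>2) \<partial>lborel \<partial>lborel)"
    by (rule lborel_pair.Fubini'[symmetric]) measurable
  also have "\<dots> = (\<integral>\<^sup>+\<xi>. rk p \<xi> * (\<integral>\<^sup>+z. ennreal ((cmod (four (slice g z \<epsilon>) \<xi>))\<^sup>2) \<partial>lborel) \<partial>lborel)"
    by (intro nn_integral_cong nn_integral_cmult) measurable
  also have "ennreal b * \<dots> = ennreal (b / (2 * pi) ^ CARD('n)) *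
     (\<integral>\<^sup>+\<xi>. rk p \<xi> * (ennreal ((2 * pi) ^ CARD('n)) * (\<integral>\<^sup>+z. ennreal ((cmod (four (slice g z \<epsilon>) \<xi>))\<^sup>2) \<partial>lborel)) \<partial>lborel)"
    unfolding c mult.assoc by (subst nn_integral_cmult[symmetric]) (auto simp: mult_ac)
  also have "\<dots> \<le> ennreal (b / (2 * pi) ^ CARD('n)) *
     (\<integral>\<^sup>+\<xi>. rk p \<xi> * (\<integral>\<^sup>+\<zeta>. ennreal ((cmod (four \<mu> (\<xi> - g *v \<zeta>)))\<^sup>2) * ennreal ((cmod (four \<nu> \<zeta>))\<^sup>2) \<partial>lborel) \<partial>lborel)"
    by (intro mult_left_mono nn_integral_mono four_slice_l2[OF g e]) auto
  also have "(\<integral>\<^sup>+\<xi>. rk p \<xi> * (\<integral>\<^sup>+\<zeta>. ennreal ((cmod (four \<mu> (\<xi> - g *v \<zeta>)))\<^sup>2) * ennreal ((cmod (four \<nu> \<zeta>))\<^sup>2) \<partial>lborel) \<partial>lborel)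
    = (\<integral>\<^sup>+\<xi>. \<integral>\<^sup>+\<zeta>. rk p \<xi> * (ennreal ((cmod (four \<mu> (\<xi> - g *v \<zeta>)))\<^sup>2) * ennreal ((cmod (four \<nu> \<zeta>))\<^sup>2)) \<partial>lborel \<partial>lborel)"
    by (intro nn_integral_cong nn_integral_cmult[symmetric]) measurable
  also have "\<dots> = (\<integral>\<^sup>+\<zeta>. \<integral>\<^sup>+\<xi>. rk p \<xi> * (ennreal ((cmod (four \<mu> (\<xi> - g *v \<zeta>)))\<^sup>2) * ennreal ((cmod (four \<nu> \<zeta>))\<^sup>2)) \<partial>lborel \<partial>lborel)"
    by (rule lborel_pair.Fubini'[symmetric]) measurable
  also have "\<dots> = Aint p g"
    unfolding Aint_def
  proof (rule nn_integral_cong)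
    fix \<zeta> :: "real^'n"
    show "(\<integral>\<^sup>+\<xi>. rk p \<xi> * (ennreal ((cmod (four \<mu> (\<xi> - g *v \<zeta>)))\<^sup>2) * ennreal ((cmod (four \<nu> \<zeta>))\<^sup>2)) \<partial>lborel)
      = (\<integral>\<^sup>+\<xi>. rk p (\<xi> + g *v \<zeta>) * (ennreal ((cmod (four \<mu> \<xi>))\<^sup>2) * ennreal ((cmod (four \<nu> \<zeta>))\<^sup>2)) \<partial>lborel)"
      by (subst nn_integral_lborel_affine[where c=1 and t="g *v \<zeta>"]) (auto simp: add.commute)
  qed
  finally show ?thesis .
qed

text \<open>After Tonelli's theorem only the kernel is averaged, and the product form of its bound
  splits the double frequency integral into two energies.\<close>

lemma Aint_average:
  fixes \<theta> :: "(real^'n^'n) measure"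
  assumes s[measurable_cong]: "sets \<theta> = sets borel" and fin: "finite_measure \<theta>"
    and av: "\<And>\<xi> \<zeta>. (\<integral>\<^sup>+g. rk p (\<xi> + g *v \<zeta>) \<partial>\<theta>) \<le> ennreal C * (rk p1 \<xi> * rk p2 \<zeta>)"
  shows "(\<integral>\<^sup>+g. Aint p g \<partial>\<theta>) \<le> ennreal C * ((\<integral>\<^sup>+\<xi>. rk p1 \<xi> * ennreal ((cmod (four \<mu> \<xi>))\<^sup>2) \<partial>lborel) * (\<integral>\<^sup>+\<zeta>. rk p2 \<zeta> * ennreal ((cmod (four \<nu> \<zeta>))\<^sup>2) \<partial>lborel))"
proof -
  interpret th: finite_measure \<theta> by fact
  interpret TL: pair_sigma_finite \<theta> "lborel :: (real^'n) measure" ..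
  let ?m = "\<lambda>\<xi>. ennreal ((cmod (four \<mu> \<xi>))\<^sup>2)" and ?n = "\<lambda>\<zeta>. ennreal ((cmod (four \<nu> \<zeta>))\<^sup>2)"
  have "(\<integral>\<^sup>+g. Aint p g \<partial>\<theta>) = (\<integral>\<^sup>+\<zeta>. \<integral>\<^sup>+g. \<integral>\<^sup>+\<xi>. rk p (\<xi> + g *v \<zeta>) * (?m \<xi> * ?n \<zeta>) \<partial>lborel \<partial>\<theta> \<partial>lborel)"
    unfolding Aint_def by (rule TL.Fubini'[symmetric]) measurable
  also have "\<dots> = (\<integral>\<^sup>+\<zeta>. \<integral>\<^sup>+\<xi>. \<integral>\<^sup>+g. rk p (\<xi> + g *v \<zeta>) * (?m \<xi> * ?n \<zeta>) \<partial>\<theta> \<partial>lborel \<partial>lborel)"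
    by (intro nn_integral_cong TL.Fubini'[symmetric]) measurable
  also have "\<dots> = (\<integral>\<^sup>+\<zeta>. \<integral>\<^sup>+\<xi>. (\<integral>\<^sup>+g. rk p (\<xi> + g *v \<zeta>) \<partial>\<theta>) * (?m \<xi> * ?n \<zeta>) \<partial>lborel \<partial>lborel)"
    by (intro nn_integral_cong nn_integral_multc) measurable
  also have "\<dots> \<le> (\<integral>\<^sup>+\<zeta>. \<integral>\<^sup>+\<xi>. ennreal C * (rk p1 \<xi> * rk p2 \<zeta>) * (?m \<xi> * ?n \<zeta>) \<partial>lborel \<partial>lborel)"
    by (intro nn_integral_mono mult_right_mono av) auto
  also have "\<dots> = (\<integral>\<^sup>+\<zeta>. \<integral>\<^sup>+\<xi>. (ennreal C * (rk p2 \<zeta> * ?n \<zeta>)) * (rk p1 \<xi> * ?m \<xi>) \<partial>lborel \<partial>lborel)"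
    by (simp add: mult_ac)
  also have "\<dots> = (\<integral>\<^sup>+\<zeta>. (ennreal C * (rk p2 \<zeta> * ?n \<zeta>)) * (\<integral>\<^sup>+\<xi>. rk p1 \<xi> * ?m \<xi> \<partial>lborel) \<partial>lborel)"
    by (intro nn_integral_cong nn_integral_cmult) measurable
  also have "\<dots> = ennreal C * (\<integral>\<^sup>+\<zeta>. rk p2 \<zeta> * ?n \<zeta> \<partial>lborel) * (\<integral>\<^sup>+\<xi>. rk p1 \<xi> * ?m \<xi> \<partial>lborel)"
    by (simp add: nn_integral_multc nn_integral_cmult)
  finally show ?thesis by (simp add: mult_ac)
qed

end

section \<open>Absolute continuity of the projected product measure\<close>

lemma tendsto_at_right_0_sequentially:
  "filterlim (\<lambda>j. 1 / real (Suc j)) (at_right 0) sequentially"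
  using LIMSEQ_inverse_real_of_nat
  by (auto simp: filterlim_at inverse_eq_divide intro!: always_eventually)

context moll_pair
begin

definition proj :: "real^'n^'n \<Rightarrow> (real^'n) measure" where
  "proj g = distr (\<mu> \<Otimes>\<^sub>M \<nu>) borel (\<lambda>p. fst p - g *v snd p)"

text \<open>Its mollifications are the integrals of \<open>f\<close> against the slices
  (\<open>integral_wproj_Phi\<close>), and it is absolutely continuous as soon as
  \<open>proj g\<close> is.\<close>

definition wproj :: "(real^'n \<Rightarrow> real) \<Rightarrow> real^'n^'n \<Rightarrow> (real^'n) measure" where
  "wproj f g = distr (density (\<mu> \<Otimes>\<^sub>M \<nu>) (\<lambda>p. ennreal (f (fst p)))) borel (\<lambda>p. fst p - g *v snd p)"

lemma sets_proj [simp, measurable_cong]: "sets (proj g) = sets borel" by (simp add: proj_def)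

lemma sets_wproj [simp, measurable_cong]: "sets (wproj f g) = sets borel" by (simp add: wproj_def)

lemma emeasure_slice:
  assumes g: "orthogonal_matrix g" and e: "\<epsilon> > 0"
  shows "emeasure (slice g z \<epsilon>) UNIV = (\<integral>\<^sup>+w. ennreal (Phi g \<epsilon> (w - z)) \<partial>proj g)"
proof -
  have "emeasure (slice g z \<epsilon>) UNIV = (\<integral>\<^sup>+x. ennreal (kern g z \<epsilon> x) \<partial>\<mu>)"
    by (simp add: slice_def emeasure_density)
  also have "\<dots> = (\<integral>\<^sup>+x. \<integral>\<^sup>+y. ennreal (Phi g \<epsilon> ((x - g *v y) - z)) \<partial>\<nu> \<partial>\<mu>)"
  proof (intro nn_integral_cong)
    fix x
    show "ennreal (kern g z \<epsilon> x) = (\<integral>\<^sup>+y. ennreal (Phi g \<epsilon> ((x - g *v y) - z)) \<partial>\<nu>)"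
      unfolding kern_def kern_Phi[OF g, symmetric] using kern_integrable[OF e] moll_bounds[OF e]
      by (intro nn_integral_eq_integral[symmetric]) auto
  qed
  also have "\<dots> = (\<integral>\<^sup>+p. ennreal (Phi g \<epsilon> ((fst p - g *v snd p) - z)) \<partial>(\<mu> \<Otimes>\<^sub>M \<nu>))"
    by (subst nu.nn_integral_fst[symmetric]) auto
  also have "\<dots> = (\<integral>\<^sup>+w. ennreal (Phi g \<epsilon> (w - z)) \<partial>proj g)"
    unfolding proj_def by (subst nn_integral_distr) auto
  finally show ?thesis .
qed

text \<open>Points of the ball of radius \<open>R\<close> are at distance at most
  \<open>2 * R\<close>, so the kernel is bounded below. The added 1 keeps the base positive when
  \<open>R = 0\<close>.\<close>

lemma mass_le_energy:
  assumes "\<epsilon> > 0" and u: "u > 0"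
  shows "emeasure (slice g z \<epsilon>) UNIV * emeasure (slice g z \<epsilon>) UNIV \<le> ennreal ((2 * R + 1) powr u) * riesz_energy u (slice g z \<epsilon>)"
proof -
  let ?S = "slice g z \<epsilon>" and ?c = "(2 * R + 1) powr (-u)"
  interpret S: finite_measure ?S by (rule finite_slice[OF assms(1)])
  have "ennreal ?c * (emeasure ?S UNIV * emeasure ?S UNIV) = (\<integral>\<^sup>+x. \<integral>\<^sup>+y. ennreal ?c \<partial>?S \<partial>?S)"
    by (simp add: mult_ac)
  also have "\<dots> \<le> riesz_energy u ?S"
    unfolding riesz_energy_rk
  proof (rule nn_integral_mono_AE, use AE_slice[OF R, of g z \<epsilon>] in eventually_elim)
    case x: (elim x)
    show ?case
    proof (rule nn_integral_mono_AE, use AE_slice[OF R, of g z \<epsilon>] in eventually_elim)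
      case (elim y)
      have "norm (x - y) \<le> 2 * R + 1" using norm_triangle_ineq4[of x y] x elim by linarith
      then show ?case using u by (auto simp: rk_def intro!: ennreal_leI powr_mono2')
    qed
  qed
  finally have "ennreal ((2 * R + 1) powr u) * (ennreal ?c * (emeasure ?S UNIV * emeasure ?S UNIV)) \<le> ennreal ((2 * R + 1) powr u) * riesz_energy u ?S"
    by (intro mult_left_mono) auto
  moreover have "ennreal ((2 * R + 1) powr u) * ennreal ?c = 1"
    using R0 by (simp add: powr_minus flip: ennreal_mult)
  ultimately show ?thesis by (simp flip: mult.assoc)
qed

text \<open>If \<open>m\<close> exceeds \<open>\<kappa>\<close>, then \<open>m\<close> is at most
  \<open>m * m / \<kappa>\<close>. Integrated over a set, this trades its volume against an L2
  bound.\<close>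

lemma ennreal_le_add_square:
  fixes m :: ennreal and \<kappa> :: real
  assumes "\<kappa> > 0"
  shows "m \<le> ennreal \<kappa> + ennreal (1 / \<kappa>) * (m * m)"
proof (cases "m \<le> ennreal \<kappa>")
  case True
  then show ?thesis by (rule order_trans) simp
next
  case False
  then have "ennreal (1 / \<kappa>) * ennreal \<kappa> \<le> ennreal (1 / \<kappa>) * m" by (intro mult_left_mono) auto
  then have "1 \<le> ennreal (1 / \<kappa>) * m" using assms by (simp flip: ennreal_mult)
  then have "1 * m \<le> (ennreal (1 / \<kappa>) * m) * m" by (intro mult_right_mono) auto
  then have "m \<le> ennreal (1 / \<kappa>) * (m * m)" by (simp add: mult.assoc)
  then show ?thesis by (rule order_trans) simp
qed

text \<open>The mollifications of \<open>proj g\<close> have uniformly bounded \<open>L\<^sup>2\<close> norms, so \<open>proj g\<close> gives small mass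
  to open sets of small volume.\<close>

lemma proj_absolutely_continuous:
  assumes g: "orthogonal_matrix g"
    and E: "\<And>\<epsilon>. \<epsilon> > 0 \<Longrightarrow> (\<integral>\<^sup>+z. emeasure (slice g z \<epsilon>) UNIV * emeasure (slice g z \<epsilon>) UNIV \<partial>lborel) \<le> ennreal E"
  shows "absolutely_continuous lborel (proj g)"
  unfolding absolutely_continuous_def
proof
  fix N :: "(real^'n) set" assume N: "N \<in> null_sets lborel"
  interpret P: finite_measure "proj g"
    unfolding proj_def by (rule munu.finite_measure_distr) simp
  interpret PL: pair_sigma_finite "proj g" "lborel :: (real^'n) measure" ..
  have "emeasure (proj g) N \<le> 0 + ennreal \<delta>" if \<delta>: "\<delta> > 0" for \<delta>
  proof -
    define E' where "E' = max E 0 + 1"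
    have E': "E' > 0" "E \<le> E'" by (auto simp: E'_def)
    \<comment> \<open>Balances the two contributions: \<open>E' / \<kappa> = \<delta> / 2\<close>,
      and the volume of \<open>U\<close> is chosen so that \<open>\<kappa>\<close> times it is at
      most \<open>\<delta> / 2\<close>.\<close>
    define \<kappa> where "\<kappa> = 2 * E' / \<delta>"
    have \<kappa>: "\<kappa> > 0" using E' \<delta> by (simp add: \<kappa>_def)
    have "N \<in> sets lebesgue" using N by (auto simp: null_sets_def)
    moreover have "\<delta> / (2 * \<kappa>) > 0" using \<delta> \<kappa> by simp
    ultimately obtain U where U: "open U" "N \<subseteq> U" "U - N \<in> lmeasurable" "emeasure lebesgue (U - N) < ennreal (\<delta> / (2 * \<kappa>))"
      by (rule sets_lebesgue_outer_open)
    have Ub[measurable]: "U \<in> sets borel" using U by simp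
    have Nb: "N \<in> sets borel" using N by (auto simp: null_sets_def)
    have "emeasure lborel U = emeasure lborel (U - N)"
      using emeasure_Diff_null_set[of N lborel U] N Ub by simp
    then have Um: "emeasure lborel U \<le> ennreal (\<delta> / (2 * \<kappa>))" using U(4) Ub Nb by simp
    define e where "e j = 1 / real (Suc j)" for j :: nat
    have epos: "e j > 0" for j by (simp add: e_def)
    have mm[measurable]: "(\<lambda>z. emeasure (slice g z (e j)) UNIV) \<in> borel_measurable borel" for j
      by (subst emeasure_slice[OF g epos]) measurable
    have "emeasure (proj g) N \<le> emeasure (proj g) U" using U Ub by (intro emeasure_mono) auto
    also have "\<dots> = (\<integral>\<^sup>+w. indicator U w \<partial>proj g)" by simp
    \<comment> \<open>Since \<open>U\<close> is open, the mollifier around a point \<open>w\<close>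
      of \<open>U\<close> is eventually supported inside \<open>U\<close> and contributes its full
      integral 1.\<close>
    also have "\<dots> \<le> (\<integral>\<^sup>+w. liminf (\<lambda>j. \<integral>\<^sup>+z. indicator U z * ennreal (Phi g (e j) (w - z)) \<partial>lborel) \<partial>proj g)"
    proof (intro nn_integral_mono)
      fix w
      show "indicator U w \<le> liminf (\<lambda>j. \<integral>\<^sup>+z. indicator U z * ennreal (Phi g (e j) (w - z)) \<partial>lborel)"
      proof (cases "w \<in> U")
        case True
        then obtain d where d: "d > 0" "cball w d \<subseteq> U" using U(1) open_contains_cball by blast
        have "\<forall>\<^sub>F j in sequentially. e j < d"
          using order_tendstoD(2)[OF LIMSEQ_inverse_real_of_nat d(1)] by (simp add: inverse_eq_divide e_def)
        then have "\<forall>\<^sub>F j in sequentially. 1 \<le> (\<integral>\<^sup>+z. indicator U z * ennreal (Phi g (e j) (w - z)) \<partial>lborel)"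
        proof eventually_elim
          case (elim j)
          have ej: "e j > 0" by (rule epos)
          note P = Phi_props[OF g ej]
          have "(\<integral>\<^sup>+z. indicator U z * ennreal (Phi g (e j) (w - z)) \<partial>lborel) = (\<integral>\<^sup>+z. ennreal (Phi g (e j) (w - z)) \<partial>lborel)"
          proof (intro nn_integral_cong)
            fix z
            show "indicator U z * ennreal (Phi g (e j) (w - z)) = ennreal (Phi g (e j) (w - z))"
            proof (cases "norm (w - z) > e j")
              case False
              then have "z \<in> cball w d" using elim by (simp add: dist_norm)
              then show ?thesis using d(2) by (auto simp: indicator_def)
            qed (simp only: P(6) ennreal_0 mult_zero_right)
          qed
          also have "\<dots> = (\<integral>\<^sup>+z. ennreal (Phi g (e j) z) \<partial>lborel)"
            by (subst (2) nn_integral_lborel_affine[where c="-1" and t=w]) auto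
          also have "\<dots> = 1" using P by (subst nn_integral_eq_integral) auto
          finally show ?case by simp
        qed
        then show ?thesis using True by (intro Liminf_bounded) simp
      qed simp
    qed
    also have "\<dots> \<le> liminf (\<lambda>j. \<integral>\<^sup>+w. \<integral>\<^sup>+z. indicator U z * ennreal (Phi g (e j) (w - z)) \<partial>lborel \<partial>proj g)"
      by (intro nn_integral_liminf) measurable
    also have "\<dots> \<le> liminf (\<lambda>j. ennreal \<delta>)"
    proof (intro Liminf_mono always_eventually allI)
      fix j
      let ?m = "\<lambda>z. emeasure (slice g z (e j)) UNIV"
      have ej: "e j > 0" by (rule epos)
      have "(\<integral>\<^sup>+w. \<integral>\<^sup>+z. indicator U z * ennreal (Phi g (e j) (w - z)) \<partial>lborel \<partial>proj g)
        = (\<integral>\<^sup>+z. \<integral>\<^sup>+w. indicator U z * ennreal (Phi g (e j) (w - z)) \<partial>proj g \<partial>lborel)"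
        by (rule PL.Fubini'[symmetric]) measurable
      also have "\<dots> = (\<integral>\<^sup>+z. indicator U z * ?m z \<partial>lborel)"
        unfolding emeasure_slice[OF g ej] by (intro nn_integral_cong nn_integral_cmult) measurable
      also have "\<dots> \<le> (\<integral>\<^sup>+z. ennreal \<kappa> * indicator U z + ennreal (1 / \<kappa>) * (?m z * ?m z) \<partial>lborel)"
      proof (intro nn_integral_mono)
        fix z
        show "indicator U z * ?m z \<le> ennreal \<kappa> * indicator U z + ennreal (1 / \<kappa>) * (?m z * ?m z)"
          using ennreal_le_add_square[OF \<kappa>, of "?m z"] by (cases "z \<in> U") auto
      qed
      also have "\<dots> = ennreal \<kappa> * emeasure lborel U + ennreal (1 / \<kappa>) * (\<integral>\<^sup>+z. ?m z * ?m z \<partial>lborel)"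
        by (subst nn_integral_add) (auto simp: nn_integral_cmult)
      also have "\<dots> \<le> ennreal \<kappa> * ennreal (\<delta> / (2 * \<kappa>)) + ennreal (1 / \<kappa>) * ennreal E'"
        by (intro add_mono mult_left_mono Um order_trans[OF E[OF ej] ennreal_leI[OF E'(2)]]) auto
      also have "\<dots> = ennreal \<delta>"
      proof -
        have 1: "\<kappa> * (\<delta> / (2 * \<kappa>)) = \<delta> / 2" using \<kappa> by simp
        have 2: "1 / \<kappa> * E' = \<delta> / 2" unfolding \<kappa>_def using E'(1) \<delta> by simp
        have "ennreal \<kappa> * ennreal (\<delta> / (2 * \<kappa>)) = ennreal (\<kappa> * (\<delta> / (2 * \<kappa>)))"
          using \<kappa> \<delta> by (intro ennreal_mult[symmetric]) simp_all
        moreover have "ennreal (1 / \<kappa>) * ennreal E' = ennreal (1 / \<kappa> * E')"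
          using \<kappa> E'(1) by (intro ennreal_mult[symmetric]) simp_all
        moreover have "ennreal (\<delta> / 2) + ennreal (\<delta> / 2) = ennreal (\<delta> / 2 + \<delta> / 2)"
          using \<delta> by (intro ennreal_plus[symmetric]) simp_all
        ultimately show ?thesis unfolding 1 2 by simp
      qed
      finally show "(\<integral>\<^sup>+w. \<integral>\<^sup>+z. indicator U z * ennreal (Phi g (e j) (w - z)) \<partial>lborel \<partial>proj g) \<le> ennreal \<delta>" .
    qed
    also have "\<dots> = ennreal \<delta>" by (simp add: Liminf_const)
    finally show ?thesis by simp
  qed
  then have "emeasure (proj g) N \<le> 0" by (rule ennreal_le_epsilon) auto
  then show "N \<in> null_sets (proj g)" using N by (auto simp: null_sets_def)
qed

lemma kern_f_integrable:
  assumes [measurable]: "f \<in> borel_measurable borel" and f: "AE x in \<mu>. \<bar>f x\<bar> \<le> K" and e: "\<epsilon> > 0"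
  shows "integrable \<mu> (\<lambda>x. f x * kern g z \<epsilon> x)"
proof (rule mu.integrable_const_bound[where B="K * ((1 / \<epsilon>) ^ CARD('n) * B * measure \<nu> UNIV)"])
  show "AE x in \<mu>. norm (f x * kern g z \<epsilon> x) \<le> K * ((1 / \<epsilon>) ^ CARD('n) * B * measure \<nu> UNIV)"
    using f
  proof eventually_elim
    case (elim x)
    then show ?case using kern_bounds[OF e, of g z x] unfolding real_norm_def abs_mult by (intro mult_mono) auto
  qed
qed measurable

lemma emeasure_wproj:
  assumes [measurable]: "f \<in> borel_measurable borel"
  shows "emeasure (wproj f g) UNIV = (\<integral>\<^sup>+x. ennreal (f x) \<partial>\<mu>) * emeasure \<nu> UNIV"
proof -
  have "emeasure (wproj f g) UNIV = (\<integral>\<^sup>+p. ennreal (f (fst p)) \<partial>(\<mu> \<Otimes>\<^sub>M \<nu>))"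
  proof -
    have "emeasure (wproj f g) UNIV = (\<integral>\<^sup>+w. 1 \<partial>wproj f g)" by (simp add: wproj_def)
    also have "\<dots> = (\<integral>\<^sup>+p. ennreal (f (fst p)) \<partial>(\<mu> \<Otimes>\<^sub>M \<nu>))"
      unfolding wproj_def by (subst nn_integral_distr) (simp_all add: nn_integral_density del: nn_integral_const)
    finally show ?thesis .
  qed
  also have "\<dots> = (\<integral>\<^sup>+x. ennreal (f x) * emeasure \<nu> UNIV \<partial>\<mu>)"
    by (subst nu.nn_integral_fst[symmetric]) auto
  also have "\<dots> = (\<integral>\<^sup>+x. ennreal (f x) \<partial>\<mu>) * emeasure \<nu> UNIV"
    by (rule nn_integral_multc) measurable
  finally show ?thesis .
qed

lemma integral_wproj_Phi:
  assumes g: "orthogonal_matrix g" and e: "\<epsilon> > 0" and [measurable]: "f \<in> borel_measurable borel"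
    and f: "\<And>x. 0 \<le> f x" "\<And>x. f x \<le> K"
  shows "(\<integral>w. Phi g \<epsilon> (w - z) \<partial>wproj f g) = (\<integral>x. f x * kern g z \<epsilon> x \<partial>\<mu>)"
proof -
  have "(\<integral>w. Phi g \<epsilon> (w - z) \<partial>wproj f g) = (\<integral>p. f (fst p) * Phi g \<epsilon> ((fst p - g *v snd p) - z) \<partial>(\<mu> \<Otimes>\<^sub>M \<nu>))"
    unfolding wproj_def using f(1) by (subst integral_distr) (auto simp: integral_density)
  also have "\<dots> = (\<integral>x. \<integral>y. f x * Phi g \<epsilon> ((x - g *v y) - z) \<partial>\<nu> \<partial>\<mu>)"
  proof (subst munu.integral_fst'[symmetric])
    have K: "K \<ge> 0" using f[of 0] by linarith
    have "norm (f x * Phi g \<epsilon> v) \<le> K * ((1 / \<epsilon>) ^ CARD('n) * B)" for x v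
      unfolding real_norm_def abs_mult using f Phi_props(1,3)[OF g e] K by (intro mult_mono) auto
    then show "integrable (\<mu> \<Otimes>\<^sub>M \<nu>) (\<lambda>p. f (fst p) * Phi g \<epsilon> ((fst p - g *v snd p) - z))"
      by (intro munu.integrable_const_bound[where B="K * ((1 / \<epsilon>) ^ CARD('n) * B)"]) auto
  qed simp
  also have "\<dots> = (\<integral>x. f x * kern g z \<epsilon> x \<partial>\<mu>)"
    unfolding kern_def kern_Phi[OF g] by simp
  finally show ?thesis .
qed

text \<open>An application of \<open>mollification_tendsto_density\<close> to
  \<open>wproj f g\<close> with the rotated profile. The integral of the limit is recorded because
  the case f = 1 yields the total mass in (b).\<close>

lemma wproj_limit:
  assumes g: "orthogonal_matrix g" and ac: "absolutely_continuous lborel (proj g)"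
    and fm[measurable]: "f \<in> borel_measurable borel" and f: "\<And>x. 0 \<le> f x" "\<And>x. f x \<le> K"
  obtains h :: "real^'n \<Rightarrow> real" where "h \<in> borel_measurable borel" "\<And>z. h z \<ge> 0"
    "(\<integral>\<^sup>+z. ennreal (h z) \<partial>lborel) = (\<integral>\<^sup>+x. ennreal (f x) \<partial>\<mu>) * emeasure \<nu> UNIV"
    "AE z in lborel. ((\<lambda>\<epsilon>. \<integral>x. f x * kern g z \<epsilon> x \<partial>\<mu>) \<longlongrightarrow> h z) (at_right 0)"
proof -
  have fin: "finite_measure (wproj f g)"
  proof (rule finite_measureI)
    have "(\<integral>\<^sup>+x. ennreal (f x) \<partial>\<mu>) \<le> (\<integral>\<^sup>+x. ennreal K \<partial>\<mu>)" using f by (intro nn_integral_mono ennreal_leI)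
    also have "\<dots> < \<infinity>" by (simp add: mu.emeasure_eq_measure ennreal_mult_less_top)
    finally have "(\<integral>\<^sup>+x. ennreal (f x) \<partial>\<mu>) * emeasure \<nu> UNIV < \<infinity>" by (simp add: nu.emeasure_eq_measure ennreal_mult_less_top)
    moreover have "space (wproj f g) = UNIV" by (simp add: wproj_def)
    ultimately show "emeasure (wproj f g) (space (wproj f g)) \<noteq> \<infinity>" by (simp add: emeasure_wproj less_top)
  qed
  have ac': "absolutely_continuous lborel (wproj f g)"
    unfolding absolutely_continuous_def
  proof
    fix N :: "(real^'n) set" assume N: "N \<in> null_sets lborel"
    then have Nb[measurable]: "N \<in> sets borel" by (auto simp: null_sets_def)
    have "emeasure (proj g) N = 0" using ac N unfolding absolutely_continuous_def by auto
    then have "AE w in proj g. w \<notin> N" by (intro AE_I[where N=N]) auto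
    then have ae: "AE p in \<mu> \<Otimes>\<^sub>M \<nu>. fst p - g *v snd p \<notin> N"
      unfolding proj_def by (subst (asm) AE_distr_iff) auto
    then have "AE p in density (\<mu> \<Otimes>\<^sub>M \<nu>) (\<lambda>p. ennreal (f (fst p))). fst p - g *v snd p \<notin> N"
      by (subst AE_density) (auto elim: eventually_mono)
    then have "AE w in wproj f g. w \<notin> N"
      unfolding wproj_def by (subst AE_distr_iff) auto
    then have "emeasure (wproj f g) N = 0"
      by (subst (asm) AE_iff_measurable[of N]) (auto simp: wproj_def)
    then show "N \<in> null_sets (wproj f g)" by (auto simp: null_sets_def)
  qed
  obtain h :: "real^'n \<Rightarrow> real" where h: "h \<in> borel_measurable borel" "\<And>z. h z \<ge> 0" "(\<integral>\<^sup>+z. ennreal (h z) \<partial>lborel) = emeasure (wproj f g) UNIV"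
    "AE z in lborel. \<forall>\<phi> B. \<phi> \<in> borel_measurable borel \<longrightarrow> (\<forall>x. \<bar>\<phi> x\<bar> \<le> B) \<longrightarrow> (\<forall>x. norm x > 1 \<longrightarrow> \<phi> x = 0) \<longrightarrow>
       integral\<^sup>L lborel \<phi> = 1 \<longrightarrow> ((\<lambda>\<epsilon>. \<integral>w. (1 / \<epsilon>) ^ DIM(real^'n) * \<phi> ((1 / \<epsilon>) *\<^sub>R (w - z)) \<partial>wproj f g) \<longlongrightarrow> h z) (at_right 0)"
    by (rule mollification_tendsto_density[OF fin sets_wproj ac'], rule that, assumption, erule meta_spec, assumption+)
  let ?\<phi> = "\<lambda>v. \<psi> (transpose g *v v)"
  have \<phi>: "?\<phi> \<in> borel_measurable borel" "\<forall>x. \<bar>?\<phi> x\<bar> \<le> B" "\<forall>x. norm x > 1 \<longrightarrow> ?\<phi> x = 0" "integral\<^sup>L lborel ?\<phi> = 1"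
  proof -
    show "?\<phi> \<in> borel_measurable borel" by measurable
    show "\<forall>x. \<bar>?\<phi> x\<bar> \<le> B" proof
      fix x show "\<bar>?\<phi> x\<bar> \<le> B" using \<psi>_nonneg[of "transpose g *v x"] \<psi>_le[of "transpose g *v x"] by linarith
    qed
    show "\<forall>x. norm x > 1 \<longrightarrow> ?\<phi> x = 0" proof (intro allI impI)
      fix x :: "real^'n" assume "norm x > 1"
      then show "?\<phi> x = 0" by (intro \<psi>_supp) (simp add: orthogonal_matrix_mult_vec[OF g])
    qed
    have "orthogonal_matrix (transpose g)" using g by (simp add: orthogonal_matrix_transpose)
    from integral_lborel_orthogonal[OF this \<psi>_measurable] show "integral\<^sup>L lborel ?\<phi> = 1" using \<psi>_int by simp
  qed
  have e: "(1 / \<epsilon>) ^ DIM(real^'n) * ?\<phi> ((1 / \<epsilon>) *\<^sub>R v) = Phi g \<epsilon> v" for \<epsilon> v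
    unfolding Phi_def moll_eps_def linear_scale[OF matrix_vector_mul_linear] by simp
  have "AE z in lborel. ((\<lambda>\<epsilon>. \<integral>x. f x * kern g z \<epsilon> x \<partial>\<mu>) \<longlongrightarrow> h z) (at_right 0)"
    using h(4)
  proof eventually_elim
    case (elim z)
    then have "((\<lambda>\<epsilon>. \<integral>w. (1 / \<epsilon>) ^ DIM(real^'n) * ?\<phi> ((1 / \<epsilon>) *\<^sub>R (w - z)) \<partial>wproj f g) \<longlongrightarrow> h z) (at_right 0)"
      using \<phi> by blast
    then have "((\<lambda>\<epsilon>. \<integral>w. Phi g \<epsilon> (w - z) \<partial>wproj f g) \<longlongrightarrow> h z) (at_right 0)" unfolding e .
    moreover have "\<forall>\<^sub>F \<epsilon> in at_right 0. (\<integral>w. Phi g \<epsilon> (w - z) \<partial>wproj f g) = (\<integral>x. f x * kern g z \<epsilon> x \<partial>\<mu>)"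
      using eventually_at_right_less[of 0] by eventually_elim (rule integral_wproj_Phi[OF g _ fm f])
    ultimately show ?case by (rule Lim_transform_eventually)
  qed
  from that[of h, OF h(1,2) h(3)[unfolded emeasure_wproj[OF fm]] this] show thesis .
qed

end

section \<open>The set of convergence\<close>

text \<open>Lists over the finite set \<open>Basis\<close> form a countable index set, so the
  exceptional null sets of all monomials can be united.\<close>

definition mon :: "'a::euclidean_space list \<Rightarrow> 'a \<Rightarrow> real" where
  "mon bs x = (\<Prod>b\<leftarrow>bs. x \<bullet> b)"

lemma mon_simps [simp]: "mon [] x = 1" "mon (b # bs) x = (x \<bullet> b) * mon bs x"
  by (simp_all add: mon_def)

lemma continuous_on_mon: "continuous_on S (mon bs)"
  by (induction bs) (auto simp: mon_def intro!: continuous_intros)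

lemma mon_measurable [measurable]: "mon bs \<in> borel_measurable borel"
  by (intro borel_measurable_continuous_onI continuous_on_mon)

text \<open>The linear span of the monomials; its induction rule transfers the existence of limits
  from monomials to polynomials.\<close>

inductive mspan :: "('a::euclidean_space \<Rightarrow> real) \<Rightarrow> bool" where
  mspan_mon: "bs \<in> lists Basis \<Longrightarrow> mspan (mon bs)"
| mspan_add: "mspan f \<Longrightarrow> mspan h \<Longrightarrow> mspan (\<lambda>x. f x + h x)"
| mspan_scale: "mspan f \<Longrightarrow> mspan (\<lambda>x. c * f x)"

lemma continuous_on_mspan: "mspan f \<Longrightarrow> continuous_on S f"
  by (induction rule: mspan.induct) (auto intro!: continuous_intros continuous_on_mon)

lemma mspan_sum: "finite A \<Longrightarrow> (\<And>a. a \<in> A \<Longrightarrow> mspan (f a)) \<Longrightarrow> mspan (\<lambda>x. \<Sum>a\<in>A. f a x)"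
proof (induction rule: finite_induct)
  case empty
  have "mspan (\<lambda>x. 0 * mon [] x)" by (intro mspan_scale mspan_mon) simp
  then show ?case by simp
qed (auto intro: mspan_add)

lemma mspan_coord_mult:
  assumes b: "b \<in> Basis" and h: "mspan h"
  shows "mspan (\<lambda>x. (x \<bullet> b) * h x)"
  using h
proof (induction rule: mspan.induct)
  case (mspan_mon bs)
  then have "mspan (mon (b # bs))" using b by (intro mspan.mspan_mon) auto
  then show ?case by (simp add: mon_def[abs_def])
next
  case (mspan_add f h)
  then show ?case using mspan.mspan_add[OF mspan_add.IH] by (simp add: distrib_left)
next
  case (mspan_scale f c)
  then show ?case using mspan.mspan_scale[OF mspan_scale.IH, of c] by (simp add: mult_ac)
qed

text \<open>The extra factor \<open>h\<close> strengthens the induction: the product case follows by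
  using the hypothesis twice.\<close>

lemma mspan_poly_mult:
  assumes "real_polynomial_function p" "mspan h"
  shows "mspan (\<lambda>x. p x * h x)"
  using assms
proof (induction arbitrary: h rule: real_polynomial_function.induct)
  case (linear f)
  have f: "f x = (\<Sum>b\<in>Basis. (x \<bullet> b) * f b)" for x
  proof -
    have "f x = f (\<Sum>b\<in>Basis. (x \<bullet> b) *\<^sub>R b)" by (simp add: euclidean_representation)
    also have "\<dots> = (\<Sum>b\<in>Basis. (x \<bullet> b) * f b)"
      using linear(1) by (simp add: bounded_linear.linear linear_sum linear_scale)
    finally show ?thesis .
  qed
  have "mspan (\<lambda>x. \<Sum>b\<in>Basis. f b * ((x \<bullet> b) * h x))"
    by (intro mspan_sum mspan_scale mspan_coord_mult linear) auto
  moreover have "(\<lambda>x. \<Sum>b\<in>Basis. f b * ((x \<bullet> b) * h x)) = (\<lambda>x. f x * h x)"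
  proof
    fix x
    have "(\<Sum>b\<in>Basis. f b * ((x \<bullet> b) * h x)) = (\<Sum>b\<in>Basis. (x \<bullet> b) * f b) * h x"
      by (simp add: sum_distrib_left mult_ac)
    also have "\<dots> = f x * h x" by (simp only: f[of x, symmetric])
    finally show "(\<Sum>b\<in>Basis. f b * ((x \<bullet> b) * h x)) = f x * h x" .
  qed
  ultimately show ?case by simp
next
  case (const c)
  then show ?case by (rule mspan_scale)
next
  case (add f g)
  then show ?case using mspan_add[OF add.IH(1)[of h] add.IH(2)[of h]] by (simp add: distrib_right)
next
  case (mult f g)
  have "mspan (\<lambda>x. f x * (g x * h x))" by (intro mult.IH mult.prems)
  then show ?case by (simp add: mult.assoc)
qed

lemma mspan_poly: "real_polynomial_function p \<Longrightarrow> mspan p"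
proof -
  assume p: "real_polynomial_function p"
  have "mspan (\<lambda>x. p x * mon [] x)" by (intro mspan_poly_mult p mspan_mon) simp
  then show "mspan p" by simp
qed

text \<open>The point of this criterion is that its right-hand side only involves countable quantifiers.\<close>

lemma convergent_at_right_iff_rat:
  fixes F :: "real \<Rightarrow> real"
  assumes cont: "continuous_on {0<..} F"
  shows "(\<exists>l. (F \<longlongrightarrow> l) (at_right 0)) \<longleftrightarrow>
    (\<forall>k::nat. \<exists>m::nat. \<forall>p q :: rat. 0 < p \<longrightarrow> 0 < q \<longrightarrow> p < 1 / of_nat (Suc m) \<longrightarrow> q < 1 / of_nat (Suc m) \<longrightarrow>
       \<bar>F (of_rat p) - F (of_rat q)\<bar> \<le> 1 / real (Suc k))"
    (is "?L \<longleftrightarrow> ?R")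
proof
  assume ?L
  then obtain l where l: "(F \<longlongrightarrow> l) (at_right 0)" ..
  have tri: "\<bar>a - b\<bar> \<le> c" if "\<bar>a - l\<bar> < c / 2" "\<bar>b - l\<bar> < c / 2" for a b c
    using that by linarith
  show ?R
  proof
    fix k
    have "\<forall>\<^sub>F e in at_right 0. dist (F e) l < 1 / real (Suc k) / 2"
      by (rule tendstoD[OF l]) simp
    then obtain d where d: "d > 0" "\<And>e. 0 < e \<Longrightarrow> e < d \<Longrightarrow> dist (F e) l < 1 / real (Suc k) / 2"
      unfolding eventually_at_right_field by auto
    obtain m where m: "1 / real (Suc m) < d" using d(1) nat_approx_posE by blast
    show "\<exists>m::nat. \<forall>p q :: rat. 0 < p \<longrightarrow> 0 < q \<longrightarrow> p < 1 / of_nat (Suc m) \<longrightarrow> q < 1 / of_nat (Suc m) \<longrightarrow>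
       \<bar>F (of_rat p) - F (of_rat q)\<bar> \<le> 1 / real (Suc k)"
    proof (intro exI[of _ m] allI impI)
      fix p q :: rat assume pq: "0 < p" "0 < q" "p < 1 / of_nat (Suc m)" "q < 1 / of_nat (Suc m)"
      have b: "0 < real_of_rat r \<and> real_of_rat r < d" if "0 < r" "r < 1 / of_nat (Suc m)" for r
      proof -
        have "real_of_rat r < real_of_rat (1 / of_nat (Suc m))" using that(2) by (simp only: of_rat_less)
        also have "\<dots> = 1 / real (Suc m)" by (simp add: of_rat_divide of_rat_add)
        finally show ?thesis using that m by simp
      qed
      have "dist (F (of_rat p)) l < 1 / real (Suc k) / 2" "dist (F (of_rat q)) l < 1 / real (Suc k) / 2"
        using d(2) b pq by auto
      then show "\<bar>F (of_rat p) - F (of_rat q)\<bar> \<le> 1 / real (Suc k)"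
        unfolding dist_real_def by (rule tri)
    qed
  qed
next
  assume R: ?R
  have close: "\<exists>m. \<forall>a b. 0 < a \<longrightarrow> 0 < b \<longrightarrow> a < 1 / real (Suc m) \<longrightarrow> b < 1 / real (Suc m) \<longrightarrow> \<bar>F a - F b\<bar> \<le> 1 / real (Suc k)" for k
  proof -
    obtain m where m: "\<And>p q :: rat. 0 < p \<Longrightarrow> 0 < q \<Longrightarrow> p < 1 / of_nat (Suc m) \<Longrightarrow> q < 1 / of_nat (Suc m) \<Longrightarrow>
       \<bar>F (of_rat p) - F (of_rat q)\<bar> \<le> 1 / real (Suc k)" using R by meson
    have rat: "\<exists>X. (\<forall>i. 0 < X i \<and> X i < 1 / of_nat (Suc m)) \<and> (\<lambda>i. real_of_rat (X i)) \<longlonglongrightarrow> a"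
      if a: "0 < a" "a < 1 / real (Suc m)" for a
    proof -
      \<comment> \<open>Approximation from above; the increment is at most the gap between
        \<open>a\<close> and \<open>1 / real (Suc m)\<close>, so the rationals stay in the
        admissible range.\<close>
      have "\<exists>r::rat. a < of_rat r \<and> of_rat r < a + (1 / real (Suc m) - a) / real (Suc i)" for i
        using a by (intro of_rat_dense) simp
      then obtain X :: "nat \<Rightarrow> rat" where X: "\<And>i. a < of_rat (X i)" "\<And>i. of_rat (X i) < a + (1 / real (Suc m) - a) / real (Suc i)"
        by metis
      have "0 < X i \<and> X i < 1 / of_nat (Suc m)" for i
      proof -
        have "(1 / real (Suc m) - a) / real (Suc i) \<le> (1 / real (Suc m) - a)"
          using a by (simp add: divide_le_eq mult_le_cancel_left1)
        then have "real_of_rat (X i) < 1 / real (Suc m)" using X(2)[of i] by linarith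
        also have "1 / real (Suc m) = real_of_rat (1 / of_nat (Suc m))" by (simp add: of_rat_divide of_rat_add)
        finally have "X i < 1 / of_nat (Suc m)" by (simp only: of_rat_less)
        moreover have "0 < real_of_rat (X i)" using X(1)[of i] a by linarith
        ultimately show ?thesis by simp
      qed
      moreover have "(\<lambda>i. real_of_rat (X i)) \<longlonglongrightarrow> a"
      proof (rule tendsto_sandwich[where f="\<lambda>_. a" and h="\<lambda>i. a + (1 / real (Suc m) - a) / real (Suc i)"])
        have "(\<lambda>i. a + (1 / real (Suc m) - a) * inverse (real (Suc i))) \<longlonglongrightarrow> a + (1 / real (Suc m) - a) * 0"
          by (intro tendsto_intros LIMSEQ_inverse_real_of_nat)
        then show "(\<lambda>i. a + (1 / real (Suc m) - a) / real (Suc i)) \<longlonglongrightarrow> a" by (simp add: divide_inverse)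
      qed (use X in \<open>auto intro!: always_eventually less_imp_le\<close>)
      ultimately show ?thesis by blast
    qed
    have "\<bar>F a - F b\<bar> \<le> 1 / real (Suc k)" if ab: "0 < a" "0 < b" "a < 1 / real (Suc m)" "b < 1 / real (Suc m)" for a b
    proof -
      obtain X Y where X: "\<And>i. 0 < X i \<and> X i < 1 / of_nat (Suc m)" "(\<lambda>i. real_of_rat (X i)) \<longlonglongrightarrow> a"
        and Y: "\<And>i. 0 < Y i \<and> Y i < 1 / of_nat (Suc m)" "(\<lambda>i. real_of_rat (Y i)) \<longlonglongrightarrow> b"
        using rat[OF ab(1,3)] rat[OF ab(2,4)] by blast
      have "(\<lambda>i. F (of_rat (X i))) \<longlonglongrightarrow> F a" "(\<lambda>i. F (of_rat (Y i))) \<longlonglongrightarrow> F b"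
        using ab X Y by (auto intro!: continuous_on_tendsto_compose[OF cont] always_eventually)
      then have "(\<lambda>i. \<bar>F (of_rat (X i)) - F (of_rat (Y i))\<bar>) \<longlonglongrightarrow> \<bar>F a - F b\<bar>" by (intro tendsto_intros)
      then show ?thesis using m X(1) Y(1) by (intro tendsto_upperbound) (auto intro!: always_eventually)
    qed
    then show ?thesis by blast
  qed
  define s where "s i = F (1 / real (Suc i))" for i
  have "Cauchy s"
  proof (rule metric_CauchyI)
    fix e :: real assume "e > 0"
    then obtain k where k: "1 / real (Suc k) < e" using nat_approx_posE by blast
    obtain m where m: "\<And>a b. 0 < a \<Longrightarrow> 0 < b \<Longrightarrow> a < 1 / real (Suc m) \<Longrightarrow> b < 1 / real (Suc m) \<Longrightarrow> \<bar>F a - F b\<bar> \<le> 1 / real (Suc k)"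
      using close[of k] by blast
    have "dist (s i) (s j) < e" if "i \<ge> Suc m" "j \<ge> Suc m" for i j
    proof -
      have "1 / real (Suc i) < 1 / real (Suc m)" "1 / real (Suc j) < 1 / real (Suc m)"
        using that by (auto intro!: divide_strict_left_mono)
      then show ?thesis using m[of "1 / real (Suc i)" "1 / real (Suc j)"] k unfolding s_def dist_real_def by simp
    qed
    then show "\<exists>M. \<forall>i\<ge>M. \<forall>j\<ge>M. dist (s i) (s j) < e" by blast
  qed
  then obtain l where l: "s \<longlonglongrightarrow> l" using Cauchy_convergent_iff convergent_def by blast
  have "(F \<longlongrightarrow> l) (at_right 0)"
  proof (rule tendstoI)
    fix e :: real assume e: "e > 0"
    then obtain k where k: "1 / real (Suc k) < e" using nat_approx_posE by blast
    obtain m where m: "\<And>a b. 0 < a \<Longrightarrow> 0 < b \<Longrightarrow> a < 1 / real (Suc m) \<Longrightarrow> b < 1 / real (Suc m) \<Longrightarrow> \<bar>F a - F b\<bar> \<le> 1 / real (Suc k)"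
      using close[of k] by blast
    have le: "\<bar>F a - l\<bar> \<le> 1 / real (Suc k)" if a: "0 < a" "a < 1 / real (Suc m)" for a
    proof -
      have "(\<lambda>i. \<bar>F a - s i\<bar>) \<longlonglongrightarrow> \<bar>F a - l\<bar>" by (intro tendsto_intros l)
      moreover have "\<forall>\<^sub>F i in sequentially. \<bar>F a - s i\<bar> \<le> 1 / real (Suc k)"
      proof (rule eventually_sequentiallyI[of "Suc m"])
        fix i assume "Suc m \<le> i"
        then have "1 / real (Suc i) < 1 / real (Suc m)" by (auto intro!: divide_strict_left_mono)
        then show "\<bar>F a - s i\<bar> \<le> 1 / real (Suc k)" unfolding s_def using a by (intro m) auto
      qed
      ultimately show ?thesis by (rule tendsto_upperbound) simp
    qed
    have "\<forall>\<^sub>F a in at_right (0::real). 0 < a \<and> a < 1 / real (Suc m)"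
      using eventually_at_right_real[of 0 "1 / real (Suc m)"] by (auto elim: eventually_mono)
    then show "\<forall>\<^sub>F a in at_right 0. dist (F a) l < e"
      by eventually_elim (use le k in \<open>force simp: dist_real_def\<close>)
  qed
  then show ?L ..
qed

context moll_pair
begin

text \<open>A countable family of convergence conditions, hence measurable in both arguments; by
  \<open>good_slice_limit\<close> it implies weak convergence of the slices.\<close>

definition good :: "real^'n^'n \<Rightarrow> real^'n \<Rightarrow> bool" where
  "good g z \<longleftrightarrow> (\<forall>bs\<in>lists Basis. \<exists>l. ((\<lambda>\<epsilon>. \<integral>x. mon bs x * kern g z \<epsilon> x \<partial>\<mu>) \<longlongrightarrow> l) (at_right 0))"

lemma mon_bounded:
  obtains K where "\<And>x :: real^'n. norm x \<le> R \<Longrightarrow> \<bar>mon bs x\<bar> \<le> K"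
proof -
  have "compact (mon bs ` cball (0::real^'n) R)" by (intro compact_continuous_image continuous_on_mon compact_cball)
  then obtain K where "\<forall>y\<in>mon bs ` cball (0::real^'n) R. norm y \<le> K" using compact_imp_bounded bounded_iff by metis
  then show thesis by (intro that[of K]) auto
qed

text \<open>Scales tending to \<open>e > 0\<close> eventually exceed \<open>e / 2\<close>, where the
  mollifiers share the bound \<open>(2 / e) ^ CARD('n) * B\<close>, so dominated convergence
  applies. The statement prepares the restriction to rational scales.\<close>

lemma kern_continuous: "continuous_on {0<..} (\<lambda>\<epsilon>. kern g z \<epsilon> x)"
proof (subst continuous_on_sequentially, intro allI impI ballI)
  fix X :: "nat \<Rightarrow> real" and e :: real
  assume e: "e \<in> {0<..}" and X: "(\<forall>i. X i \<in> {0<..}) \<and> X \<longlonglongrightarrow> e"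
  have ev: "\<forall>\<^sub>F i in sequentially. e / 2 < X i" using X e by (intro order_tendstoD) auto
  obtain N where N: "\<And>i. e / 2 < X (i + N)" using ev unfolding eventually_sequentially by (metis le_add2)
  have "(\<lambda>i. kern g z (X (i + N)) x) \<longlonglongrightarrow> kern g z e x"
    unfolding kern_def
  proof (rule integral_dominated_convergence[where w="\<lambda>_. (2 / e) ^ CARD('n) * B"])
    fix i
    show "AE y in \<nu>. norm (moll_eps \<psi> (X (i + N)) (transpose g *v (x - z) - y)) \<le> (2 / e) ^ CARD('n) * B"
    proof (rule AE_I2)
      fix y
      have Xi: "X (i + N) > 0" using X by auto
      have "(1 / X (i + N)) ^ CARD('n) * B \<le> (2 / e) ^ CARD('n) * B"
        using N[of i] e Xi B0 by (intro mult_right_mono power_mono) (auto simp: field_simps)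
      then show "norm (moll_eps \<psi> (X (i + N)) (transpose g *v (x - z) - y)) \<le> (2 / e) ^ CARD('n) * B"
        using moll_bounds[OF Xi, of "transpose g *v (x - z) - y"] by simp
    qed
  next
    show "AE y in \<nu>. (\<lambda>i. moll_eps \<psi> (X (i + N)) (transpose g *v (x - z) - y)) \<longlonglongrightarrow> moll_eps \<psi> e (transpose g *v (x - z) - y)"
    proof (rule AE_I2)
      fix y
      have lim: "(\<lambda>i. 1 / X (i + N)) \<longlonglongrightarrow> 1 / e" using X e by (intro tendsto_intros LIMSEQ_ignore_initial_segment) auto
      show "(\<lambda>i. moll_eps \<psi> (X (i + N)) (transpose g *v (x - z) - y)) \<longlonglongrightarrow> moll_eps \<psi> e (transpose g *v (x - z) - y)"
        unfolding moll_eps_def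
        by (rule tendsto_mult[OF tendsto_power[OF lim] continuous_on_tendsto_compose[OF \<psi>_cont tendsto_scaleR[OF lim tendsto_const]]]) auto
    qed
  qed simp_all
  then have "(\<lambda>i. kern g z (X i) x) \<longlonglongrightarrow> kern g z e x" by (rule LIMSEQ_offset)
  then show "((\<lambda>\<epsilon>. kern g z \<epsilon> x) \<circ> X) \<longlonglongrightarrow> kern g z e x" by (simp add: o_def)
qed

lemma integral_kern_continuous:
  assumes [measurable]: "f \<in> borel_measurable borel" and f: "AE x in \<mu>. \<bar>f x\<bar> \<le> K"
  shows "continuous_on {0<..} (\<lambda>\<epsilon>. \<integral>x. f x * kern g z \<epsilon> x \<partial>\<mu>)"
proof (subst continuous_on_sequentially, intro allI impI ballI)
  fix X :: "nat \<Rightarrow> real" and e :: real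
  assume e: "e \<in> {0<..}" and X: "(\<forall>i. X i \<in> {0<..}) \<and> X \<longlonglongrightarrow> e"
  have ev: "\<forall>\<^sub>F i in sequentially. e / 2 < X i" using X e by (intro order_tendstoD) auto
  define C where "C = \<bar>K\<bar> * ((2 / e) ^ CARD('n) * B * measure \<nu> UNIV)"
  obtain N where N: "\<And>i. e / 2 < X (i + N)" using ev unfolding eventually_sequentially by (metis le_add2)
  have "(\<lambda>i. \<integral>x. f x * kern g z (X (i + N)) x \<partial>\<mu>) \<longlonglongrightarrow> (\<integral>x. f x * kern g z e x \<partial>\<mu>)"
  proof (rule integral_dominated_convergence[where w="\<lambda>_. C"])
    fix i
    have Xi: "X (i + N) > 0" using X by auto
    have "(1 / X (i + N)) ^ CARD('n) * B * measure \<nu> UNIV \<le> (2 / e) ^ CARD('n) * B * measure \<nu> UNIV"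
      using N[of i] e Xi B0 by (intro mult_right_mono power_mono) (auto simp: field_simps)
    then have k: "\<bar>kern g z (X (i + N)) x\<bar> \<le> (2 / e) ^ CARD('n) * B * measure \<nu> UNIV" for x
      using kern_bounds[OF Xi, of g z x] by linarith
    from f show "AE x in \<mu>. norm (f x * kern g z (X (i + N)) x) \<le> C"
    proof eventually_elim
      case (elim x)
      then show ?case unfolding C_def real_norm_def abs_mult using k[of x] by (intro mult_mono) auto
    qed
  next
    show "AE x in \<mu>. (\<lambda>i. f x * kern g z (X (i + N)) x) \<longlonglongrightarrow> f x * kern g z e x"
      using X e by (intro AE_I2 tendsto_intros continuous_on_tendsto_compose[OF kern_continuous] LIMSEQ_ignore_initial_segment) auto
  qed simp_all
  then have "(\<lambda>i. \<integral>x. f x * kern g z (X i) x \<partial>\<mu>) \<longlonglongrightarrow> (\<integral>x. f x * kern g z e x \<partial>\<mu>)"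
    by (rule LIMSEQ_offset)
  then show "((\<lambda>\<epsilon>. \<integral>x. f x * kern g z \<epsilon> x \<partial>\<mu>) \<circ> X) \<longlonglongrightarrow> (\<integral>x. f x * kern g z e x \<partial>\<mu>)" by (simp add: o_def)
qed

text \<open>Measurability in the product is what turns a statement for almost every g and then
  almost every z into one about almost every pair.\<close>

lemma good_measurable: "{p. good (fst p) (snd p)} \<in> sets (borel \<Otimes>\<^sub>M borel)"
proof -
  have eq: "{p. good (fst p) (snd p)} = (\<Inter>bs\<in>lists Basis. {p \<in> space (borel \<Otimes>\<^sub>M borel).
    \<forall>k::nat. \<exists>m::nat. \<forall>q r :: rat. 0 < q \<longrightarrow> 0 < r \<longrightarrow> q < 1 / of_nat (Suc m) \<longrightarrow> r < 1 / of_nat (Suc m) \<longrightarrow>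
       \<bar>(\<integral>x. mon bs x * kern (fst p) (snd p) (of_rat q) x \<partial>\<mu>) - (\<integral>x. mon bs x * kern (fst p) (snd p) (of_rat r) x \<partial>\<mu>)\<bar> \<le> 1 / real (Suc k)})"
  proof (intro set_eqI)
    fix p :: "(real^'n^'n) \<times> (real^'n)"
    have "(\<exists>l. ((\<lambda>\<epsilon>. \<integral>x. mon bs x * kern (fst p) (snd p) \<epsilon> x \<partial>\<mu>) \<longlongrightarrow> l) (at_right 0)) \<longleftrightarrow>
      (\<forall>k::nat. \<exists>m::nat. \<forall>q r :: rat. 0 < q \<longrightarrow> 0 < r \<longrightarrow> q < 1 / of_nat (Suc m) \<longrightarrow> r < 1 / of_nat (Suc m) \<longrightarrow>
       \<bar>(\<integral>x. mon bs x * kern (fst p) (snd p) (of_rat q) x \<partial>\<mu>) - (\<integral>x. mon bs x * kern (fst p) (snd p) (of_rat r) x \<partial>\<mu>)\<bar> \<le> 1 / real (Suc k))" for bs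
    proof (rule convergent_at_right_iff_rat)
      obtain K where K: "\<And>x :: real^'n. norm x \<le> R \<Longrightarrow> \<bar>mon bs x\<bar> \<le> K" using mon_bounded by blast
      show "continuous_on {0<..} (\<lambda>\<epsilon>. \<integral>x. mon bs x * kern (fst p) (snd p) \<epsilon> x \<partial>\<mu>)"
        using R K by (intro integral_kern_continuous[where K=K]) (auto elim: eventually_mono)
    qed
    then show "p \<in> {p. good (fst p) (snd p)} \<longleftrightarrow> p \<in> (\<Inter>bs\<in>lists Basis. {p \<in> space (borel \<Otimes>\<^sub>M borel).
    \<forall>k::nat. \<exists>m::nat. \<forall>q r :: rat. 0 < q \<longrightarrow> 0 < r \<longrightarrow> q < 1 / of_nat (Suc m) \<longrightarrow> r < 1 / of_nat (Suc m) \<longrightarrow>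
       \<bar>(\<integral>x. mon bs x * kern (fst p) (snd p) (of_rat q) x \<partial>\<mu>) - (\<integral>x. mon bs x * kern (fst p) (snd p) (of_rat r) x \<partial>\<mu>)\<bar> \<le> 1 / real (Suc k)})"
      by (simp add: good_def space_pair_measure)
  qed
  have "countable (lists (Basis :: (real^'n) set))" by (simp add: countable_finite)
  moreover have "lists (Basis :: (real^'n) set) \<noteq> {}" by blast
  ultimately show ?thesis unfolding eq
    by (intro sets.countable_INT') (auto, measurable)
qed

text \<open>\<open>wproj_limit\<close> requires a bounded nonnegative weight, so the monomial is cut
  off to the ball carrying \<open>\<mu>\<close> and split into positive and negative parts.\<close>

lemma AE_good:
  assumes g: "orthogonal_matrix g" and ac: "absolutely_continuous lborel (proj g)"
  shows "AE z in lborel. good g z"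
proof -
  have "AE z in lborel. \<exists>l. ((\<lambda>\<epsilon>. \<integral>x. mon bs x * kern g z \<epsilon> x \<partial>\<mu>) \<longlongrightarrow> l) (at_right 0)" for bs
  proof -
    obtain K where K: "\<And>x :: real^'n. norm x \<le> R \<Longrightarrow> \<bar>mon bs x\<bar> \<le> K" using mon_bounded by blast
    have K0: "K \<ge> 0" using K[of 0] R0 by simp
    define P where "P x = indicator (cball 0 R) x * max (mon bs x) 0" for x :: "real^'n"
    define Q where "Q x = indicator (cball 0 R) x * max (- mon bs x) 0" for x :: "real^'n"
    have [measurable]: "P \<in> borel_measurable borel" "Q \<in> borel_measurable borel" unfolding P_def Q_def by measurable
    have PQ: "0 \<le> P x" "P x \<le> K" "0 \<le> Q x" "Q x \<le> K" for x
      using K[of x] K0 by (auto simp: P_def Q_def indicator_def)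
    have diff: "(\<integral>x. mon bs x * kern g z \<epsilon> x \<partial>\<mu>) = (\<integral>x. P x * kern g z \<epsilon> x \<partial>\<mu>) - (\<integral>x. Q x * kern g z \<epsilon> x \<partial>\<mu>)" if e: "\<epsilon> > 0" for z \<epsilon>
    proof -
      have "(\<integral>x. P x * kern g z \<epsilon> x \<partial>\<mu>) - (\<integral>x. Q x * kern g z \<epsilon> x \<partial>\<mu>) = (\<integral>x. P x * kern g z \<epsilon> x - Q x * kern g z \<epsilon> x \<partial>\<mu>)"
        using PQ e by (intro Bochner_Integration.integral_diff[symmetric] kern_f_integrable[where K=K]) auto
      also have "\<dots> = (\<integral>x. mon bs x * kern g z \<epsilon> x \<partial>\<mu>)"
      proof (rule integral_cong_AE)
        show "AE x in \<mu>. P x * kern g z \<epsilon> x - Q x * kern g z \<epsilon> x = mon bs x * kern g z \<epsilon> x"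
          using R
        proof eventually_elim
          case (elim x)
          have "P x - Q x = mon bs x" using elim by (auto simp: P_def Q_def max_def)
          then show ?case by (metis left_diff_distrib)
        qed
      qed measurable
      finally show ?thesis by simp
    qed
    have ex: "\<exists>h. AE z in lborel. ((\<lambda>\<epsilon>. \<integral>x. f x * kern g z \<epsilon> x \<partial>\<mu>) \<longlongrightarrow> h z) (at_right 0)"
      if "f \<in> borel_measurable borel" "\<And>x. 0 \<le> f x" "\<And>x. f x \<le> K" for f
      by (rule wproj_limit[OF g ac that]) (rule exI)
    obtain hP where hP: "AE z in lborel. ((\<lambda>\<epsilon>. \<integral>x. P x * kern g z \<epsilon> x \<partial>\<mu>) \<longlongrightarrow> hP z) (at_right 0)"
      using ex[of P] PQ by auto
    obtain hQ where hQ: "AE z in lborel. ((\<lambda>\<epsilon>. \<integral>x. Q x * kern g z \<epsilon> x \<partial>\<mu>) \<longlongrightarrow> hQ z) (at_right 0)"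
      using ex[of Q] PQ by auto
    note h = hP hQ
    from h show ?thesis
    proof eventually_elim
      case (elim z)
      have "((\<lambda>\<epsilon>. (\<integral>x. P x * kern g z \<epsilon> x \<partial>\<mu>) - (\<integral>x. Q x * kern g z \<epsilon> x \<partial>\<mu>)) \<longlongrightarrow> hP z - hQ z) (at_right 0)"
        by (intro tendsto_intros elim)
      moreover have "\<forall>\<^sub>F \<epsilon> in at_right 0. (\<integral>x. P x * kern g z \<epsilon> x \<partial>\<mu>) - (\<integral>x. Q x * kern g z \<epsilon> x \<partial>\<mu>) = (\<integral>x. mon bs x * kern g z \<epsilon> x \<partial>\<mu>)"
        using eventually_at_right_less[of 0] by eventually_elim (simp add: diff)
      ultimately show ?case by (blast intro: Lim_transform_eventually)
    qed
  qed
  then show ?thesis unfolding good_def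
    by (subst AE_ball_countable) (auto simp: countable_finite)
qed

lemma good_mspan:
  assumes gd: "good g z" and p: "mspan p"
  shows "\<exists>l. ((\<lambda>\<epsilon>. \<integral>x. p x * kern g z \<epsilon> x \<partial>\<mu>) \<longlongrightarrow> l) (at_right 0)"
  using p
proof (induction rule: mspan.induct)
  case (mspan_mon bs)
  then show ?case using gd by (auto simp: good_def)
next
  case (mspan_add f h)
  have int: "integrable \<mu> (\<lambda>x. q x * kern g z \<epsilon> x)" if q: "mspan q" and e: "\<epsilon> > 0" for q \<epsilon>
  proof -
    have qc: "continuous_on S q" for S using q by (rule continuous_on_mspan)
    have "compact (q ` cball 0 R)" by (intro compact_continuous_image qc compact_cball)
    then obtain K where "\<forall>y\<in>q ` cball 0 R. norm y \<le> K" using compact_imp_bounded bounded_iff by metis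
    then have "AE x in \<mu>. \<bar>q x\<bar> \<le> K" using R by (auto elim!: eventually_mono)
    then show ?thesis using e qc by (intro kern_f_integrable borel_measurable_continuous_onI)
  qed
  obtain l1 l2 where l: "((\<lambda>\<epsilon>. \<integral>x. f x * kern g z \<epsilon> x \<partial>\<mu>) \<longlongrightarrow> l1) (at_right 0)" "((\<lambda>\<epsilon>. \<integral>x. h x * kern g z \<epsilon> x \<partial>\<mu>) \<longlongrightarrow> l2) (at_right 0)"
    using mspan_add.IH by blast
  then have "((\<lambda>\<epsilon>. (\<integral>x. f x * kern g z \<epsilon> x \<partial>\<mu>) + (\<integral>x. h x * kern g z \<epsilon> x \<partial>\<mu>)) \<longlongrightarrow> l1 + l2) (at_right 0)"
    by (intro tendsto_intros)
  moreover have "\<forall>\<^sub>F \<epsilon> in at_right 0. (\<integral>x. f x * kern g z \<epsilon> x \<partial>\<mu>) + (\<integral>x. h x * kern g z \<epsilon> x \<partial>\<mu>) = (\<integral>x. (f x + h x) * kern g z \<epsilon> x \<partial>\<mu>)"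
    using eventually_at_right_less[of 0]
    by eventually_elim (simp add: distrib_right int mspan_add.hyps)
  ultimately show ?case by (blast intro: Lim_transform_eventually)
next
  case (mspan_scale f c)
  then obtain l where "((\<lambda>\<epsilon>. \<integral>x. f x * kern g z \<epsilon> x \<partial>\<mu>) \<longlongrightarrow> l) (at_right 0)" by blast
  then have "((\<lambda>\<epsilon>. c * (\<integral>x. f x * kern g z \<epsilon> x \<partial>\<mu>)) \<longlongrightarrow> c * l) (at_right 0)" by (intro tendsto_intros)
  then show ?case by (auto simp: mult.assoc)
qed

end

section \<open>Limits of the slices\<close>

context moll_pair
begin

lemma integral_slice_real:
  fixes f :: "real^'n \<Rightarrow> real"
  assumes "\<epsilon> > 0" "f \<in> borel_measurable borel"
  shows "(\<integral>x. f x \<partial>slice g z \<epsilon>) = (\<integral>x. f x * kern g z \<epsilon> x \<partial>\<mu>)"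
  using integral_slice[OF assms] by (simp add: mult.commute)

text \<open>Weak compactness supplies a candidate along a subsequence of the scales
  \<open>1 / Suc j\<close>. By \<open>good_mspan\<close> the integrals of polynomials converge along
  all scales, so their limits must be given by the candidate, and uniform approximation on the ball
  extends this to continuous functions.\<close>

lemma good_slice_limit:
  assumes gd: "good g z"
  obtains \<Lambda> where "finite_measure \<Lambda>" "sets \<Lambda> = sets borel"
    "\<And>f :: real^'n \<Rightarrow> real. continuous_on UNIV f \<Longrightarrow> bounded (range f) \<Longrightarrow>
       ((\<lambda>\<epsilon>. \<integral>x. f x \<partial>slice g z \<epsilon>) \<longlongrightarrow> (\<integral>x. f x \<partial>\<Lambda>)) (at_right 0)"
proof -
  let ?e = "\<lambda>j. 1 / real (Suc j)"
  have epos: "?e j > 0" for j by simp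
  have fin: "finite_measure (slice g z (?e j))" for j by (rule finite_slice[OF epos])
  have seq: "(\<lambda>j. F (?e j)) \<longlonglongrightarrow> l" if "(F \<longlongrightarrow> l) (at_right 0)" for F :: "real \<Rightarrow> real" and l
    using filterlim_compose[OF that tendsto_at_right_0_sequentially] .
  have ev: "\<forall>\<^sub>F \<epsilon> in at_right (0::real). 0 < \<epsilon>" using eventually_at_right_less[of 0] .
  have mass: "measure (slice g z \<epsilon>) UNIV = (\<integral>x. mon [] x * kern g z \<epsilon> x \<partial>\<mu>)" if "\<epsilon> > 0" for \<epsilon>
    using integral_slice_real[OF that, of "\<lambda>_. 1" g z] by simp
  obtain m where m0: "((\<lambda>\<epsilon>. \<integral>x. mon [] x * kern g z \<epsilon> x \<partial>\<mu>) \<longlongrightarrow> m) (at_right 0)"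
    using gd unfolding good_def by (metis lists.Nil)
  have m1: "((\<lambda>\<epsilon>. measure (slice g z \<epsilon>) UNIV) \<longlongrightarrow> m) (at_right 0)"
    using m0 by (rule Lim_transform_eventually) (use ev in \<open>eventually_elim, simp only: mass\<close>)
  obtain r \<Lambda> where r: "strict_mono (r :: nat \<Rightarrow> nat)" and L: "finite_measure \<Lambda>" "sets \<Lambda> = sets borel"
    and conv: "\<And>f :: real^'n \<Rightarrow> real. continuous_on UNIV f \<Longrightarrow> bounded (range f) \<Longrightarrow> (\<lambda>j. \<integral>x. f x \<partial>slice g z (?e (r j))) \<longlonglongrightarrow> (\<integral>x. f x \<partial>\<Lambda>)"
    using weak_compactness[of "\<lambda>j. slice g z (?e j)" R m] fin AE_slice[OF R] seq[OF m1] sets_slice by metis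
  interpret L: finite_measure \<Lambda> by fact
  note L(2)[measurable_cong]
  have spL[simp]: "space \<Lambda> = UNIV" using sets_eq_imp_space_eq[OF L(2)] by simp
  \<comment> \<open>Polynomials are unbounded, and \<open>\<Lambda>\<close> is not yet known to be
    carried by the ball. Composition with the nearest-point map makes them bounded and continuous
    without changing integrals over the slices.\<close>
  define cl where "cl = closest_point (cball (0::real^'n) R)"
  have clc: "continuous_on UNIV cl" unfolding cl_def using R0 by (intro continuous_on_closest_point) auto
  have clin: "cl x \<in> cball 0 R" for x unfolding cl_def using R0 by (intro closest_point_in_set) auto
  have clid: "norm x \<le> R \<Longrightarrow> cl x = x" for x unfolding cl_def by (intro closest_point_self) simp
  have bd: "bounded (range (\<lambda>x. f (cl x)))" if "continuous_on UNIV f" for f :: "real^'n \<Rightarrow> real"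
  proof -
    have "compact (f ` cball 0 R)" using that by (intro compact_continuous_image continuous_on_subset[OF that]) auto
    then show ?thesis by (rule bounded_subset[OF compact_imp_bounded]) (use clin in auto)
  qed
  have ccl: "continuous_on UNIV (\<lambda>x. f (cl x))" if "continuous_on UNIV f" for f :: "real^'n \<Rightarrow> real"
    using that clc by (rule continuous_on_compose2) auto
  have cl_int: "(\<integral>x. f (cl x) \<partial>slice g z \<epsilon>) = (\<integral>x. f x \<partial>slice g z \<epsilon>)" if f: "continuous_on UNIV f" for f :: "real^'n \<Rightarrow> real" and \<epsilon>
  proof (rule integral_cong_AE)
    show "AE x in slice g z \<epsilon>. f (cl x) = f x"
      using AE_slice[OF R] by eventually_elim (simp add: clid)
    show "(\<lambda>x. f (cl x)) \<in> borel_measurable (slice g z \<epsilon>)" "f \<in> borel_measurable (slice g z \<epsilon>)"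
      using borel_measurable_continuous_onI[OF ccl[OF f]] borel_measurable_continuous_onI[OF f] by (auto cong: measurable_cong_sets)
  qed
  have poly: "((\<lambda>\<epsilon>. \<integral>x. p x \<partial>slice g z \<epsilon>) \<longlongrightarrow> (\<integral>x. p (cl x) \<partial>\<Lambda>)) (at_right 0)" if "real_polynomial_function p" for p
  proof -
    have p: "mspan p" "continuous_on UNIV p" using mspan_poly[OF that] continuous_on_mspan by auto
    obtain l where "((\<lambda>\<epsilon>. \<integral>x. p x * kern g z \<epsilon> x \<partial>\<mu>) \<longlongrightarrow> l) (at_right 0)" using good_mspan[OF gd p(1)] by blast
    then have l: "((\<lambda>\<epsilon>. \<integral>x. p x \<partial>slice g z \<epsilon>) \<longlongrightarrow> l) (at_right 0)"
      by (rule Lim_transform_eventually)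
         (use ev in \<open>eventually_elim, simp only: integral_slice_real borel_measurable_continuous_onI[OF p(2)]\<close>)
    have "(\<lambda>j. \<integral>x. p x \<partial>slice g z (?e (r j))) \<longlonglongrightarrow> l"
      using LIMSEQ_subseq_LIMSEQ[OF seq[OF l] r] by (simp add: o_def)
    moreover have "(\<lambda>j. \<integral>x. p x \<partial>slice g z (?e (r j))) \<longlonglongrightarrow> (\<integral>x. p (cl x) \<partial>\<Lambda>)"
      using conv[OF ccl bd, OF p(2) p(2)] unfolding cl_int[OF p(2)] .
    ultimately have "l = (\<integral>x. p (cl x) \<partial>\<Lambda>)" by (rule LIMSEQ_unique)
    then show ?thesis using l by simp
  qed
  have main: "((\<lambda>\<epsilon>. \<integral>x. f x \<partial>slice g z \<epsilon>) \<longlongrightarrow> (\<integral>x. f (cl x) \<partial>\<Lambda>)) (at_right 0)" if f: "continuous_on UNIV f" for f :: "real^'n \<Rightarrow> real"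
  proof (rule tendstoI)
    fix e :: real assume e: "e > 0"
    \<comment> \<open>Bounds the mass of the slices for small \<open>\<epsilon>\<close> plus that of
      \<open>\<Lambda>\<close>, so replacing \<open>f\<close> by a polynomial costs at most
      \<open>\<delta> * C = e / 2\<close> in total.\<close>
    define C where "C = \<bar>m\<bar> + 1 + measure \<Lambda> UNIV"
    have C: "C > 0" using measure_nonneg[of \<Lambda> UNIV] unfolding C_def by linarith
    define \<delta> where "\<delta> = e / (2 * C)"
    have \<delta>: "\<delta> > 0" using e C by (simp add: \<delta>_def)
    obtain p where p: "real_polynomial_function p" "\<And>x. x \<in> cball 0 R \<Longrightarrow> \<bar>f x - p x\<bar> < \<delta>"
      using Stone_Weierstrass_real_polynomial_function[of "cball 0 R" f \<delta>] \<delta> continuous_on_subset[OF f] by auto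
    have pc: "continuous_on UNIV p" using continuous_on_mspan[OF mspan_poly[OF p(1)]] .
    have 1: "\<forall>\<^sub>F \<epsilon> in at_right 0. dist (\<integral>x. p x \<partial>slice g z \<epsilon>) (\<integral>x. p (cl x) \<partial>\<Lambda>) < e / 2"
      using e by (intro tendstoD[OF poly[OF p(1)]]) auto
    have 2: "\<forall>\<^sub>F \<epsilon> in at_right 0. measure (slice g z \<epsilon>) UNIV < \<bar>m\<bar> + 1"
      by (rule order_tendstoD[OF m1]) simp
    have diff: "\<bar>(\<integral>x. f (cl x) \<partial>M) - (\<integral>x. p (cl x) \<partial>M)\<bar> \<le> \<delta> * measure M UNIV"
      if M: "finite_measure M" "sets M = sets borel" for M :: "(real^'n) measure"
    proof -
      interpret M: finite_measure M by fact
      note M(2)[measurable_cong]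
      have sp: "space M = UNIV" using sets_eq_imp_space_eq[OF M(2)] by simp
      have i: "integrable M (\<lambda>x. h (cl x))" if h: "continuous_on UNIV h" for h :: "real^'n \<Rightarrow> real"
      proof -
        obtain K where "\<And>x. norm (h (cl x)) \<le> K" using bd[OF h] by (auto simp: bounded_iff)
        moreover have "(\<lambda>x. h (cl x)) \<in> borel_measurable M" using borel_measurable_continuous_onI[OF ccl[OF h]] by measurable
        ultimately show ?thesis by (intro M.integrable_const_bound[where B=K]) auto
      qed
      have "\<bar>(\<integral>x. f (cl x) \<partial>M) - (\<integral>x. p (cl x) \<partial>M)\<bar> = \<bar>\<integral>x. f (cl x) - p (cl x) \<partial>M\<bar>"
        using i f pc by (simp add: Bochner_Integration.integral_diff)
      also have "\<dots> \<le> (\<integral>x. \<bar>f (cl x) - p (cl x)\<bar> \<partial>M)" by (rule integral_abs_bound)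
      also have "\<dots> \<le> (\<integral>x. \<delta> \<partial>M)"
        using i f pc p(2)[OF clin] by (intro integral_mono integrable_abs Bochner_Integration.integrable_diff) (auto intro: less_imp_le)
      finally show ?thesis by (simp add: sp mult.commute)
    qed
    show "\<forall>\<^sub>F \<epsilon> in at_right 0. dist (\<integral>x. f x \<partial>slice g z \<epsilon>) (\<integral>x. f (cl x) \<partial>\<Lambda>) < e"
      using 1 2 ev
    proof eventually_elim
      case (elim \<epsilon>)
      have d1: "\<bar>(\<integral>x. f x \<partial>slice g z \<epsilon>) - (\<integral>x. p x \<partial>slice g z \<epsilon>)\<bar> \<le> \<delta> * measure (slice g z \<epsilon>) UNIV"
        using diff[OF finite_slice[OF elim(3)] sets_slice, of g z] unfolding cl_int[OF f] cl_int[OF pc] .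
      have d2: "\<delta> * measure (slice g z \<epsilon>) UNIV \<le> \<delta> * (\<bar>m\<bar> + 1)" using elim(2) \<delta> by (intro mult_left_mono) auto
      have d3: "\<bar>(\<integral>x. f (cl x) \<partial>\<Lambda>) - (\<integral>x. p (cl x) \<partial>\<Lambda>)\<bar> \<le> \<delta> * measure \<Lambda> UNIV" by (rule diff[OF L])
      have d4: "\<delta> * (\<bar>m\<bar> + 1) + \<delta> * measure \<Lambda> UNIV = e / 2"
      proof -
        have "\<delta> * (\<bar>m\<bar> + 1) + \<delta> * measure \<Lambda> UNIV = \<delta> * C" by (simp only: C_def distrib_left)
        also have "\<dots> = e / 2" using C by (simp add: \<delta>_def)
        finally show ?thesis .
      qed
      show ?case using d1 d2 d3 d4 elim(1) unfolding dist_real_def by linarith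
    qed
  qed
  show thesis
  proof (rule that[OF L])
    fix f :: "real^'n \<Rightarrow> real" assume f: "continuous_on UNIV f" "bounded (range f)"
    \<comment> \<open>For bounded \<open>f\<close> the compactness statement applies to
      \<open>f\<close> itself; comparing the two limits along the subsequence removes
      \<open>cl\<close>.\<close>
    have "(\<lambda>j. \<integral>x. f x \<partial>slice g z (?e (r j))) \<longlonglongrightarrow> (\<integral>x. f (cl x) \<partial>\<Lambda>)"
      using LIMSEQ_subseq_LIMSEQ[OF seq[OF main[OF f(1)]] r] by (simp add: o_def)
    then have "(\<integral>x. f (cl x) \<partial>\<Lambda>) = (\<integral>x. f x \<partial>\<Lambda>)" using conv[OF f] by (rule LIMSEQ_unique)
    then show "((\<lambda>\<epsilon>. \<integral>x. f x \<partial>slice g z \<epsilon>) \<longlongrightarrow> (\<integral>x. f x \<partial>\<Lambda>)) (at_right 0)" using main[OF f(1)] by simp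
  qed
qed

text \<open>The test function is the positive part of \<open>r - dist x y\<close>: it is continuous
  and bounded, and positive exactly on the open ball.\<close>

lemma slice_limit_null_ball:
  assumes L: "finite_measure \<Lambda>" "sets \<Lambda> = sets borel"
    and conv: "\<And>f :: real^'n \<Rightarrow> real. continuous_on UNIV f \<Longrightarrow> bounded (range f) \<Longrightarrow>
       ((\<lambda>\<epsilon>. \<integral>x. f x \<partial>slice g z \<epsilon>) \<longlongrightarrow> (\<integral>x. f x \<partial>\<Lambda>)) (at_right 0)"
    and r: "r > 0" and null: "\<forall>\<^sub>F \<epsilon> in at_right 0. AE y in slice g z \<epsilon>. y \<notin> ball x r"
  shows "emeasure \<Lambda> (ball x r) = 0"
proof -
  interpret L: finite_measure \<Lambda> by fact
  note L(2)[measurable_cong]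
  define f where "f y = max 0 (r - dist x y)" for y
  have f: "continuous_on UNIV f" unfolding f_def by (intro continuous_intros)
  have fb: "0 \<le> f y" "f y \<le> r" for y using r by (auto simp: f_def)
  have bf: "bounded (range f)" using fb by (auto simp: bounded_iff intro!: exI[of _ r])
  have [measurable]: "f \<in> borel_measurable borel" using f by (rule borel_measurable_continuous_onI)
  have "\<forall>\<^sub>F \<epsilon> in at_right 0. 0 = (\<integral>y. f y \<partial>slice g z \<epsilon>)"
    using null
  proof eventually_elim
    case (elim \<epsilon>)
    then have "AE y in slice g z \<epsilon>. f y = 0" by eventually_elim (auto simp: f_def)
    then have "(\<integral>y. f y \<partial>slice g z \<epsilon>) = (\<integral>y. 0 \<partial>slice g z \<epsilon>)" by (intro integral_cong_AE) auto
    then show ?case by simp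
  qed
  then have "((\<lambda>\<epsilon>. \<integral>y. f y \<partial>slice g z \<epsilon>) \<longlongrightarrow> 0) (at_right 0)"
    by (rule Lim_transform_eventually[OF tendsto_const])
  then have "(\<integral>y. f y \<partial>\<Lambda>) = 0" using conv[OF f bf] by (intro tendsto_unique[of "at_right (0::real)"]) auto
  moreover have "integrable \<Lambda> f" using fb by (intro L.integrable_const_bound[where B=r]) auto
  ultimately have "AE y in \<Lambda>. f y = 0" using fb by (subst (asm) integral_nonneg_eq_0_iff_AE) auto
  then have "AE y in \<Lambda>. y \<notin> ball x r" by eventually_elim (auto simp: f_def)
  then show ?thesis by (subst (asm) AE_iff_measurable[of "ball x r"]) (auto simp: L(2) sets_eq_imp_space_eq[OF L(2)])
qed

lemma spt_slice_limit:
  assumes g: "orthogonal_matrix g"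
    and L: "finite_measure \<Lambda>" "sets \<Lambda> = sets borel"
    and conv: "\<And>f :: real^'n \<Rightarrow> real. continuous_on UNIV f \<Longrightarrow> bounded (range f) \<Longrightarrow>
       ((\<lambda>\<epsilon>. \<integral>x. f x \<partial>slice g z \<epsilon>) \<longlongrightarrow> (\<integral>x. f x \<partial>\<Lambda>)) (at_right 0)"
  shows "spt \<Lambda> \<subseteq> spt \<mu> \<inter> (\<lambda>x. g *v x + z) ` spt \<nu>"
proof
  fix x assume x: "x \<in> spt \<Lambda>"
  have "x \<in> spt \<mu>"
  proof (rule ccontr)
    assume "x \<notin> spt \<mu>"
    then obtain r where r: "r > 0" "emeasure \<mu> (ball x r) = 0" by (auto simp: spt_def)
    then have "AE y in \<mu>. y \<notin> ball x r" by (intro AE_I[where N="ball x r"]) (auto simp: sets_mu)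
    then have "AE y in slice g z \<epsilon>. y \<notin> ball x r" for \<epsilon> by (rule AE_slice)
    then have ev: "\<forall>\<^sub>F \<epsilon> in at_right 0. AE y in slice g z \<epsilon>. y \<notin> ball x r" by simp
    have "emeasure \<Lambda> (ball x r) = 0" by (rule slice_limit_null_ball[OF L conv r(1) ev])
    then show False using x r by (auto simp: spt_def)
  qed
  moreover have "transpose g *v (x - z) \<in> spt \<nu>"
  proof (rule ccontr)
    let ?v = "transpose g *v (x - z)"
    assume "?v \<notin> spt \<nu>"
    then obtain r where r: "r > 0" "emeasure \<nu> (ball ?v r) = 0" by (auto simp: spt_def)
    then have AEn: "AE y in \<nu>. y \<notin> ball ?v r" by (intro AE_I[where N="ball ?v r"]) (auto simp: sets_nu)
    \<comment> \<open>Half of \<open>r\<close> is spent on the distance of \<open>x'\<close> from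
      \<open>x\<close>, half on the radius of the mollifier, which then stays inside the
      \<open>\<nu>\<close>-null ball.\<close>
    have "\<forall>\<^sub>F \<epsilon> in at_right (0::real). 0 < \<epsilon> \<and> \<epsilon> < r / 2"
      using r eventually_at_right_real[of 0 "r / 2"] by (auto elim: eventually_mono)
    then have "\<forall>\<^sub>F \<epsilon> in at_right 0. AE y in slice g z \<epsilon>. y \<notin> ball x (r / 2)"
    proof eventually_elim
      case (elim \<epsilon>)
      have k: "kern g z \<epsilon> x' = 0" if x': "x' \<in> ball x (r / 2)" for x'
      proof -
        have "AE y in \<nu>. moll_eps \<psi> \<epsilon> (transpose g *v (x' - z) - y) = 0"
          using AEn
        proof eventually_elim
          case (elim y)
          have "?v - transpose g *v (x' - z) = transpose g *v (x - x')"
            by (simp flip: matrix_vector_mult_diff_distrib)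
          then have d: "norm (?v - transpose g *v (x' - z)) < r / 2"
            using x' by (simp add: orthogonal_matrix_mult_vec[OF g] dist_norm)
          have "r \<le> norm (?v - y)" using elim by (simp add: dist_norm)
          also have "\<dots> \<le> norm (?v - transpose g *v (x' - z)) + norm (transpose g *v (x' - z) - y)"
            using norm_triangle_ineq[of "?v - transpose g *v (x' - z)" "transpose g *v (x' - z) - y"] by simp
          finally have "norm (transpose g *v (x' - z) - y) > \<epsilon>" using d \<open>0 < \<epsilon> \<and> \<epsilon> < r / 2\<close> by linarith
          then have "norm ((1 / \<epsilon>) *\<^sub>R (transpose g *v (x' - z) - y)) > 1" using \<open>0 < \<epsilon> \<and> \<epsilon> < r / 2\<close> unfolding norm_scaleR by simp
          then show ?case unfolding moll_eps_def by (simp only: \<psi>_supp mult_zero_right)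
        qed
        then have "kern g z \<epsilon> x' = (\<integral>y. 0 \<partial>\<nu>)" unfolding kern_def by (intro integral_cong_AE) auto
        then show ?thesis by simp
      qed
      have "AE x' in \<mu>. 0 < ennreal (kern g z \<epsilon> x') \<longrightarrow> x' \<notin> ball x (r / 2)"
        by (rule AE_I2) (auto simp del: mem_ball simp: k)
      then show ?case unfolding slice_def by (subst AE_density) auto
    qed
    then have "emeasure \<Lambda> (ball x (r / 2)) = 0"
      using r(1) by (intro slice_limit_null_ball[OF L conv]) auto
    moreover have "emeasure \<Lambda> (ball x (r / 2)) > 0" using x r(1) by (auto simp: spt_def)
    ultimately show False by simp
  qed
  then have "x \<in> (\<lambda>x. g *v x + z) ` spt \<nu>"
    by (intro image_eqI[of _ _ "transpose g *v (x - z)"]) (simp_all add: orthogonal_matrix_mult_vec[OF g])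
  ultimately show "x \<in> spt \<mu> \<inter> (\<lambda>x. g *v x + z) ` spt \<nu>" by blast
qed

text \<open>Fatou's lemma on the Fourier side.\<close>

lemma energy_slice_limit_le:
  assumes L: "finite_measure \<Lambda>" "sets \<Lambda> = sets borel"
    and conv: "\<And>f :: real^'n \<Rightarrow> real. continuous_on UNIV f \<Longrightarrow> bounded (range f) \<Longrightarrow>
       ((\<lambda>\<epsilon>. \<integral>x. f x \<partial>slice g z \<epsilon>) \<longlongrightarrow> (\<integral>x. f x \<partial>\<Lambda>)) (at_right 0)"
    and b: "b > 0" and en: "\<And>M :: (real^'n) measure. finite_measure M \<Longrightarrow> sets M = sets borel \<Longrightarrow>
       riesz_energy u M = ennreal b * (\<integral>\<^sup>+\<xi>. rk p \<xi> * ennreal ((cmod (four M \<xi>))\<^sup>2) \<partial>lborel)"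
  shows "riesz_energy u \<Lambda> \<le> liminf (\<lambda>j. riesz_energy u (slice g z (1 / real (Suc j))))"
proof -
  let ?S = "\<lambda>j. slice g z (1 / real (Suc j))"
  have ReIm: "four M \<xi> = Complex (\<integral>x. cos (\<xi> \<bullet> x) \<partial>M) (\<integral>x. sin (\<xi> \<bullet> x) \<partial>M)"
    if M: "finite_measure M" "sets M = sets borel" for M :: "(real^'n) measure" and \<xi>
  proof -
    interpret M: finite_measure M by fact
    note M(2)[measurable_cong]
    have i: "integrable M (\<lambda>x. cis (\<xi> \<bullet> x))" by (intro M.integrable_const_bound[where B=1]) auto
    show ?thesis unfolding four_def using integral_Re[OF i] integral_Im[OF i] by (intro complex_eqI) auto
  qed
  have fS: "finite_measure (?S j)" for j by (rule finite_slice) simp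
  have lim: "(\<lambda>j. four (?S j) \<xi>) \<longlonglongrightarrow> four \<Lambda> \<xi>" for \<xi>
  proof -
    have "(\<lambda>j. \<integral>x. cos (\<xi> \<bullet> x) \<partial>?S j) \<longlonglongrightarrow> (\<integral>x. cos (\<xi> \<bullet> x) \<partial>\<Lambda>)"
      by (rule filterlim_compose[OF conv tendsto_at_right_0_sequentially])
         (auto intro!: continuous_intros simp: bounded_iff intro: exI[of _ 1])
    moreover have "(\<lambda>j. \<integral>x. sin (\<xi> \<bullet> x) \<partial>?S j) \<longlonglongrightarrow> (\<integral>x. sin (\<xi> \<bullet> x) \<partial>\<Lambda>)"
      by (rule filterlim_compose[OF conv tendsto_at_right_0_sequentially])
         (auto intro!: continuous_intros simp: bounded_iff intro: exI[of _ 1])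
    ultimately show ?thesis unfolding ReIm[OF L] ReIm[OF fS sets_slice] by (rule tendsto_Complex)
  qed
  note four_measurable[OF fS sets_slice, measurable]
  have en': "riesz_energy u M = (\<integral>\<^sup>+\<xi>. ennreal b * (rk p \<xi> * ennreal ((cmod (four M \<xi>))\<^sup>2)) \<partial>lborel)"
    if M: "finite_measure M" "sets M = sets borel" for M :: "(real^'n) measure"
  proof -
    note four_measurable[OF M, measurable]
    show ?thesis unfolding en[OF M] by (rule nn_integral_cmult[symmetric]) measurable
  qed
  have "riesz_energy u \<Lambda> \<le> (\<integral>\<^sup>+\<xi>. liminf (\<lambda>j. ennreal b * (rk p \<xi> * ennreal ((cmod (four (?S j) \<xi>))\<^sup>2))) \<partial>lborel)"
    unfolding en'[OF L]
  \<comment> \<open>At frequency 0 the kernel is infinite and multiplication by it is not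
    continuous; the point is a null set.\<close>
  proof (rule nn_integral_mono_AE, use AE_lborel_singleton[of "0::real^'n"] in eventually_elim)
    case (elim \<xi>)
    have "(\<lambda>j. ennreal (\<bar>b\<bar> * (norm \<xi> powr (-p) * (cmod (four (?S j) \<xi>))\<^sup>2))) \<longlonglongrightarrow> ennreal (\<bar>b\<bar> * (norm \<xi> powr (-p) * (cmod (four \<Lambda> \<xi>))\<^sup>2))"
      by (intro tendsto_intros lim)
    then have "(\<lambda>j. ennreal b * (rk p \<xi> * ennreal ((cmod (four (?S j) \<xi>))\<^sup>2))) \<longlonglongrightarrow> ennreal b * (rk p \<xi> * ennreal ((cmod (four \<Lambda> \<xi>))\<^sup>2))"
      using elim b by (simp add: rk_def ennreal_mult)
    then have "liminf (\<lambda>j. ennreal b * (rk p \<xi> * ennreal ((cmod (four (?S j) \<xi>))\<^sup>2))) = ennreal b * (rk p \<xi> * ennreal ((cmod (four \<Lambda> \<xi>))\<^sup>2))"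
      by (intro lim_imp_Liminf) auto
    then show ?case by simp
  qed
  also have "\<dots> \<le> liminf (\<lambda>j. \<integral>\<^sup>+\<xi>. ennreal b * (rk p \<xi> * ennreal ((cmod (four (?S j) \<xi>))\<^sup>2)) \<partial>lborel)"
    by (rule nn_integral_liminf) measurable
  finally show ?thesis unfolding en'[OF fS sets_slice] .
qed

end

text \<open>The complement of the support is covered by null balls, countably many of which suffice
  by Lindelof's theorem. Hence the measure is carried by its compact support.\<close>

lemma cs_radon_finite:
  fixes M :: "'a::euclidean_space measure"
  assumes "cs_radon M"
  shows "finite_measure M" "sets M = sets borel" "\<exists>R\<ge>0. AE x in M. norm x \<le> R"
proof -
  show s: "sets M = sets borel" using assms by (simp add: cs_radon_def radon_measure_def)
  have K: "compact (spt M)" "\<And>K. compact K \<Longrightarrow> emeasure M K < \<infinity>" using assms by (auto simp: cs_radon_def radon_measure_def)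
  define \<F> where "\<F> = {ball x r |x r. 0 < r \<and> emeasure M (ball x r) = 0}"
  have "\<And>S. S \<in> \<F> \<Longrightarrow> open S" by (auto simp: \<F>_def)
  then obtain \<F>' where F': "\<F>' \<subseteq> \<F>" "countable \<F>'" "\<Union>\<F>' = \<Union>\<F>" by (rule Lindelof)
  have "(\<Union>S\<in>\<F>'. S) \<in> null_sets M"
    using F' by (intro null_sets_UN') (auto simp: \<F>_def null_sets_def s)
  then have "\<Union>\<F> \<in> null_sets M" using F'(3) by simp
  moreover have "- spt M \<subseteq> \<Union>\<F>"
  proof
    fix x assume "x \<in> - spt M"
    then obtain r where "r > 0" "emeasure M (ball x r) = 0" by (auto simp: spt_def)
    then show "x \<in> \<Union>\<F>" by (intro UnionI[of "ball x r"]) (auto simp: \<F>_def)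
  qed
  ultimately have ae: "AE x in M. x \<in> spt M" by (intro AE_I'[of "\<Union>\<F>"]) auto
  have "spt M \<in> sets M" using K(1) s by (auto intro: borel_compact)
  then have "emeasure M (space M) = emeasure M (spt M)"
    using ae by (intro emeasure_eq_AE) auto
  then show "finite_measure M" using K(2)[OF K(1)] by (intro finite_measureI) auto
  obtain R where "\<forall>x\<in>spt M. norm x \<le> R" using compact_imp_bounded[OF K(1)] by (auto simp: bounded_iff)
  then have "AE x in M. norm x \<le> max R 0" using ae by (auto elim!: eventually_mono)
  then show "\<exists>R\<ge>0. AE x in M. norm x \<le> R" by (intro exI[of _ "max R 0"]) auto
qed

section \<open>The slicing theorem\<close>

lemma (in moll_pair) energy_slice_measurable:
  assumes g: "orthogonal_matrix g" and e: "\<epsilon> > 0"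
    and en: "\<And>M :: (real^'n) measure. finite_measure M \<Longrightarrow> sets M = sets borel \<Longrightarrow>
       riesz_energy u M = ennreal b * (\<integral>\<^sup>+\<xi>. rk p \<xi> * ennreal ((cmod (four M \<xi>))\<^sup>2) \<partial>lborel)"
  shows "(\<lambda>z. riesz_energy u (slice g z \<epsilon>)) \<in> borel_measurable borel"
proof -
  have [measurable]: "(\<lambda>(z, \<xi>). four (slice g z \<epsilon>) \<xi>) \<in> borel_measurable (borel \<Otimes>\<^sub>M lborel)"
    unfolding four_slice[OF g e] by measurable
  show ?thesis unfolding en[OF finite_slice[OF e] sets_slice] by measurable
qed

lemma (in moll_pair) smooth_meas_gw_eq_kern:
  assumes "orthogonal_matrix g"
  shows "smooth_meas_gw \<psi> \<nu> g (matrix_inv g *v z) \<epsilon> x = kern g z \<epsilon> x"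
  unfolding smooth_meas_gw_def smooth_meas_def kern_def orthogonal_matrix_mult_vec(5)[OF assms]
  by (simp add: matrix_vector_mult_diff_distrib)

lemma bounded_range_compact_support:
  fixes f :: "'a::euclidean_space \<Rightarrow> real"
  assumes "continuous_on UNIV f" "compact (closure {x. f x \<noteq> 0})"
  shows "bounded (range f)"
proof -
  let ?S = "closure {x. f x \<noteq> 0}"
  have "continuous_on ?S f" using assms(1) by (rule continuous_on_subset) simp
  then have "bounded (f ` ?S)" using assms(2) by (intro compact_imp_bounded compact_continuous_image)
  then have "bounded (insert 0 (f ` ?S))" by simp
  moreover have "range f \<subseteq> insert 0 (f ` ?S)"
  proof
    fix y assume "y \<in> range f"
    then obtain x where x: "y = f x" by (rule rangeE)
    show "y \<in> insert 0 (f ` ?S)"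
    proof (cases "f x = 0")
      case False
      then have "x \<in> ?S" by (intro subsetD[OF closure_subset]) simp
      then show ?thesis using x by (intro insertI2) (rule image_eqI)
    qed (simp add: x)
  qed
  ultimately show ?thesis by (rule bounded_subset)
qed

lemma (in moll_pair) weak_conv_at0_slice:
  assumes g: "orthogonal_matrix g"
    and conv: "\<And>f :: real^'n \<Rightarrow> real. continuous_on UNIV f \<Longrightarrow> bounded (range f) \<Longrightarrow>
       ((\<lambda>\<epsilon>. \<integral>x. f x \<partial>slice g z \<epsilon>) \<longlongrightarrow> (\<integral>x. f x \<partial>\<Lambda>)) (at_right 0)"
  shows "weak_conv_at0 (\<lambda>\<epsilon>. density \<mu> (\<lambda>x. ennreal (smooth_meas_gw \<psi> \<nu> g (matrix_inv g *v z) \<epsilon> x))) \<Lambda>"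
proof -
  have "(\<lambda>\<epsilon>. density \<mu> (\<lambda>x. ennreal (smooth_meas_gw \<psi> \<nu> g (matrix_inv g *v z) \<epsilon> x))) = slice g z"
    by (rule ext) (simp only: slice_def smooth_meas_gw_eq_kern[OF g])
  moreover have "weak_conv_at0 (slice g z) \<Lambda>"
    unfolding weak_conv_at0_def
  proof (rule allI, rule impI, elim conjE)
    fix f :: "real^'n \<Rightarrow> real" assume "continuous_on UNIV f" "compact (closure {x. f x \<noteq> 0})"
    then show "((\<lambda>\<epsilon>. \<integral>x. f x \<partial>slice g z \<epsilon>) \<longlongrightarrow> (\<integral>x. f x \<partial>\<Lambda>)) (at_right 0)"
      by (intro conv bounded_range_compact_support)
  qed
  ultimately show ?thesis by (simp only:)
qed

lemma mollifier_props:
  fixes \<psi> :: "real^'n \<Rightarrow> real"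
  assumes "mollifier \<psi>"
  shows "continuous_on UNIV \<psi>" "\<exists>B. \<forall>x. \<psi> x \<le> B"
proof -
  have "Ck 0 \<psi>" using assms unfolding mollifier_def smooth_fun_def by blast
  then show c: "continuous_on UNIV \<psi>" by simp
  have "compact (\<psi> ` cball 0 1)" by (intro compact_continuous_image continuous_on_subset[OF c]) auto
  then obtain B where B: "\<forall>y\<in>\<psi> ` cball 0 1. norm y \<le> B" using compact_imp_bounded bounded_iff by metis
  have "\<psi> x \<le> max B 0" for x
  proof (cases "norm x > 1")
    case True
    then have "\<psi> x = 0" using assms unfolding mollifier_def by blast
    then show ?thesis by simp
  next
    case False
    then have "norm (\<psi> x) \<le> B" using B by auto
    then show ?thesis by simp
  qed
  then show "\<exists>B. \<forall>x. \<psi> x \<le> B" by blast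
qed

theorem theorem3p2:
  fixes s t \<beta> :: real
  assumes "0 < s" "s < CARD('n)" "0 < t" "t < CARD('n)"
    and "s + t - CARD('n) > 0"
    and "\<beta> > 0" "s + t - CARD('n) > CARD('n) - \<beta>"
  shows "\<exists>C>0. \<forall>(\<psi>::real^'n \<Rightarrow> real) (\<mu>::(real^'n) measure) (\<nu>::(real^'n) measure)
            (\<theta>::(real^'n^'n) measure).
     mollifier \<psi> \<and> cs_radon \<mu> \<and> cs_radon \<nu> \<and>
     riesz_energy s \<mu> < \<infinity> \<and> riesz_energy t \<nu> < \<infinity> \<and>
     sets \<theta> = sets borel \<and>
     emeasure \<theta> (- {g. orthogonal_matrix g}) = 0 \<and>
     emeasure \<theta> {g. orthogonal_matrix g} \<le> 1 \<and>
     (\<forall>x z r. x \<noteq> 0 \<longrightarrow> z \<noteq> 0 \<longrightarrow> r > 0 \<longrightarrow>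
        emeasure \<theta> {g. orthogonal_matrix g \<and> norm (x - g *v z) < r}
          \<le> ennreal ((r / norm z) powr \<beta>))
     \<longrightarrow>
     (\<exists>Lam::real^'n^'n \<Rightarrow> real^'n \<Rightarrow> (real^'n) measure.
        (AE (g, z) in \<theta> \<Otimes>\<^sub>M lborel.
            radon_measure (Lam g z) \<and>
            weak_conv_at0
              (\<lambda>\<epsilon>. density \<mu> (\<lambda>x. ennreal (smooth_meas_gw \<psi> \<nu> g (matrix_inv g *v z) \<epsilon> x)))
              (Lam g z) \<and>
            spt (Lam g z) \<subseteq> spt \<mu> \<inter> (\<lambda>x. g *v x + z) ` spt \<nu>) \<and>
        (AE g in \<theta>. (\<integral>\<^sup>+z. emeasure (Lam g z) UNIV \<partial>lborel) = emeasure \<mu> UNIV * emeasure \<nu> UNIV) \<and>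
        (\<integral>\<^sup>+g. (\<integral>\<^sup>+z. riesz_energy (s + t - CARD('n)) (Lam g z) \<partial>lborel) \<partial>\<theta>)
          \<le> ennreal C * riesz_energy s \<mu> * riesz_energy t \<nu>)"
proof -
  define n where "n = real CARD('n)"
  define u where "u = s + t - n"
  define p where "p = n - u"
  have D: "real DIM(real^'n) = n" by (simp add: n_def)
  have u: "0 < u" "u < n" using assms unfolding u_def n_def by linarith+
  obtain bu where bu: "bu > 0" "\<And>M :: (real^'n) measure. finite_measure M \<Longrightarrow> sets M = sets borel \<Longrightarrow>
       riesz_energy u M = ennreal bu * (\<integral>\<^sup>+\<xi>. rk p \<xi> * ennreal ((cmod (four M \<xi>))\<^sup>2) \<partial>lborel)"
    using riesz_energy_four[of u, where 'a="real^'n"] u unfolding D p_def by blast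
  obtain bs where bs: "bs > 0" "\<And>M :: (real^'n) measure. finite_measure M \<Longrightarrow> sets M = sets borel \<Longrightarrow>
       riesz_energy s M = ennreal bs * (\<integral>\<^sup>+\<xi>. rk (n - s) \<xi> * ennreal ((cmod (four M \<xi>))\<^sup>2) \<partial>lborel)"
    using riesz_energy_four[of s, where 'a="real^'n"] assms(1,2) unfolding D n_def[symmetric] by blast
  obtain bt where bt: "bt > 0" "\<And>M :: (real^'n) measure. finite_measure M \<Longrightarrow> sets M = sets borel \<Longrightarrow>
       riesz_energy t M = ennreal bt * (\<integral>\<^sup>+\<xi>. rk (n - t) \<xi> * ennreal ((cmod (four M \<xi>))\<^sup>2) \<partial>lborel)"
    using riesz_energy_four[of t, where 'a="real^'n"] assms(3,4) unfolding D n_def[symmetric] by blast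
  have pst: "p = (n - s) + (n - t)" unfolding p_def u_def by simp
  \<comment> \<open>The last inequality is the hypothesis that u exceeds n - \<beta>.\<close>
  have pq: "n - s > 0" "n - t > 0" "(n - s) + (n - t) < \<beta>" using assms unfolding n_def by linarith+
  obtain Ca where Ca: "Ca > 0"
    "\<And>(\<theta> :: (real^'n^'n) measure) \<xi> \<zeta>. sets \<theta> = sets borel \<Longrightarrow> emeasure \<theta> (- {g. orthogonal_matrix g}) = 0 \<Longrightarrow>
      emeasure \<theta> {g. orthogonal_matrix g} \<le> 1 \<Longrightarrow>
      (\<And>x z r. x \<noteq> 0 \<Longrightarrow> z \<noteq> 0 \<Longrightarrow> r > 0 \<Longrightarrow>
        emeasure \<theta> {g. orthogonal_matrix g \<and> norm (x - g *v z) < r} \<le> ennreal ((r / norm z) powr \<beta>)) \<Longrightarrow>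
      (\<integral>\<^sup>+g. rk p (\<xi> + g *v \<zeta>) \<partial>\<theta>) \<le> ennreal Ca * (rk (n - s) \<xi> * rk (n - t) \<zeta>)"
    unfolding pst by (rule average_rk[OF pq]) blast
  define K where "K = bu / (2 * pi) ^ CARD('n)"
  have K: "K > 0" using bu by (simp add: K_def)
  \<comment> \<open>\<open>K\<close> comes from the energies of the slices, \<open>Ca\<close> from
    averaging over \<theta>, and \<open>1 / bs\<close>, \<open>1 / bt\<close> convert the frequency
    integrals back into energies.\<close>
  define C where "C = K * (Ca * (1 / bs * (1 / bt)))"
  have C: "C > 0" using K Ca(1) bs(1) bt(1) by (simp add: C_def)
  show ?thesis
  proof (intro exI[of _ C] conjI allI impI C, elim conjE)
    fix \<psi> :: "real^'n \<Rightarrow> real" and \<mu> \<nu> :: "(real^'n) measure" and \<theta> :: "(real^'n^'n) measure"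
    assume \<psi>: "mollifier \<psi>" and \<mu>: "cs_radon \<mu>" and \<nu>: "cs_radon \<nu>"
      and Is: "riesz_energy s \<mu> < \<infinity>" and It: "riesz_energy t \<nu> < \<infinity>"
      and s\<theta>: "sets \<theta> = sets borel" and O0: "emeasure \<theta> (- {g. orthogonal_matrix g}) = 0"
      and O1: "emeasure \<theta> {g. orthogonal_matrix g} \<le> 1"
      and hyp: "\<forall>x z r. x \<noteq> 0 \<longrightarrow> z \<noteq> 0 \<longrightarrow> r > 0 \<longrightarrow>
        emeasure \<theta> {g. orthogonal_matrix g \<and> norm (x - g *v z) < r} \<le> ennreal ((r / norm z) powr \<beta>)"
    note s\<theta>[measurable_cong]
    have sp\<theta>: "space \<theta> = UNIV" using sets_eq_imp_space_eq[OF s\<theta>] by simp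
    have AEO: "AE g in \<theta>. orthogonal_matrix g"
      using O0 s\<theta> by (intro AE_I[where N="- {g. orthogonal_matrix g}"]) auto
    have "emeasure \<theta> UNIV = emeasure \<theta> {g. orthogonal_matrix g}"
      using AEO s\<theta> by (intro emeasure_eq_AE) auto
    then have "emeasure \<theta> (space \<theta>) \<noteq> \<infinity>" using O1 sp\<theta> by (auto simp: top_unique)
    then interpret th: finite_measure \<theta> by (rule finite_measureI)
    obtain R where R: "R \<ge> 0" "AE x in \<mu>. norm x \<le> R" using cs_radon_finite(3)[OF \<mu>] by blast
    obtain B where B: "\<And>x. \<psi> x \<le> B" using mollifier_props(2)[OF \<psi>] by blast
    interpret mu: finite_measure \<mu> by (rule cs_radon_finite(1)[OF \<mu>])
    interpret nu: finite_measure \<nu> by (rule cs_radon_finite(1)[OF \<nu>])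
    interpret moll_pair \<mu> \<nu> \<psi> R B
      using \<psi> R B cs_radon_finite(2)[OF \<mu>] cs_radon_finite(2)[OF \<nu>] mollifier_props(1)[OF \<psi>]
      by unfold_locales (auto simp: mollifier_def)
    define lim where "lim g z \<Lambda> \<longleftrightarrow> finite_measure \<Lambda> \<and> sets \<Lambda> = sets borel \<and>
      (\<forall>f :: real^'n \<Rightarrow> real. continuous_on UNIV f \<longrightarrow> bounded (range f) \<longrightarrow>
         ((\<lambda>\<epsilon>. \<integral>x. f x \<partial>slice g z \<epsilon>) \<longlongrightarrow> (\<integral>x. f x \<partial>\<Lambda>)) (at_right 0))" for g z \<Lambda>
    \<comment> \<open>The null measure has zero energy, so the estimate behind (c) holds for every
      \<open>z\<close> once \<open>g\<close> is orthogonal.\<close>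
    define Lam where "Lam g z = (if orthogonal_matrix g \<and> good g z then SOME \<Lambda>. lim g z \<Lambda> else null_measure borel)" for g z
    have Lam: "lim g z (Lam g z)" if "orthogonal_matrix g" "good g z" for g z
    proof -
      have "\<exists>\<Lambda>. lim g z \<Lambda>" unfolding lim_def by (rule good_slice_limit[OF that(2)]) blast
      then show ?thesis using that unfolding Lam_def by (simp add: someI_ex)
    qed
    note limD = Lam[unfolded lim_def, THEN conjunct1] Lam[unfolded lim_def, THEN conjunct2, THEN conjunct1]
      Lam[unfolded lim_def, THEN conjunct2, THEN conjunct2, rule_format]
    let ?e = "\<lambda>j. 1 / real (Suc j)"
    have epos: "?e j > 0" for j by simp
    have energy_g: "(\<integral>\<^sup>+z. riesz_energy u (Lam g z) \<partial>lborel) \<le> ennreal K * Aint p g" if g: "orthogonal_matrix g" for g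
    proof -
      have em: "(\<lambda>z. riesz_energy u (slice g z (?e j))) \<in> borel_measurable lborel" for j
        unfolding measurable_lborel2 by (rule energy_slice_measurable[OF g epos bu(2)])
      \<comment> \<open>Only monotonicity of \<open>nn_integral\<close> is applied to the energies
        of the limits, whose measurability in \<open>z\<close> is not established; Fatou's lemma
        concerns the energies of the slices.\<close>
      have "(\<integral>\<^sup>+z. riesz_energy u (Lam g z) \<partial>lborel) \<le> (\<integral>\<^sup>+z. liminf (\<lambda>j. riesz_energy u (slice g z (?e j))) \<partial>lborel)"
      proof (intro nn_integral_mono)
        fix z
        show "riesz_energy u (Lam g z) \<le> liminf (\<lambda>j. riesz_energy u (slice g z (?e j)))"
        proof (cases "good g z")
          case True
          show ?thesis by (rule energy_slice_limit_le[OF limD[OF g True] bu])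
        next
          case False
          then show ?thesis by (simp add: Lam_def riesz_energy_def)
        qed
      qed
      also have "\<dots> \<le> liminf (\<lambda>j. \<integral>\<^sup>+z. riesz_energy u (slice g z (?e j)) \<partial>lborel)"
        by (rule nn_integral_liminf[OF em])
      also have "\<dots> \<le> liminf (\<lambda>j::nat. ennreal K * Aint p g)"
        unfolding K_def by (intro Liminf_mono always_eventually allI energy_slice_le[OF g epos bu])
      also have "\<dots> = ennreal K * Aint p g" by (simp add: Liminf_const)
      finally show ?thesis .
    qed
    have avg: "(\<integral>\<^sup>+g. Aint p g \<partial>\<theta>) \<le> ennreal (Ca * (1 / bs * (1 / bt))) * (riesz_energy s \<mu> * riesz_energy t \<nu>)"
    proof -
      let ?I = "\<integral>\<^sup>+\<xi>. rk (n - s) \<xi> * ennreal ((cmod (four \<mu> \<xi>))\<^sup>2) \<partial>lborel"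
      let ?J = "\<integral>\<^sup>+\<xi>. rk (n - t) \<xi> * ennreal ((cmod (four \<nu> \<xi>))\<^sup>2) \<partial>lborel"
      have "(\<integral>\<^sup>+g. Aint p g \<partial>\<theta>) \<le> ennreal Ca * (?I * ?J)"
        using hyp by (intro Aint_average s\<theta> th.finite_measure_axioms Ca(2)[OF s\<theta> O0 O1]) blast
      moreover have "?I = ennreal (1 / bs) * riesz_energy s \<mu>"
        unfolding bs(2)[OF mu.finite_measure_axioms sets_mu] mult.assoc[symmetric] using bs(1) by (simp flip: ennreal_mult)
      moreover have "?J = ennreal (1 / bt) * riesz_energy t \<nu>"
        unfolding bt(2)[OF nu.finite_measure_axioms sets_nu] mult.assoc[symmetric] using bt(1) by (simp flip: ennreal_mult)
      moreover have "ennreal (Ca * (1 / bs * (1 / bt))) = ennreal Ca * (ennreal (1 / bs) * ennreal (1 / bt))"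
      proof -
        have "ennreal (Ca * (1 / bs * (1 / bt))) = ennreal Ca * ennreal (1 / bs * (1 / bt))"
          using Ca(1) bs(1) bt(1) by (intro ennreal_mult) auto
        moreover have "ennreal (1 / bs * (1 / bt)) = ennreal (1 / bs) * ennreal (1 / bt)"
          using bs(1) bt(1) by (intro ennreal_mult) auto
        ultimately show ?thesis by (simp only:)
      qed
      ultimately show ?thesis by (simp add: mult_ac)
    qed
    also have "\<dots> < \<infinity>" using Is It by (simp add: ennreal_mult_less_top)
    finally have "(\<integral>\<^sup>+g. Aint p g \<partial>\<theta>) \<noteq> \<infinity>" by simp
    moreover have "Aint p \<in> borel_measurable \<theta>" unfolding Aint_def[abs_def] by measurable
    ultimately have "AE g in \<theta>. Aint p g \<noteq> \<infinity>" by (intro nn_integral_PInf_AE)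
    \<comment> \<open>Finiteness of \<open>Aint p g\<close> bounds the energies of the slices
      uniformly in \<open>\<epsilon>\<close>, and \<open>mass_le_energy\<close> turns this into the
      L2 bound for their masses.\<close>
    with AEO have AEg: "AE g in \<theta>. orthogonal_matrix g \<and> absolutely_continuous lborel (proj g)"
    proof eventually_elim
      case (elim g)
      let ?c = "(2 * R + 1) powr u"
      define E where "E = enn2real (ennreal ?c * (ennreal K * Aint p g))"
      have fin: "ennreal ?c * (ennreal K * Aint p g) < \<infinity>" using elim(2) by (simp add: ennreal_mult_less_top less_top)
      have "(\<integral>\<^sup>+z. emeasure (slice g z \<epsilon>) UNIV * emeasure (slice g z \<epsilon>) UNIV \<partial>lborel) \<le> ennreal E" if e: "\<epsilon> > 0" for \<epsilon>
      proof -
        have "(\<integral>\<^sup>+z. emeasure (slice g z \<epsilon>) UNIV * emeasure (slice g z \<epsilon>) UNIV \<partial>lborel)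
          \<le> (\<integral>\<^sup>+z. ennreal ?c * riesz_energy u (slice g z \<epsilon>) \<partial>lborel)"
          by (intro nn_integral_mono mass_le_energy e u)
        also have "\<dots> = ennreal ?c * (\<integral>\<^sup>+z. riesz_energy u (slice g z \<epsilon>) \<partial>lborel)"
          using energy_slice_measurable[OF elim(1) e bu(2)] by (intro nn_integral_cmult) simp
        also have "\<dots> \<le> ennreal ?c * (ennreal K * Aint p g)"
          unfolding K_def by (intro mult_left_mono energy_slice_le[OF elim(1) e bu]) simp_all
        also have "\<dots> = ennreal E" unfolding E_def using fin by simp
        finally show ?thesis .
      qed
      then show ?case using elim(1) proj_absolutely_continuous[OF elim(1)] by blast
    qed
    have goodset: "{q \<in> space (\<theta> \<Otimes>\<^sub>M lborel). orthogonal_matrix (fst q) \<and> good (fst q) (snd q)} \<in> sets (\<theta> \<Otimes>\<^sub>M lborel)"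
    proof -
      have se: "sets (\<theta> \<Otimes>\<^sub>M lborel) = sets ((borel :: (real^'n^'n) measure) \<Otimes>\<^sub>M (borel :: (real^'n) measure))"
        by (intro sets_pair_measure_cong s\<theta> sets_lborel)
      have "{q \<in> space ((borel :: (real^'n^'n) measure) \<Otimes>\<^sub>M (borel :: (real^'n) measure)). orthogonal_matrix (fst q)} \<in> sets (borel \<Otimes>\<^sub>M borel)"
        by measurable
      moreover have "{q \<in> space (\<theta> \<Otimes>\<^sub>M lborel). orthogonal_matrix (fst q) \<and> good (fst q) (snd q)}
        = {q \<in> space (borel \<Otimes>\<^sub>M borel). orthogonal_matrix (fst q)} \<inter> {q. good (fst q) (snd q)}"
        by (auto simp: space_pair_measure sp\<theta>)
      ultimately show ?thesis unfolding se using good_measurable by auto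
    qed
    have AEgood: "AE q in \<theta> \<Otimes>\<^sub>M lborel. orthogonal_matrix (fst q) \<and> good (fst q) (snd q)"
    proof (rule pair_sigma_finite.AE_pair_measure[OF _ goodset])
      show "pair_sigma_finite \<theta> (lborel :: (real^'n) measure)" ..
      show "AE g in \<theta>. AE z in lborel. orthogonal_matrix (fst (g, z)) \<and> good (fst (g, z)) (snd (g, z))"
        using AEg by eventually_elim (use AE_good in auto)
    qed
    have a: "AE (g, z) in \<theta> \<Otimes>\<^sub>M lborel.
            radon_measure (Lam g z) \<and>
            weak_conv_at0
              (\<lambda>\<epsilon>. density \<mu> (\<lambda>x. ennreal (smooth_meas_gw \<psi> \<nu> g (matrix_inv g *v z) \<epsilon> x)))
              (Lam g z) \<and>
            spt (Lam g z) \<subseteq> spt \<mu> \<inter> (\<lambda>x. g *v x + z) ` spt \<nu>"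
      using AEgood
    proof eventually_elim
      case (elim q)
      obtain g z where q: "q = (g, z)" by (cases q)
      have g: "orthogonal_matrix g" and z: "good g z" using elim by (auto simp: q)
      note L = limD[OF g z]
      interpret L: finite_measure "Lam g z" by (rule L(1))
      have 1: "radon_measure (Lam g z)"
        unfolding radon_measure_def using L(2) L.emeasure_finite by (simp add: less_top[symmetric])
      have 2: "weak_conv_at0 (\<lambda>\<epsilon>. density \<mu> (\<lambda>x. ennreal (smooth_meas_gw \<psi> \<nu> g (matrix_inv g *v z) \<epsilon> x))) (Lam g z)"
        by (rule weak_conv_at0_slice[OF g L(3)])
      have 3: "spt (Lam g z) \<subseteq> spt \<mu> \<inter> (\<lambda>x. g *v x + z) ` spt \<nu>" by (rule spt_slice_limit[OF g L])
      show ?case unfolding q using 1 2 3 by simp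
    qed
    have b: "AE g in \<theta>. (\<integral>\<^sup>+z. emeasure (Lam g z) UNIV \<partial>lborel) = emeasure \<mu> UNIV * emeasure \<nu> UNIV"
      using AEg
    proof eventually_elim
      case (elim g)
      then have g: "orthogonal_matrix g" and ac: "absolutely_continuous lborel (proj g)" by auto
      obtain h :: "real^'n \<Rightarrow> real" where h: "h \<in> borel_measurable borel" "\<And>z. h z \<ge> 0"
        "(\<integral>\<^sup>+z. ennreal (h z) \<partial>lborel) = (\<integral>\<^sup>+x. ennreal 1 \<partial>\<mu>) * emeasure \<nu> UNIV"
        "AE z in lborel. ((\<lambda>\<epsilon>. \<integral>x. 1 * kern g z \<epsilon> x \<partial>\<mu>) \<longlongrightarrow> h z) (at_right 0)"
        by (rule wproj_limit[OF g ac, of "\<lambda>_. 1" 1, OF borel_measurable_const zero_le_one order_refl],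
            rule that, assumption, erule meta_spec, assumption+)
      \<comment> \<open>Both sides are limits of the total masses of the slices; no mass is lost
        because 1 is an admissible test function in \<open>lim\<close>.\<close>
      have "AE z in lborel. emeasure (Lam g z) UNIV = ennreal (h z)"
        using AE_good[OF g ac] h(4)
      proof eventually_elim
        case (elim z)
        note L = limD[OF g elim(1)]
        interpret L: finite_measure "Lam g z" by (rule L(1))
        have spL: "space (Lam g z) = UNIV" using sets_eq_imp_space_eq[OF L(2)] by simp
        have "((\<lambda>\<epsilon>. \<integral>x. (1::real) \<partial>slice g z \<epsilon>) \<longlongrightarrow> (\<integral>x. 1 \<partial>Lam g z)) (at_right 0)"
          by (rule L(3)) auto
        moreover have "((\<lambda>\<epsilon>. \<integral>x. (1::real) \<partial>slice g z \<epsilon>) \<longlongrightarrow> h z) (at_right 0)"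
        proof (rule Lim_transform_eventually[OF elim(2)])
          show "\<forall>\<^sub>F \<epsilon> in at_right 0. (\<integral>x. 1 * kern g z \<epsilon> x \<partial>\<mu>) = (\<integral>x. (1::real) \<partial>slice g z \<epsilon>)"
            using eventually_at_right_less[of 0] by eventually_elim (rule integral_slice_real[symmetric], auto)
        qed
        ultimately have "(\<integral>x. (1::real) \<partial>Lam g z) = h z" by (intro tendsto_unique[of "at_right (0::real)"]) auto
        then show ?case by (simp add: L.emeasure_eq_measure spL)
      qed
      then have "(\<integral>\<^sup>+z. emeasure (Lam g z) UNIV \<partial>lborel) = (\<integral>\<^sup>+z. ennreal (h z) \<partial>lborel)" by (rule nn_integral_cong_AE)
      then show ?case using h(3) by simp
    qed
    have c: "(\<integral>\<^sup>+g. (\<integral>\<^sup>+z. riesz_energy (s + t - CARD('n)) (Lam g z) \<partial>lborel) \<partial>\<theta>)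
          \<le> ennreal C * riesz_energy s \<mu> * riesz_energy t \<nu>"
    proof -
      have "(\<integral>\<^sup>+g. (\<integral>\<^sup>+z. riesz_energy u (Lam g z) \<partial>lborel) \<partial>\<theta>) \<le> (\<integral>\<^sup>+g. ennreal K * Aint p g \<partial>\<theta>)"
        by (rule nn_integral_mono_AE) (use AEO energy_g in \<open>auto elim: eventually_mono\<close>)
      also have "\<dots> = ennreal K * (\<integral>\<^sup>+g. Aint p g \<partial>\<theta>)"
        using \<open>Aint p \<in> borel_measurable \<theta>\<close> by (rule nn_integral_cmult)
      also have "\<dots> \<le> ennreal K * (ennreal (Ca * (1 / bs * (1 / bt))) * (riesz_energy s \<mu> * riesz_energy t \<nu>))"
        by (intro mult_left_mono avg) simp_all
      also have "\<dots> = (ennreal K * ennreal (Ca * (1 / bs * (1 / bt)))) * riesz_energy s \<mu> * riesz_energy t \<nu>"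
        by (simp only: mult.assoc)
      also have "ennreal K * ennreal (Ca * (1 / bs * (1 / bt))) = ennreal C"
        unfolding C_def using K Ca(1) bs(1) bt(1) by (intro ennreal_mult[symmetric]) auto
      finally show ?thesis unfolding u_def n_def .
    qed
    show "\<exists>Lam::real^'n^'n \<Rightarrow> real^'n \<Rightarrow> (real^'n) measure.
        (AE (g, z) in \<theta> \<Otimes>\<^sub>M lborel.
            radon_measure (Lam g z) \<and>
            weak_conv_at0
              (\<lambda>\<epsilon>. density \<mu> (\<lambda>x. ennreal (smooth_meas_gw \<psi> \<nu> g (matrix_inv g *v z) \<epsilon> x)))
              (Lam g z) \<and>
            spt (Lam g z) \<subseteq> spt \<mu> \<inter> (\<lambda>x. g *v x + z) ` spt \<nu>) \<and>
        (AE g in \<theta>. (\<integral>\<^sup>+z. emeasure (Lam g z) UNIV \<partial>lborel) = emeasure \<mu> UNIV * emeasure \<nu> UNIV) \<and>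
        (\<integral>\<^sup>+g. (\<integral>\<^sup>+z. riesz_energy (s + t - CARD('n)) (Lam g z) \<partial>lborel) \<partial>\<theta>)
          \<le> ennreal C * riesz_energy s \<mu> * riesz_energy t \<nu>"
      by (intro exI[of _ Lam] conjI a b c)
  qed
qed

end
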